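(* Let $p_0=1$, $p_1=p_2\in(1/2,1)$, and $p_3=0$. Let $\mu_B^N$ (resp., $\mu_C^N$) denote the mean profit per player per unit of time to an ensemble of $N\ge1$ consecutive players always playing game $B$ (resp., game $C$) in the spin system on ${\bf Z}$, assuming that the initial distribution is concentrated on $S$. Then $\mu_B^N=0$ for all even $N\ge2$, $\mu_B^N$ does not exist for all odd $N\ge1$, and $\mu_C^N>0$ for all $N\ge1$. In particular, the Parrondo effect (that is, $\mu_B^N\le0$ and $\mu_C^N>0$) is present if and only if $N$ is even.
   Context: Spin system with parameters $p_0,p_1,p_2,p_3\in[0,1]$ (game $B$). State space $\{0,1\}^{\bf Z}$; $x_i$ is the status of player $i$ (0 = loser, 1 = winner); $m_i(\boldsymbol x):=2x_{i-1}+x_{i+1}$; $q_m:=1-p_m$. The spin system $\{\boldsymbol X(t)\}_{t\ge0}$ is the Feller process with flip rate at site $i$ equal to $c_i(\boldsymbol x)=p_{m_i(\boldsymbol x)}$ if $x_i=0$ and $c_i(\boldsymbol x)=q_{m_i(\boldsymbol x)}$ if $x_i=1$. To define profits it is realized as follows: each player plays at the times of a rate 1 Poisson process, these Poisson processes being independent over players; when player $i$ plays and the state just before is $\boldsymbol x$, he wins one unit (his status becomes 1) with probability $p_{m_i(\boldsymbol x)}$ and loses one unit (his status becomes 0) with probability $q_{m_i(\boldsymbol x)}$. (Thus a winner may win again and a loser may lose again; these plays do not change the state but count towards the profit.) Game $C$ is the same model with each $p_m$ replaced by $(1/2+p_m)/2$, $m=0,1,2,3$. $S$ is the countable subset of $\{0,1\}^{\bf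 Z}$ consisting of the states with alternating 0s and 1s with the single exception of one pair of adjacent 0s or one pair of adjacent 1s. For a set $A\subset{\bf Z}$ of $N$ consecutive players, let $\hat S_t^A$ be the cumulative profit per player up to time $t$ (the total profit of the players in $A$ divided by $N$). The mean profit per player per unit of time is the constant $\mu$ such that $t^{-1}\hat S_t^A\to\mu$ almost surely as $t\to\infty$, if there is such a constant; otherwise it does not exist. *)

theory Defs
  imports "HOL-Probability.Probability"
begin

type_synonym config = "int \<Rightarrow> bool"

(* \<open>p m\<close> is the winning probability for neighbourhood type m; only m = 0, 1, 2, 3 matter. *)
type_synonym game = "nat \<Rightarrow> real"

definition nbhd :: "config \<Rightarrow> int \<Rightarrow> nat" where
  "nbhd x i = 2 * of_bool (x (i - 1)) + of_bool (x (i + 1))"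

definition game_C :: "game \<Rightarrow> game" where
  "game_C p m = (1 / 2 + p m) / 2"

(* S; the unique i is the left element of the single pair of equal adjacent symbols. *)
definition almost_alternating :: "config set" where
  "almost_alternating = {x. \<exists>!i. x i = x (i + 1)}"

definition config_space :: "config measure" where
  "config_space = (\<Pi>\<^sub>M i\<in>UNIV. count_space UNIV)"

definition concentrated_on_S :: "config measure \<Rightarrow> bool" where
  "concentrated_on_S \<nu> \<longleftrightarrow>
     prob_space \<nu> \<and> sets \<nu> = sets config_space \<and> measure \<nu> almost_alternating = 1"


text \<open>
  Graphical construction. A sample point consists of the initial configuration, the waiting times
  between successive plays (i.i.d. exponential with parameter 1, so that every player plays at the
  times of a rate 1 Poisson process, independently over players), and a uniform mark for every play;
  the index \<open>(i, n)\<close> refers to play number \<open>n\<close> (counted from 0) of player \<open>i\<close>.  A player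
  who plays in the configuration x just before the play wins iff his mark is below
  \<open>p (nbhd x i)\<close>, which happens with that probability; consequently site i flips
  from 0 to 1 at rate \<open>p (nbhd x i)\<close> and from 1 to 0 at rate \<open>1 - p (nbhd x i)\<close>.
\<close>

type_synonym sample = "config \<times> (int \<times> nat \<Rightarrow> real) \<times> (int \<times> nat \<Rightarrow> real)"

definition sample_space :: "config measure \<Rightarrow> sample measure" where
  "sample_space \<nu> =
     \<nu> \<Otimes>\<^sub>M ((\<Pi>\<^sub>M k\<in>UNIV. density lborel (exponential_density 1))
        \<Otimes>\<^sub>M (\<Pi>\<^sub>M k\<in>UNIV. uniform_measure lborel {0..1}))"

definition init :: "sample \<Rightarrow> config" where
  "init \<omega> = fst \<omega>"

definition play_time :: "sample \<Rightarrow> int \<Rightarrow> nat \<Rightarrow> real" where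
  "play_time \<omega> i n = (\<Sum>k\<le>n. fst (snd \<omega>) (i, k))"

definition mark :: "sample \<Rightarrow> int \<Rightarrow> nat \<Rightarrow> real" where
  "mark \<omega> i n = snd (snd \<omega>) (i, n)"

(* The configuration X(t-) when w i n tells whether player i wins his play number n: the status of
   a player is the result of his last play before t, and his initial status if there is none. *)
definition config_before :: "sample \<Rightarrow> (int \<Rightarrow> nat \<Rightarrow> bool) \<Rightarrow> real \<Rightarrow> config" where
  "config_before \<omega> w t i =
     (case card {n. play_time \<omega> i n < t} of 0 \<Rightarrow> init \<omega> i | Suc k \<Rightarrow> w i k)"

definition follows_game :: "game \<Rightarrow> sample \<Rightarrow> (int \<Rightarrow> nat \<Rightarrow> bool) \<Rightarrow> bool" where
  "follows_game p \<omega> w \<longleftrightarrow>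
     (\<forall>i n. w i n \<longleftrightarrow> mark \<omega> i n < p (nbhd (config_before \<omega> w (play_time \<omega> i n)) i))"

(* Almost surely there is exactly one solution: the result of a play is determined by the results of
   earlier plays of the two neighbours, and almost surely no play has an infinite chain of
   predecessors (for a given last player, the expected number of chains of n plays in a time window
   of length t is at most 2^n t^n / n!). *)
definition wins :: "game \<Rightarrow> sample \<Rightarrow> int \<Rightarrow> nat \<Rightarrow> bool" where
  "wins p \<omega> = (THE w. follows_game p \<omega> w)"

definition profit_per_player :: "game \<Rightarrow> int set \<Rightarrow> sample \<Rightarrow> real \<Rightarrow> real" where
  "profit_per_player p A \<omega> t =
     (\<Sum>i\<in>A. \<Sum>n | play_time \<omega> i n \<le> t. if wins p \<omega> i n then 1 else - 1) / real (card A)"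

definition has_mean_profit :: "game \<Rightarrow> config measure \<Rightarrow> int set \<Rightarrow> real \<Rightarrow> bool" where
  "has_mean_profit p \<nu> A \<mu> \<longleftrightarrow>
     (AE \<omega> in sample_space \<nu>. ((\<lambda>t. profit_per_player p A \<omega> t / t) \<longlongrightarrow> \<mu>) at_top)"

definition parrondo_effect :: "game \<Rightarrow> config measure \<Rightarrow> int set \<Rightarrow> bool" where
  "parrondo_effect p \<nu> A \<longleftrightarrow>
     (\<exists>\<mu>B \<mu>C. has_mean_profit p \<nu> A \<mu>B \<and> has_mean_profit (game_C p) \<nu> A \<mu>C \<and> \<mu>B \<le> 0 \<and> \<mu>C > 0)"

definition consecutive :: "int \<Rightarrow> nat \<Rightarrow> int set" where
  "consecutive a N = {a..<a + int N}"

end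

theory Submission
  imports Defs
begin

text \<open>
  The states of S are the alternating configurations with a single defect, and game B stays in this
  class: the defect performs a nearest neighbour random walk whose jump rates to the left and to the
  right are equal, and a player away from the defect gains at rate 1 or -1, with a sign that
  alternates in space and is reversed when the defect passes him. The defect spends a vanishing
  proportion of time near the ensemble, so for even N the gains cancel. For odd N the average profit
  follows the side on which the defect is; by diffusive scaling, with a probability that is bounded
  below, the defect stays on a prescribed side during most of \<open>[0, t]\<close>, so there is no limit.

  For game C the discrepancies between two copies driven by the same noise decay exponentially, so a
  law of large numbers holds, and the limiting winning probability \<open>\<rho>\<close> of a player
  satisfies \<open>\<rho> = 3/4 - \<rho>/2 + (r - 1/2) D\<close>, where \<open>r\<close> is the common value of
  \<open>p 1\<close> and \<open>p 2\<close> in game C and \<open>D > 0\<close> is the limiting probability that his two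
  neighbours have different status; hence \<open>\<rho> > 1/2\<close>.
\<close>

text \<open>Infinitely many players play in every time interval, so the system has no first play and
  no jump chain, and even the existence of outcomes needs an argument. All probability therefore
  passes through time blocks of length h and finite windows of players: in one block, up to
  probability O(h^2), a window sees at most one play. This expansion, iterated over t / h blocks,
  takes the place of the generator.

  The profit is compared with averages of state functions at the times k h. The error of this
  comparison does not vanish as t grows, only as h does; hence the statements for whole sequences of
  meshes.

  The jump rate of the defect depends on the parity of its position. What is needed of it comes from
  test functions with one-sided bounds on their second differences, which work for every rate
  between the minimum of p and 1 - p and the value 1.

  In game C the contraction constant is 2 r - 1/2, which is less than 1 because r < 3/4.\<close>

lemma nn_integral_PiM_prod:
  assumes "prob_space M" "finite J" "\<And>j. j \<in> J \<Longrightarrow> f j \<in> borel_measurable M"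
  shows "(\<integral>\<^sup>+x. (\<Prod>j\<in>J. f j (x j)) \<partial>PiM UNIV (\<lambda>_. M)) = (\<Prod>j\<in>J. \<integral>\<^sup>+x. f j x \<partial>M)"
proof -
  interpret M: prob_space M by fact
  interpret product_prob_space "\<lambda>_. M" UNIV by unfold_locales
  note assms(3)[measurable]
  have "(\<integral>\<^sup>+x. (\<Prod>j\<in>J. f j (x j)) \<partial>PiM UNIV (\<lambda>_. M))
      = (\<integral>\<^sup>+x. (\<Prod>j\<in>J. f j (restrict x J j)) \<partial>PiM UNIV (\<lambda>_. M))"
    by (intro nn_integral_cong prod.cong) auto
  also have "\<dots> = (\<integral>\<^sup>+x. (\<Prod>j\<in>J. f j (x j)) \<partial>distr (PiM UNIV (\<lambda>_. M)) (PiM J (\<lambda>_. M)) (\<lambda>x. restrict x J))"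
    by (subst nn_integral_distr) auto
  also have "\<dots> = (\<integral>\<^sup>+x. (\<Prod>j\<in>J. f j (x j)) \<partial>PiM J (\<lambda>_. M))"
    using distr_PiM_restrict_finite[of J] assms(2) by simp
  also have "\<dots> = (\<Prod>j\<in>J. \<integral>\<^sup>+x. f j x \<partial>M)"
    by (rule product_nn_integral_prod) (use assms in auto)
  finally show ?thesis .
qed

text \<open>Combining two independent i.i.d. families coordinate by coordinate keeps independence,
  so only the law of a single pair has to be checked. Used with the splicing map, to restart the
  noise of all players at a fixed time, and with the identity, to merge waiting times and
  marks.\<close>

lemma distr_PiM_zip:
  assumes M: "prob_space M" and N: "prob_space N"
    and g[measurable]: "g \<in> measurable (M \<Otimes>\<^sub>M N) K" and K: "distr (M \<Otimes>\<^sub>M N) K g = K"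
  shows "distr (PiM UNIV (\<lambda>_. M) \<Otimes>\<^sub>M PiM UNIV (\<lambda>_. N)) (PiM (UNIV :: 'i set) (\<lambda>_. K))
    (\<lambda>(x, y) i. g (x i, y i)) = PiM UNIV (\<lambda>_. K)"
    (is "distr (?M \<Otimes>\<^sub>M ?N) ?K ?g = ?K")
proof -
  interpret M: prob_space M by fact
  interpret N: prob_space N by fact
  interpret MN: pair_prob_space M N by unfold_locales
  interpret K: prob_space K by (subst K[symmetric], rule MN.prob_space_distr) simp
  interpret product_prob_space "\<lambda>_. K" UNIV by unfold_locales
  interpret PM: product_prob_space "\<lambda>_. M" UNIV by unfold_locales
  interpret PN: product_prob_space "\<lambda>_. N" UNIV by unfold_locales
  have gm[measurable]: "?g \<in> measurable (?M \<Otimes>\<^sub>M ?N) ?K"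
    unfolding split_beta' by (intro measurable_abs_UNIV) measurable
  show ?thesis
  proof (rule PiM_eq)
    fix J :: "'i set" and F assume J: "finite J" "J \<subseteq> UNIV" and F: "\<And>j. j \<in> J \<Longrightarrow> F j \<in> sets K"
    note F[measurable]
    have FS: "prod_emb UNIV (\<lambda>_. K) J (\<Pi>\<^sub>E j\<in>J. F j) \<in> sets ?K"
      using J F by (intro sets_PiM_I) auto
    have "emeasure (distr (?M \<Otimes>\<^sub>M ?N) ?K ?g) (prod_emb UNIV (\<lambda>_. K) J (\<Pi>\<^sub>E j\<in>J. F j))
        = (\<integral>\<^sup>+z. indicator (prod_emb UNIV (\<lambda>_. K) J (\<Pi>\<^sub>E j\<in>J. F j)) z \<partial>distr (?M \<Otimes>\<^sub>M ?N) ?K ?g)"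
      using FS by simp
    also have "\<dots> = (\<integral>\<^sup>+z. indicator (prod_emb UNIV (\<lambda>_. K) J (\<Pi>\<^sub>E j\<in>J. F j)) (?g z) \<partial>(?M \<Otimes>\<^sub>M ?N))"
      using FS by (intro nn_integral_distr) auto
    also have "\<dots> = (\<integral>\<^sup>+z. (\<Prod>j\<in>J. indicator (F j) (g (fst z j, snd z j))) \<partial>(?M \<Otimes>\<^sub>M ?N))"
    proof (intro nn_integral_cong)
      fix z assume z: "z \<in> space (?M \<Otimes>\<^sub>M ?N)"
      then have "?g z \<in> space ?K" using gm by (rule measurable_space[rotated])
      then show "indicator (prod_emb UNIV (\<lambda>_. K) J (\<Pi>\<^sub>E j\<in>J. F j)) (?g z)
          = (\<Prod>j\<in>J. indicator (F j) (g (fst z j, snd z j)) :: ennreal)"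
        using J by (auto simp: indicator_def prod_emb_def space_PiM PiE_iff prod_zero_iff split_beta' restrict_def extensional_def
            intro!: prod_zero[symmetric] prod.neutral[symmetric] split: if_splits)
    qed
    also have "\<dots> = (\<integral>\<^sup>+x. \<integral>\<^sup>+y. (\<Prod>j\<in>J. indicator (F j) (g (x j, y j))) \<partial>?N \<partial>?M)"
      by (subst PN.nn_integral_fst[symmetric]) (auto intro!: borel_measurable_prod_ennreal)
    also have "\<dots> = (\<integral>\<^sup>+x. (\<Prod>j\<in>J. \<integral>\<^sup>+y. indicator (F j) (g (x j, y)) \<partial>N) \<partial>?M)"
    proof (intro nn_integral_cong)
      fix x assume "x \<in> space ?M"
      then have [measurable]: "x j \<in> space M" for j by (auto simp: space_PiM)
      show "(\<integral>\<^sup>+y. (\<Prod>j\<in>J. indicator (F j) (g (x j, y j))) \<partial>?N) = (\<Prod>j\<in>J. \<integral>\<^sup>+y. indicator (F j) (g (x j, y)) \<partial>N)"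
        using J by (intro nn_integral_PiM_prod[OF N, where f="\<lambda>j y. indicator (F j) (g (x j, y))"]) auto
    qed
    also have "\<dots> = (\<Prod>j\<in>J. \<integral>\<^sup>+x. \<integral>\<^sup>+y. indicator (F j) (g (x, y)) \<partial>N \<partial>M)"
      using J by (intro nn_integral_PiM_prod[OF M, where f="\<lambda>j x. \<integral>\<^sup>+y. indicator (F j) (g (x, y)) \<partial>N"]) auto
    also have "\<dots> = (\<Prod>j\<in>J. emeasure K (F j))"
    proof (intro prod.cong refl)
      fix j assume j: "j \<in> J"
      have "(\<integral>\<^sup>+x. \<integral>\<^sup>+y. indicator (F j) (g (x, y)) \<partial>N \<partial>M) = (\<integral>\<^sup>+z. indicator (F j) (g z) \<partial>(M \<Otimes>\<^sub>M N))"
        using j by (subst N.nn_integral_fst[symmetric]) auto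
      also have "\<dots> = (\<integral>\<^sup>+z. indicator (F j) z \<partial>distr (M \<Otimes>\<^sub>M N) K g)"
        using j F by (intro nn_integral_distr[symmetric]) auto
      finally show "(\<integral>\<^sup>+x. \<integral>\<^sup>+y. indicator (F j) (g (x, y)) \<partial>N \<partial>M) = emeasure K (F j)"
        using j F K by simp
    qed
    finally show "emeasure (distr (?M \<Otimes>\<^sub>M ?N) ?K ?g) (prod_emb UNIV (\<lambda>_. K) J (\<Pi>\<^sub>E j\<in>J. F j))
      = (\<Prod>j\<in>J. emeasure K (F j))" .
  qed simp
qed

section \<open>The noise as one i.i.d. sequence of plays per player\<close>

definition step_law :: "(real \<times> real) measure" where
  "step_law = density lborel (exponential_density 1) \<Otimes>\<^sub>M uniform_measure lborel {0..1}"

definition site_law :: "(nat \<Rightarrow> real \<times> real) measure" where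
  "site_law = PiM UNIV (\<lambda>_. step_law)"

text \<open>Players first, plays second, unlike the two families over pairs in
  \<open>sample_space\<close>: restarting at a fixed time acts on the whole sequence of a player,
  which must therefore be one coordinate.\<close>

definition noise_law :: "(int \<Rightarrow> nat \<Rightarrow> real \<times> real) measure" where
  "noise_law = PiM UNIV (\<lambda>_. site_law)"

interpretation wait: prob_space "density lborel (exponential_density 1)"
  by (rule prob_space_exponential_density) simp

interpretation unif: prob_space "uniform_measure lborel {0..1::real}"
  by (rule prob_space_uniform_measure) auto

interpretation step: prob_space step_law
  unfolding step_law_def by (rule prob_space_pair) unfold_locales

interpretation site: sequence_space step_law
  rewrites "PiM UNIV (\<lambda>_. step_law) = site_law"
  by unfold_locales (simp add: site_law_def)

interpretation noise: product_prob_space "\<lambda>_. site_law" "UNIV :: int set"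
  rewrites "PiM UNIV (\<lambda>_. site_law) = noise_law"
  by unfold_locales (auto simp: noise_law_def)

lemma sets_step_law[measurable_cong]: "sets step_law = sets (borel \<Otimes>\<^sub>M borel)"
  unfolding step_law_def by (intro sets_pair_measure_cong) auto

lemma sets_site_law[measurable_cong]: "sets site_law = sets (PiM UNIV (\<lambda>_. borel \<Otimes>\<^sub>M borel))"
  unfolding site_law_def by (intro sets_PiM_cong) (auto simp: sets_step_law)

lemma sets_noise_law[measurable_cong]:
  "sets noise_law = sets (PiM UNIV (\<lambda>_. PiM UNIV (\<lambda>_. borel \<Otimes>\<^sub>M borel)))"
  unfolding noise_law_def by (intro sets_PiM_cong) (auto simp: sets_site_law)

lemma space_noise_law[simp]: "space noise_law = UNIV"
  using sets_eq_imp_space_eq[OF sets_noise_law] by (auto simp: space_PiM space_pair_measure)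

lemma space_site_law[simp]: "space site_law = UNIV"
  using sets_eq_imp_space_eq[OF sets_site_law] by (auto simp: space_PiM space_pair_measure)

lemma space_step_law[simp]: "space step_law = UNIV"
  using sets_eq_imp_space_eq[OF sets_step_law] by (auto simp: space_pair_measure)

subsection \<open>Memorylessness\<close>

text \<open>The density at \<open>s + y\<close> is \<open>exp (- s)\<close> times the density at
  \<open>y\<close>, so the integral of \<open>g\<close> over the tail \<open>{s..}\<close> is
  \<open>exp (- s)\<close> times the constant \<open>C\<close>. The tail itself has mass
  \<open>exp (- s)\<close>, hence replacing \<open>g\<close> by \<open>C\<close> on it changes
  nothing.\<close>

lemma exponential_memoryless:
  fixes g :: "real \<Rightarrow> ennreal"
  assumes [measurable]: "g \<in> borel_measurable borel" and s: "s \<ge> 0"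
  defines "E \<equiv> density lborel (exponential_density 1)"
  shows "(\<integral>\<^sup>+x. (if x < s then g x else (\<integral>\<^sup>+y. g (s + y) \<partial>E)) \<partial>E) = (\<integral>\<^sup>+x. g x \<partial>E)"
proof -
  define C where "C = (\<integral>\<^sup>+y. g (s + y) \<partial>E)"
  let ?d = "\<lambda>x. ennreal (exponential_density 1 x)"
  interpret E: prob_space E unfolding E_def by (rule prob_space_exponential_density) simp
  have [simp]: "sets E = sets borel" "space E = UNIV" by (simp_all add: E_def)
  have tail: "emeasure E {s..} = ennreal (exp (- s))"
  proof -
    have "emeasure E {x \<in> space E. s < x} = ennreal (exp (- s))"
    proof -
      have "distributed E lborel (\<lambda>x. x) (exponential_density 1)"
        by (auto simp: distributed_def E_def distr_id[unfolded id_def] intro!: distr_id2)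
      from E.exponential_distributedD_gt[OF this s] show ?thesis
        by (simp add: E.emeasure_eq_measure)
    qed
    moreover have "emeasure E {s..} = emeasure E {x \<in> space E. s < x}"
    proof (rule emeasure_eq_AE)
      have "AE x in lborel. x \<noteq> s" by (rule AE_lborel_singleton)
      then show "AE x in E. (x \<in> {s..}) = (x \<in> {x \<in> space E. s < x})"
        unfolding E_def by (subst AE_density) auto
    qed auto
    ultimately show ?thesis by simp
  qed
  have "C = (\<integral>\<^sup>+y. ?d y * g (s + y) \<partial>lborel)"
    unfolding C_def E_def by (subst nn_integral_density) auto
  also have "\<dots> = (\<integral>\<^sup>+x. ?d (x - s) * g x \<partial>lborel)"
    by (subst nn_integral_real_affine[where c=1 and t="-s"]) (auto simp: algebra_simps)
  finally have "C * ennreal (exp (- s)) = (\<integral>\<^sup>+x. ennreal (exp (- s)) * (?d (x - s) * g x) \<partial>lborel)"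
    by (subst nn_integral_cmult) (auto simp: mult.commute)
  also have "\<dots> = (\<integral>\<^sup>+x. ?d x * (g x * indicator {s..} x) \<partial>lborel)"
  proof (intro nn_integral_cong)
    fix x :: real
    show "ennreal (exp (- s)) * (?d (x - s) * g x) = ?d x * (g x * indicator {s..} x)"
      using s by (auto simp: exponential_density_def indicator_def mult.assoc[symmetric] ennreal_mult[symmetric]
          exp_add[symmetric] split: if_splits)
  qed
  also have "\<dots> = (\<integral>\<^sup>+x. g x * indicator {s..} x \<partial>E)"
    unfolding E_def by (subst nn_integral_density) auto
  finally have *: "C * ennreal (exp (- s)) = (\<integral>\<^sup>+x. g x * indicator {s..} x \<partial>E)" .
  have "(\<integral>\<^sup>+x. (if x < s then g x else C) \<partial>E) = (\<integral>\<^sup>+x. g x * indicator {..<s} x + C * indicator {s..} x \<partial>E)"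
    by (intro nn_integral_cong) (auto simp: indicator_def)
  also have "\<dots> = (\<integral>\<^sup>+x. g x * indicator {..<s} x \<partial>E) + (\<integral>\<^sup>+x. g x * indicator {s..} x \<partial>E)"
  proof (subst nn_integral_add)
    have "(\<integral>\<^sup>+x. C * indicator {s..} x \<partial>E) = C * emeasure E {s..}"
      by (rule nn_integral_cmult_indicator) simp
    then show "(\<integral>\<^sup>+x. g x * indicator {..<s} x \<partial>E) + (\<integral>\<^sup>+x. C * indicator {s..} x \<partial>E)
      = (\<integral>\<^sup>+x. g x * indicator {..<s} x \<partial>E) + (\<integral>\<^sup>+x. g x * indicator {s..} x \<partial>E)"
      using * tail by simp
  qed (auto simp: E_def)
  also have "\<dots> = (\<integral>\<^sup>+x. g x \<partial>E)"
    by (subst nn_integral_add[symmetric]) (auto intro!: nn_integral_cong simp: indicator_def E_def)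
  finally show ?thesis unfolding C_def .
qed

text \<open>A play not reached before \<open>s\<close> takes its mark as well as its residual
  waiting time from the fresh pair. As mark and waiting time are independent, the mark can be
  integrated out first, and the exponential case applies to \<open>g\<close>.\<close>

lemma step_law_memoryless:
  fixes f :: "real \<times> real \<Rightarrow> ennreal"
  assumes [measurable]: "f \<in> borel_measurable step_law" and s: "s \<ge> 0"
  shows "(\<integral>\<^sup>+a. (if fst a < s then f a else (\<integral>\<^sup>+b. f (s + fst b, snd b) \<partial>step_law)) \<partial>step_law)
    = (\<integral>\<^sup>+a. f a \<partial>step_law)"
proof -
  define g where "g = (\<lambda>e. \<integral>\<^sup>+u. f (e, u) \<partial>uniform_measure lborel {0..1})"
  have fm[measurable]: "f \<in> borel_measurable (borel \<Otimes>\<^sub>M borel)"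
    using assms(1) by (simp cong: measurable_cong_sets add: sets_step_law)
  have [measurable]: "g \<in> borel_measurable borel" unfolding g_def by measurable
  have 1: "(\<integral>\<^sup>+a. h a \<partial>step_law) = (\<integral>\<^sup>+e. \<integral>\<^sup>+u. h (e, u) \<partial>uniform_measure lborel {0..1}
      \<partial>density lborel (exponential_density 1))"
    if [measurable]: "h \<in> borel_measurable (borel \<Otimes>\<^sub>M borel)" for h :: "_ \<Rightarrow> ennreal"
    unfolding step_law_def by (subst unif.nn_integral_fst[symmetric]) auto
  define C where "C = (\<integral>\<^sup>+y. g (s + y) \<partial>density lborel (exponential_density 1))"
  have C: "(\<integral>\<^sup>+b. f (s + fst b, snd b) \<partial>step_law) = C"
    unfolding C_def g_def by (subst 1) auto
  have "(\<integral>\<^sup>+a. (if fst a < s then f a else C) \<partial>step_law)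
      = (\<integral>\<^sup>+e. (if e < s then g e else C) \<partial>density lborel (exponential_density 1))"
    by (subst 1) (auto intro!: nn_integral_cong simp: g_def unif.emeasure_space_1[simplified])
  also have "\<dots> = (\<integral>\<^sup>+e. g e \<partial>density lborel (exponential_density 1))"
    unfolding C_def by (rule exponential_memoryless) (use s in auto)
  also have "\<dots> = (\<integral>\<^sup>+a. f a \<partial>step_law)"
    unfolding g_def by (rule 1[symmetric]) measurable
  finally show ?thesis unfolding C .
qed

section \<open>Splicing the noise of one player at a fixed time\<close>

lemma measurable_site_component[measurable]:
  "f \<in> measurable M site_law \<Longrightarrow> (\<lambda>x. f x n) \<in> measurable M (borel \<Otimes>\<^sub>M borel)"
  unfolding site_law_def
  by (subst measurable_cong_sets[OF refl sets_step_law[symmetric]])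
     (rule measurable_compose[OF _ measurable_component_singleton], auto)

lemma measurable_noise_component[measurable]:
  "f \<in> measurable M noise_law \<Longrightarrow> (\<lambda>x. f x i) \<in> measurable M site_law"
  unfolding noise_law_def by (rule measurable_compose[OF _ measurable_component_singleton]) auto

text \<open>The waiting time during which \<open>s\<close> occurs is cut off at \<open>s\<close> and continued by the first
  waiting time of \<open>f\<close>; being exponential, it does not change its law.\<close>

fun splice_at :: "real \<Rightarrow> (nat \<Rightarrow> real \<times> real) \<Rightarrow> (nat \<Rightarrow> real \<times> real) \<Rightarrow> nat \<Rightarrow> real \<times> real" where
  "splice_at s e f 0 = (if fst (e 0) < s then e 0 else (s + fst (f 0), snd (f 0)))"
| "splice_at s e f (Suc n) = (if fst (e 0) < s then splice_at (s - fst (e 0)) (\<lambda>k. e (Suc k)) f n else f (Suc n))"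

lemma measurable_splice_component[measurable]:
  assumes [measurable]: "s \<in> borel_measurable M" "e \<in> measurable M site_law" "f \<in> measurable M site_law"
  shows "(\<lambda>x. splice_at (s x) (e x) (f x) n) \<in> measurable M step_law"
  using assms
proof (induction n arbitrary: s e)
  case 0
  note 0[measurable]
  show ?case by (simp cong: measurable_cong_sets)
next
  case (Suc n)
  note Suc.prems[measurable]
  have [measurable]: "(\<lambda>x. splice_at (s x - fst (e x 0)) (\<lambda>k. e x (Suc k)) (f x) n) \<in> measurable M (borel \<Otimes>\<^sub>M borel)"
    unfolding measurable_cong_sets[OF refl sets_step_law, symmetric]
  proof (rule Suc.IH)
    show "(\<lambda>x k. e x (Suc k)) \<in> measurable M site_law"
      unfolding site_law_def
      by (intro measurable_abs_UNIV, subst measurable_cong_sets[OF refl sets_step_law]) measurable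
  qed measurable
  show ?case by (simp cong: measurable_cong_sets)
qed

lemma measurable_splice[measurable]:
  assumes [measurable]: "s \<in> borel_measurable M" "e \<in> measurable M site_law" "f \<in> measurable M site_law"
  shows "(\<lambda>x. splice_at (s x) (e x) (f x)) \<in> measurable M site_law"
  unfolding site_law_def by (intro measurable_abs_UNIV) measurable

lemma measurable_case_nat_site[measurable]:
  assumes [measurable]: "a \<in> measurable M step_law" "e \<in> measurable M site_law"
  shows "(\<lambda>x. case_nat (a x) (e x)) \<in> measurable M site_law"
  unfolding site_law_def
proof (intro measurable_abs_UNIV)
  fix n show "(\<lambda>x. case n of 0 \<Rightarrow> a x | Suc k \<Rightarrow> e x k) \<in> measurable M step_law"
    using assms(1) measurable_site_component[OF assms(2)]
    by (cases n) (simp_all add: measurable_cong_sets[OF refl sets_step_law])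
qed

lemma nn_integral_site_Cons:
  assumes [measurable]: "G \<in> borel_measurable site_law"
  shows "(\<integral>\<^sup>+e. G e \<partial>site_law) = (\<integral>\<^sup>+a. \<integral>\<^sup>+e. G (case_nat a e) \<partial>site_law \<partial>step_law)"
proof -
  have "(\<integral>\<^sup>+e. G e \<partial>site_law) = (\<integral>\<^sup>+e. G e \<partial>distr (step_law \<Otimes>\<^sub>M site_law) site_law (\<lambda>(s, \<omega>). case_nat s \<omega>))"
    by (subst site.PiM_iter) simp
  also have "\<dots> = (\<integral>\<^sup>+z. G (case_nat (fst z) (snd z)) \<partial>(step_law \<Otimes>\<^sub>M site_law))"
    unfolding split_beta' by (intro nn_integral_distr) (auto intro!: measurable_case_nat_site)
  also have "\<dots> = (\<integral>\<^sup>+a. \<integral>\<^sup>+e. G (case_nat a e) \<partial>site_law \<partial>step_law)"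
    by (subst site.nn_integral_fst[symmetric]) auto
  finally show ?thesis .
qed

text \<open>The first waiting time decides: if it ends before \<open>s\<close>, the rest is a splice
  at the reduced time and the induction applies; otherwise the rest comes from the fresh sequence.
  Both cases leave the same factor \<open>P\<close>, so only the first coordinate remains, where
  \<open>step_law_memoryless\<close> applies.\<close>

lemma splice_cylinder:
  assumes "s \<ge> 0" and "\<And>n. a n \<in> borel_measurable step_law"
  shows "(\<integral>\<^sup>+e. \<integral>\<^sup>+f. (\<Prod>n<m. a n (splice_at s e f n)) \<partial>site_law \<partial>site_law) = (\<Prod>n<m. \<integral>\<^sup>+x. a n x \<partial>step_law)"
  using assms
proof (induction m arbitrary: s a)
  case 0
  then show ?case by (simp add: site.emeasure_space_1[simplified])
next
  case (Suc m)
  note [measurable] = Suc.prems(2)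
  define P where "P = (\<Prod>n<m. \<integral>\<^sup>+x. a (Suc n) x \<partial>step_law)"
  define C where "C = (\<integral>\<^sup>+b. a 0 (s + fst b, snd b) \<partial>step_law)"
  define H where "H = (\<lambda>t e f. \<Prod>n<m. a (Suc n) (splice_at t e f n))"
  have H[measurable]: "(\<lambda>x. H t (u x) (v x)) \<in> borel_measurable M"
    if [measurable]: "u \<in> measurable M site_law" "v \<in> measurable M site_law"
    for t u v and M :: "'z measure"
    unfolding H_def by (intro borel_measurable_prod_ennreal measurable_compose[OF measurable_splice_component Suc.prems(2)]) simp_all
  have C_meas: "(\<lambda>b. a 0 (s + fst b, snd b)) \<in> borel_measurable step_law"
    by (rule measurable_compose[OF _ Suc.prems(2)]) (simp add: measurable_cong_sets[OF sets_step_law sets_step_law])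
  have eq: "(\<integral>\<^sup>+e. \<integral>\<^sup>+f. (\<Prod>n<Suc m. a n (splice_at s (case_nat x e) f n)) \<partial>site_law \<partial>site_law)
      = (if fst x < s then a 0 x else C) * P" for x
  proof (cases "fst x < s")
    case True
    have "(\<integral>\<^sup>+e. \<integral>\<^sup>+f. (\<Prod>n<Suc m. a n (splice_at s (case_nat x e) f n)) \<partial>site_law \<partial>site_law)
        = (\<integral>\<^sup>+e. \<integral>\<^sup>+f. a 0 x * H (s - fst x) e f \<partial>site_law \<partial>site_law)"
      using True by (simp add: prod.lessThan_Suc_shift H_def del: prod.lessThan_Suc)
    also have "\<dots> = (\<integral>\<^sup>+e. a 0 x * \<integral>\<^sup>+f. H (s - fst x) e f \<partial>site_law \<partial>site_law)"
      by (intro nn_integral_cong nn_integral_cmult H) auto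
    also have "\<dots> = a 0 x * (\<integral>\<^sup>+e. \<integral>\<^sup>+f. H (s - fst x) e f \<partial>site_law \<partial>site_law)"
      by (intro nn_integral_cmult site.borel_measurable_nn_integral) (auto simp: split_beta' intro!: H)
    also have "\<dots> = a 0 x * P"
      unfolding P_def H_def by (subst Suc.IH) (use True Suc.prems in auto)
    finally show ?thesis using True by simp
  next
    case False
    \<comment> \<open>The shift by \<open>s\<close> hits only the first fresh play; the later ones
      are copied unchanged.\<close>
    define b where "b = (\<lambda>n. case n of 0 \<Rightarrow> \<lambda>b. a 0 (s + fst b, snd b) | Suc k \<Rightarrow> a (Suc k))"
    have "(\<integral>\<^sup>+e. \<integral>\<^sup>+f. (\<Prod>n<Suc m. a n (splice_at s (case_nat x e) f n)) \<partial>site_law \<partial>site_law)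
        = (\<integral>\<^sup>+f. (\<Prod>n<Suc m. b n (f n)) \<partial>site_law)"
      using False by (simp add: b_def prod.lessThan_Suc_shift site.emeasure_space_1[simplified] del: prod.lessThan_Suc)
    also have "\<dots> = (\<Prod>n<Suc m. \<integral>\<^sup>+x. b n x \<partial>step_law)"
      unfolding site_law_def
      by (rule nn_integral_PiM_prod[OF step.prob_space_axioms])
        (use C_meas Suc.prems(2) in \<open>auto simp: b_def split: nat.split\<close>)
    also have "\<dots> = C * P"
      by (simp add: prod.lessThan_Suc_shift C_def P_def b_def del: prod.lessThan_Suc)
    finally show ?thesis using False by simp
  qed
  have "(\<integral>\<^sup>+e. \<integral>\<^sup>+f. (\<Prod>n<Suc m. a n (splice_at s e f n)) \<partial>site_law \<partial>site_law)
      = (\<integral>\<^sup>+x. (if fst x < s then a 0 x else C) * P \<partial>step_law)"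
  proof (subst nn_integral_site_Cons)
    show "(\<lambda>e. \<integral>\<^sup>+f. (\<Prod>n<Suc m. a n (splice_at s e f n)) \<partial>site_law) \<in> borel_measurable site_law"
      by (intro site.borel_measurable_nn_integral)
         (auto simp: split_beta' simp del: prod.lessThan_Suc intro!: borel_measurable_prod_ennreal measurable_compose[OF measurable_splice_component Suc.prems(2)])
  qed (simp only: eq)
  also have "\<dots> = (\<integral>\<^sup>+x. (if fst x < s then a 0 x else C) \<partial>step_law) * P"
  proof (rule nn_integral_multc)
    have "fst \<in> borel_measurable step_law"
      by (simp add: measurable_cong_sets[OF sets_step_law refl])
    then have "{x \<in> space step_law. fst x < s} \<in> sets step_law"
      by (rule borel_measurable_less) simp
    then show "(\<lambda>x. if fst x < s then a 0 x else C) \<in> borel_measurable step_law"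
      using Suc.prems(2) by (intro measurable_If) auto
  qed
  also have "(\<integral>\<^sup>+x. (if fst x < s then a 0 x else C) \<partial>step_law) = (\<integral>\<^sup>+x. a 0 x \<partial>step_law)"
    unfolding C_def by (rule step_law_memoryless) (use Suc.prems in auto)
  finally show ?case
    by (simp add: prod.lessThan_Suc_shift P_def del: prod.lessThan_Suc)
qed

lemma distr_splice:
  assumes "s \<ge> 0"
  shows "distr (site_law \<Otimes>\<^sub>M site_law) site_law (\<lambda>(e, f). splice_at s e f) = site_law"
proof (rule site.PiM_eq)
  fix J :: "nat set" and F assume J: "finite J" "J \<subseteq> UNIV" and F: "\<And>j. j \<in> J \<Longrightarrow> F j \<in> sets step_law"
  note F[measurable]
  \<comment> \<open>Filling up with \<open>UNIV\<close> outside \<open>J\<close> makes the cylinder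
    a condition on an initial segment \<open>{..<m}\<close>, the form of
    \<open>splice_cylinder\<close>.\<close>
  define A where "A = (\<lambda>j. if j \<in> J then F j else UNIV)"
  have A[measurable]: "A j \<in> sets step_law" for j
    using F sets.top[of step_law] by (auto simp: A_def)
  obtain m where m: "J \<subseteq> {..<m}" using J finite_nat_iff_bounded by blast
  let ?X = "prod_emb UNIV (\<lambda>_. step_law) J (\<Pi>\<^sub>E j\<in>J. F j)"
  have X: "?X \<in> sets site_law"
    using J F unfolding site_law_def by (intro sets_PiM_I) auto
  have Xi: "z \<in> ?X \<longleftrightarrow> (\<forall>n<m. z n \<in> A n)" for z
    using m by (auto simp: prod_emb_def PiE_iff A_def subset_iff extensional_def)
  have ind: "indicator ?X z = (\<Prod>n<m. indicator (A n) (z n) :: ennreal)" for z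
  proof (cases "\<forall>n<m. z n \<in> A n")
    case True
    then show ?thesis by (simp add: indicator_def Xi)
  next
    case False
    then show ?thesis by (auto simp: indicator_def Xi intro!: prod_zero[symmetric])
  qed
  have "emeasure (distr (site_law \<Otimes>\<^sub>M site_law) site_law (\<lambda>(e, f). splice_at s e f)) ?X
      = (\<integral>\<^sup>+z. indicator ?X z \<partial>distr (site_law \<Otimes>\<^sub>M site_law) site_law (\<lambda>(e, f). splice_at s e f))"
    using X by simp
  also have "\<dots> = (\<integral>\<^sup>+z. indicator ?X (splice_at s (fst z) (snd z)) \<partial>(site_law \<Otimes>\<^sub>M site_law))"
    unfolding split_beta' using X by (intro nn_integral_distr) auto
  also have "\<dots> = (\<integral>\<^sup>+z. (\<Prod>n<m. indicator (A n) (splice_at s (fst z) (snd z) n)) \<partial>(site_law \<Otimes>\<^sub>M site_law))"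
    by (simp only: ind)
  also have "\<dots> = (\<integral>\<^sup>+e. \<integral>\<^sup>+f. (\<Prod>n<m. indicator (A n) (splice_at s e f n)) \<partial>site_law \<partial>site_law)"
    by (subst site.nn_integral_fst[symmetric]) (auto intro!: borel_measurable_prod_ennreal)
  also have "\<dots> = (\<Prod>n<m. emeasure step_law (A n))"
    by (subst splice_cylinder[OF assms]) auto
  also have "\<dots> = (\<Prod>n\<in>J. emeasure step_law (F n))"
    using m by (intro prod.mono_neutral_cong_right) (auto simp: A_def step.emeasure_space_1[simplified])
  finally show "emeasure (distr (site_law \<Otimes>\<^sub>M site_law) site_law (\<lambda>(e, f). splice_at s e f)) ?X
      = (\<Prod>n\<in>J. emeasure step_law (F n))" .
qed (simp add: site_law_def)

section \<open>Gluing two noises at a fixed time\<close>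

definition glue :: "real \<Rightarrow> (int \<Rightarrow> nat \<Rightarrow> real \<times> real) \<Rightarrow> (int \<Rightarrow> nat \<Rightarrow> real \<times> real) \<Rightarrow> int \<Rightarrow> nat \<Rightarrow> real \<times> real" where
  "glue s \<omega> \<omega>' i = splice_at s (\<omega> i) (\<omega>' i)"

lemma measurable_glue[measurable]:
  assumes [measurable]: "e \<in> measurable M noise_law" "f \<in> measurable M noise_law"
  shows "(\<lambda>x. glue s (e x) (f x)) \<in> measurable M noise_law"
proof -
  show ?thesis
    unfolding noise_law_def glue_def by (intro measurable_abs_UNIV) measurable
qed

text \<open>The source of the Markov property: a noise may be replaced by one that is followed up to
  \<open>s\<close> and then continued with an independent copy.\<close>

lemma distr_glue:
  assumes "s \<ge> 0"
  shows "distr (noise_law \<Otimes>\<^sub>M noise_law) noise_law (\<lambda>(\<omega>, \<omega>'). glue s \<omega> \<omega>') = noise_law"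
proof -
  have "distr (PiM UNIV (\<lambda>_. site_law) \<Otimes>\<^sub>M PiM UNIV (\<lambda>_. site_law)) (PiM (UNIV :: int set) (\<lambda>_. site_law))
    (\<lambda>(\<omega>, \<omega>') i. (\<lambda>(e, f). splice_at s e f) (\<omega> i, \<omega>' i)) = PiM UNIV (\<lambda>_. site_law)"
    by (rule distr_PiM_zip[OF site.prob_space_axioms site.prob_space_axioms _ distr_splice[OF assms]])
      (unfold split_beta', measurable)
  then show ?thesis
    unfolding noise_law_def by (simp add: split_beta' glue_def[abs_def])
qed

section \<open>Play times and numbers of plays\<close>

type_synonym noise = "int \<Rightarrow> nat \<Rightarrow> real \<times> real"

definition smp :: "config \<Rightarrow> noise \<Rightarrow> sample" where
  "smp x \<omega> = (x, (\<lambda>(i, n). fst (\<omega> i n)), (\<lambda>(i, n). snd (\<omega> i n)))"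

definition ptime :: "(nat \<Rightarrow> real \<times> real) \<Rightarrow> nat \<Rightarrow> real" where
  "ptime e n = (\<Sum>k\<le>n. fst (e k))"

text \<open>Strictly before \<open>t\<close>, as in \<open>config_before\<close>: at a play time the
  state is the one just before the play.\<close>

definition cnt :: "(nat \<Rightarrow> real \<times> real) \<Rightarrow> real \<Rightarrow> nat" where
  "cnt e t = card {n. ptime e n < t}"

definition proper :: "(nat \<Rightarrow> real \<times> real) \<Rightarrow> bool" where
  "proper e \<longleftrightarrow> (\<forall>n. 0 < fst (e n)) \<and> (\<forall>t. \<exists>n. t \<le> ptime e n)"

lemma ptime_0[simp]: "ptime e 0 = fst (e 0)"
  and ptime_Suc: "ptime e (Suc n) = ptime e n + fst (e (Suc n))"
  by (simp_all add: ptime_def)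

lemma ptime_shift: "ptime e (Suc n) = fst (e 0) + ptime (\<lambda>k. e (Suc k)) n"
  by (induction n) (simp_all add: ptime_Suc)

lemma cnt_eqI: "(\<And>n. ptime e n < t \<longleftrightarrow> n < c) \<Longrightarrow> cnt e t = c"
  by (simp add: cnt_def)

lemma proper_strict_mono: "proper e \<Longrightarrow> strict_mono (ptime e)"
  by (rule strict_mono_Suc_iff[THEN iffD2]) (simp add: proper_def ptime_Suc)

lemma proper_ptime_pos: "proper e \<Longrightarrow> 0 < ptime e n"
  by (induction n) (auto simp: ptime_Suc proper_def intro: add_pos_pos)

text \<open>Play times increase and are unbounded, so the plays before \<open>t\<close> form an
  initial segment, which ends at the first index whose play is not before \<open>t\<close>.\<close>

lemma less_cnt_iff:
  assumes "proper e"
  shows "n < cnt e t \<longleftrightarrow> ptime e n < t"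
proof -
  define N where "N = (LEAST n. t \<le> ptime e n)"
  have N: "t \<le> ptime e N" using assms unfolding N_def proper_def by (metis LeastI)
  have "ptime e n < t \<longleftrightarrow> n < N" for n
  proof
    assume "n < N" then show "ptime e n < t"
      using not_less_Least[of n "\<lambda>n. t \<le> ptime e n"] by (simp add: N_def)
  next
    assume "ptime e n < t"
    then have "ptime e n < ptime e N" using N by simp
    then show "n < N" using strict_mono_less[OF proper_strict_mono[OF assms]] by simp
  qed
  then show ?thesis using cnt_eqI[of e t N] by simp
qed

lemma cnt_mono: "proper e \<Longrightarrow> s \<le> t \<Longrightarrow> cnt e s \<le> cnt e t"
  by (metis less_cnt_iff not_le less_le_trans less_irrefl)

lemma cnt_0[simp]: "proper e \<Longrightarrow> t \<le> 0 \<Longrightarrow> cnt e t = 0"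
  using less_cnt_iff[of e 0 t] proper_ptime_pos[of e 0] by auto

lemma cnt_eq_0_iff: "proper e \<Longrightarrow> cnt e t = 0 \<longleftrightarrow> t \<le> fst (e 0)"
  using less_cnt_iff[of e 0 t] by auto

lemma cnt_eq_1_iff: "proper e \<Longrightarrow> cnt e t = 1 \<longleftrightarrow> fst (e 0) < t \<and> t \<le> fst (e 0) + fst (e 1)"
  using less_cnt_iff[of e 0 t] less_cnt_iff[of e 1 t] by (auto simp: ptime_Suc[of _ 0, simplified])

lemma splice_at_eq:
  assumes "\<And>k. k < N \<Longrightarrow> ptime e k < s" "s \<le> ptime e N"
  shows "splice_at s e f n = (if n < N then e n
    else if n = N then (s - (\<Sum>k<N. fst (e k)) + fst (f 0), snd (f 0)) else f (n - N))"
  using assms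
proof (induction N arbitrary: s e n)
  case 0
  then show ?case by (cases n) auto
next
  case (Suc N)
  have 0: "fst (e 0) < s" using Suc.prems(1)[of 0] by simp
  have IH: "splice_at (s - fst (e 0)) (\<lambda>k. e (Suc k)) f n = (if n < N then e (Suc n)
    else if n = N then (s - fst (e 0) - (\<Sum>k<N. fst (e (Suc k))) + fst (f 0), snd (f 0)) else f (n - N))" for n
  proof (rule Suc.IH)
    fix k assume "k < N"
    then show "ptime (\<lambda>k. e (Suc k)) k < s - fst (e 0)"
      using Suc.prems(1)[of "Suc k"] by (simp add: ptime_shift)
  qed (use Suc.prems in \<open>simp add: ptime_shift\<close>)
  show ?case
  proof (cases n)
    case 0
    with \<open>fst (e 0) < s\<close> show ?thesis by simp
  next
    case (Suc n')
    have "(\<Sum>k<Suc N. fst (e k)) = fst (e 0) + (\<Sum>k<N. fst (e (Suc k)))"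
      by (rule sum.lessThan_Suc_shift)
    with Suc 0 show ?thesis by (simp add: IH del: sum.lessThan_Suc)
  qed
qed

context
  fixes s :: real and e f assumes e: "proper e" and f: "proper f" and s: "s \<ge> 0"
begin

lemma splice_cnt: "splice_at s e f n = (if n < cnt e s then e n
    else if n = cnt e s then (s - (\<Sum>k<cnt e s. fst (e k)) + fst (f 0), snd (f 0)) else f (n - cnt e s))"
  by (rule splice_at_eq) (use less_cnt_iff[OF e, of _ s] in \<open>auto simp: not_less[symmetric]\<close>)

lemma snd_splice: "snd (splice_at s e f n) = (if n < cnt e s then snd (e n) else snd (f (n - cnt e s)))"
  by (simp add: splice_cnt)

lemma ptime_splice:
  "ptime (splice_at s e f) n = (if n < cnt e s then ptime e n else s + ptime f (n - cnt e s))"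
proof (cases "n < cnt e s")
  case True
  then show ?thesis by (auto simp: ptime_def splice_cnt intro!: sum.cong)
next
  case False
  have "ptime (splice_at s e f) (cnt e s + m) = s + ptime f m" for m
  proof (induction m)
    case 0
    have "ptime (splice_at s e f) (cnt e s) = (\<Sum>k<cnt e s. fst (splice_at s e f k)) + fst (splice_at s e f (cnt e s))"
      by (simp add: ptime_def lessThan_Suc_atMost[symmetric])
    also have "(\<Sum>k<cnt e s. fst (splice_at s e f k)) = (\<Sum>k<cnt e s. fst (e k))"
      by (intro sum.cong) (auto simp: splice_cnt)
    finally show ?case by (simp add: splice_cnt)
  next
    case (Suc m)
    then show ?case by (simp add: ptime_Suc splice_cnt)
  qed
  from this[of "n - cnt e s"] False show ?thesis by simp
qed

lemma cnt_splice: "cnt (splice_at s e f) t = (if t \<le> s then cnt e t else cnt e s + cnt f (t - s))"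
proof (rule cnt_eqI)
  fix n
  show "ptime (splice_at s e f) n < t \<longleftrightarrow> n < (if t \<le> s then cnt e t else cnt e s + cnt f (t - s))"
  proof (cases "n < cnt e s")
    case True
    then have "ptime e n < s" by (simp add: less_cnt_iff[OF e])
    moreover have "n < cnt e s + k" for k using True by simp
    ultimately show ?thesis using True by (auto simp: ptime_splice less_cnt_iff[OF e, of n t])
  next
    case False
    then obtain m where m: "n = cnt e s + m" by (metis le_Suc_ex not_less)
    have "t \<le> s \<Longrightarrow> cnt e t \<le> cnt e s" by (rule cnt_mono[OF e])
    \<comment> \<open>Plays of the continuation come strictly after \<open>s\<close>, which is why
      \<open>t = s\<close> still belongs to the old noise.\<close>
    moreover have "\<not> s + ptime f m < t" if "t \<le> s"
      using that proper_ptime_pos[OF f, of m] by simp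
    ultimately show ?thesis using False m by (auto simp: ptime_splice less_cnt_iff[OF f])
  qed
qed

end

text \<open>A player without play before \<open>t\<close> separates the two halves of \<open>\<int>\<close> up to time \<open>t\<close>. As
  such players exist arbitrarily far to the left and to the right, the results of all plays up to
  \<open>t\<close> are determined recursively in finite blocks of players.\<close>

definition good :: "noise \<Rightarrow> bool" where
  "good \<omega> \<longleftrightarrow> (\<forall>i. proper (\<omega> i)) \<and> (\<forall>t i. \<exists>j>i. t \<le> fst (\<omega> j 0)) \<and> (\<forall>t i. \<exists>j<i. t \<le> fst (\<omega> j 0))
    \<and> (\<forall>i n m. ptime (\<omega> i) n \<noteq> ptime (\<omega> (i + 1)) m) \<and> (\<forall>i n. 0 \<le> snd (\<omega> i n) \<and> snd (\<omega> i n) < 1)"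

lemma good_proper: "good \<omega> \<Longrightarrow> proper (\<omega> i)"
  by (simp add: good_def)

lemma good_left: "good \<omega> \<Longrightarrow> \<exists>j<i. t \<le> fst (\<omega> j 0)"
  and good_right: "good \<omega> \<Longrightarrow> \<exists>j>i. t \<le> fst (\<omega> j 0)"
  by (simp_all add: good_def)

text \<open>A backward chain of plays at equal or neighbouring sites is finite: it starts between
  two players \<open>a\<close> and \<open>b\<close> whose first plays are not before its starting
  time, so it cannot enter them, and the number of earlier plays in this finite block drops at each
  link. Existence and uniqueness of outcomes rest on this induction, and so does the invariance of S
  under game B.\<close>

lemma good_induct[consumes 1, case_names step]:
  assumes "good \<omega>"
    and step: "\<And>i n. (\<And>j m. \<bar>i - j\<bar> \<le> 1 \<Longrightarrow> ptime (\<omega> j) m < ptime (\<omega> i) n \<Longrightarrow> P j m) \<Longrightarrow> P i n"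
  shows "P i n"
proof -
  have pr: "proper (\<omega> j)" for j using assms(1) by (rule good_proper)
  define t where "t = ptime (\<omega> i) n"
  obtain a where a: "a < i" "t \<le> fst (\<omega> a 0)" using good_left[OF assms(1)] by blast
  obtain b where b: "b > i" "t \<le> fst (\<omega> b 0)" using good_right[OF assms(1)] by blast
  define F where "F = (\<lambda>r. SIGMA j:{a<..<b}. {m. ptime (\<omega> j) m < r})"
  have fin: "finite (F r)" for r
    unfolding F_def using less_cnt_iff[OF pr, symmetric] by (intro finite_SigmaI) auto
  have "a < j \<Longrightarrow> j < b \<Longrightarrow> ptime (\<omega> j) m \<le> t \<Longrightarrow> P j m" for j m
  proof (induction "card (F (ptime (\<omega> j) m))" arbitrary: j m rule: less_induct)
    case less
    show ?case
    proof (rule step)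
      fix j' m' assume j': "\<bar>j - j'\<bar> \<le> 1" "ptime (\<omega> j') m' < ptime (\<omega> j) m"
      have late: "t \<le> ptime (\<omega> k) m'" if "t \<le> fst (\<omega> k 0)" for k
        using that strict_mono_less_eq[OF proper_strict_mono[OF pr], of k 0 m'] by simp
      have "j' \<noteq> a" "j' \<noteq> b" using late[of j'] a b j' less.prems by auto
      with j' less.prems have "a < j'" "j' < b" by auto
      moreover have "card (F (ptime (\<omega> j') m')) < card (F (ptime (\<omega> j) m))"
        using j' calculation by (intro psubset_card_mono fin) (auto simp: F_def)
      ultimately show "P j' m'" using j' less.prems by (intro less.hyps) auto
    qed
  qed
  then show ?thesis using a b by (auto simp: t_def)
qed

section \<open>Outcomes as the limit of an iteration\<close>

lemma play_time_smp[simp]: "play_time (smp x \<omega>) i = ptime (\<omega> i)"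
  by (simp add: fun_eq_iff play_time_def ptime_def smp_def)

lemma mark_smp[simp]: "mark (smp x \<omega>) i n = snd (\<omega> i n)"
  by (simp add: mark_def smp_def)

lemma init_smp[simp]: "init (smp x \<omega>) = x"
  by (simp add: init_def smp_def)

lemma config_before_smp:
  "config_before (smp x \<omega>) w t i = (case cnt (\<omega> i) t of 0 \<Rightarrow> x i | Suc k \<Rightarrow> w i k)"
  by (simp add: config_before_def cnt_def split: nat.split)

text \<open>Iteration from the guess that everybody loses. It serves existence, as each single
  outcome becomes constant after finitely many rounds, and measurability, which the definite
  description in \<open>wins\<close> does not give.\<close>

fun out_iter :: "game \<Rightarrow> config \<Rightarrow> noise \<Rightarrow> nat \<Rightarrow> int \<Rightarrow> nat \<Rightarrow> bool" where
  "out_iter p x \<omega> 0 = (\<lambda>i n. False)"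
| "out_iter p x \<omega> (Suc k) = (\<lambda>i n. snd (\<omega> i n) <
      p (nbhd (config_before (smp x \<omega>) (out_iter p x \<omega> k) (ptime (\<omega> i) n)) i))"

definition out :: "game \<Rightarrow> config \<Rightarrow> noise \<Rightarrow> int \<Rightarrow> nat \<Rightarrow> bool" where
  "out p x \<omega> i n \<longleftrightarrow> (\<exists>K. \<forall>k\<ge>K. out_iter p x \<omega> k i n)"

definition X :: "game \<Rightarrow> config \<Rightarrow> noise \<Rightarrow> real \<Rightarrow> config" where
  "X p x \<omega> t = config_before (smp x \<omega>) (out p x \<omega>) t"

lemma X_eq: "X p x \<omega> t i = (case cnt (\<omega> i) t of 0 \<Rightarrow> x i | Suc k \<Rightarrow> out p x \<omega> i k)"
  by (simp add: X_def config_before_smp)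

lemma cnt_SucD: "proper e \<Longrightarrow> cnt e t = Suc k \<Longrightarrow> ptime e k < t"
  using less_cnt_iff[of e k t] by simp

lemma nbhd_cong: "x (i - 1) = y (i - 1) \<Longrightarrow> x (i + 1) = y (i + 1) \<Longrightarrow> nbhd x i = nbhd y i"
  by (simp add: nbhd_def)

text \<open>An outcome is fixed one round after the relevant earlier outcomes of the two neighbours;
  \<open>good_induct\<close> turns this into stabilisation, with a number of rounds that depends on
  the play.\<close>

lemma out_iter_stable:
  assumes "good \<omega>"
  shows "\<exists>K. \<forall>k\<ge>K. out_iter p x \<omega> k i n = out p x \<omega> i n"
proof -
  have "\<exists>K b. \<forall>k\<ge>K. out_iter p x \<omega> k i n = b"
    using assms
  proof (induction i n rule: good_induct)
    case (step i n)
    let ?c = "\<lambda>k. config_before (smp x \<omega>) (out_iter p x \<omega> k) (ptime (\<omega> i) n)"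
    have "\<exists>K b. \<forall>k\<ge>K. ?c k j = b" if "\<bar>i - j\<bar> \<le> 1" for j
    proof (cases "cnt (\<omega> j) (ptime (\<omega> i) n)")
      case (Suc m)
      then have "ptime (\<omega> j) m < ptime (\<omega> i) n"
        by (intro cnt_SucD good_proper assms)
      from step[OF that this] show ?thesis by (simp add: config_before_smp Suc)
    qed (simp add: config_before_smp)
    from this[of "i - 1"] this[of "i + 1"] obtain K b K' b'
      where K: "\<And>k. k \<ge> K \<Longrightarrow> ?c k (i - 1) = b" "\<And>k. k \<ge> K' \<Longrightarrow> ?c k (i + 1) = b'"
      by auto
    show ?case
    proof (intro exI allI impI)
      fix k assume k: "k \<ge> Suc (max K K')"
      then obtain k' where k': "k = Suc k'" "k' \<ge> max K K'" by (cases k) auto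
      have "nbhd (?c k') i = nbhd (?c (max K K')) i"
        using K k' by (intro nbhd_cong) auto
      then show "out_iter p x \<omega> k i n = (snd (\<omega> i n) < p (nbhd (?c (max K K')) i))"
        by (simp add: k')
    qed
  qed
  then obtain K b where K: "\<And>k. k \<ge> K \<Longrightarrow> out_iter p x \<omega> k i n = b" by auto
  moreover have "out p x \<omega> i n = b"
    unfolding out_def using K by (metis nle_le)
  ultimately show ?thesis by auto
qed

lemma out_follows:
  assumes "good \<omega>"
  shows "follows_game p (smp x \<omega>) (out p x \<omega>)"
  unfolding follows_game_def
proof (intro allI)
  fix i n
  let ?c = "\<lambda>w. config_before (smp x \<omega>) w (ptime (\<omega> i) n)"
  have "\<exists>K. \<forall>k\<ge>K. ?c (out_iter p x \<omega> k) j = ?c (out p x \<omega>) j" for j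
    using out_iter_stable[OF assms] by (auto simp: config_before_smp split: nat.split)
  then obtain K1 K2 K3 where K: "\<And>k. k \<ge> K1 \<Longrightarrow> ?c (out_iter p x \<omega> k) (i - 1) = ?c (out p x \<omega>) (i - 1)"
    "\<And>k. k \<ge> K2 \<Longrightarrow> ?c (out_iter p x \<omega> k) (i + 1) = ?c (out p x \<omega>) (i + 1)"
    "\<And>k. k \<ge> K3 \<Longrightarrow> out_iter p x \<omega> k i n = out p x \<omega> i n"
    using out_iter_stable[OF assms, of p x i n] by metis
  define k where "k = max K1 (max K2 K3)"
  have "out p x \<omega> i n = out_iter p x \<omega> (Suc k) i n" using K(3)[of "Suc k"] by (simp add: k_def)
  also have "nbhd (?c (out_iter p x \<omega> k)) i = nbhd (?c (out p x \<omega>)) i"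
    using K by (intro nbhd_cong) (auto simp: k_def)
  then have "out_iter p x \<omega> (Suc k) i n = (snd (\<omega> i n) < p (nbhd (?c (out p x \<omega>)) i))"
    by simp
  finally show "out p x \<omega> i n = (mark (smp x \<omega>) i n <
      p (nbhd (config_before (smp x \<omega>) (out p x \<omega>) (play_time (smp x \<omega>) i n)) i))"
    by simp
qed

lemma out_unfold:
  "good \<omega> \<Longrightarrow> out p x \<omega> i n \<longleftrightarrow> snd (\<omega> i n) < p (nbhd (X p x \<omega> (ptime (\<omega> i) n)) i)"
  using out_follows[of \<omega> p x] by (simp add: follows_game_def X_def)

lemma follows_game_unique:
  assumes "good \<omega>" "follows_game p (smp x \<omega>) w"
  shows "w = out p x \<omega>"
proof -
  have "w i n = out p x \<omega> i n" for i n
    using assms(1)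
  proof (induction i n rule: good_induct)
    case (step i n)
    let ?c = "\<lambda>w. config_before (smp x \<omega>) w (ptime (\<omega> i) n)"
    have "?c w j = ?c (out p x \<omega>) j" if "\<bar>i - j\<bar> \<le> 1" for j
      using step[OF that cnt_SucD[OF good_proper[OF assms(1)]]]
      by (auto simp: config_before_smp split: nat.split)
    then have "nbhd (?c w) i = nbhd (?c (out p x \<omega>)) i" by (intro nbhd_cong) auto
    then show ?case
      using assms(2) out_follows[OF assms(1), of p x] unfolding follows_game_def by simp
  qed
  then show ?thesis by (simp add: fun_eq_iff)
qed

lemma wins_smp: "good \<omega> \<Longrightarrow> wins p (smp x \<omega>) = out p x \<omega>"
  unfolding wins_def by (intro the_equality out_follows follows_game_unique)

lemma X_0: "good \<omega> \<Longrightarrow> X p x \<omega> 0 = x"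
  by (simp add: fun_eq_iff X_eq good_proper)

section \<open>The flow property under gluing\<close>

context
  fixes p :: game and s :: real and \<omega> \<omega>' :: noise
  assumes gd: "good \<omega>" "good \<omega>'" "good (glue s \<omega> \<omega>')" and s: "s \<ge> 0"
begin

private lemma pr: "proper (\<omega> i)" "proper (\<omega>' i)"
  using gd by (auto intro: good_proper)

lemma cnt_glue: "cnt (glue s \<omega> \<omega>' i) t = (if t \<le> s then cnt (\<omega> i) t else cnt (\<omega> i) s + cnt (\<omega>' i) (t - s))"
  unfolding glue_def by (rule cnt_splice[OF pr s])

text \<open>The outcomes before \<open>s\<close>, followed by those of the system restarted from the
  state at \<open>s\<close>, satisfy the defining equation for the glued noise, and that equation
  has only one solution.\<close>

lemma out_glue:
  "out p x (glue s \<omega> \<omega>') i n =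
    (if n < cnt (\<omega> i) s then out p x \<omega> i n else out p (X p x \<omega> s) \<omega>' i (n - cnt (\<omega> i) s))"
proof -
  define w where "w i n = (if n < cnt (\<omega> i) s then out p x \<omega> i n
    else out p (X p x \<omega> s) \<omega>' i (n - cnt (\<omega> i) s))" for i n
  have early: "config_before (smp x (glue s \<omega> \<omega>')) w t j = X p x \<omega> t j" if "t \<le> s" for t j
    using that cnt_mono[OF pr(1) that, of j]
    by (auto simp: config_before_smp X_eq cnt_glue w_def split: nat.split)
  have late: "config_before (smp x (glue s \<omega> \<omega>')) w (s + t) j = X p (X p x \<omega> s) \<omega>' t j" if "t > 0" for t j
    using that by (cases "cnt (\<omega>' j) t"; cases "cnt (\<omega> j) s")
      (auto simp: config_before_smp X_eq cnt_glue w_def split: nat.split)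
  have "follows_game p (smp x (glue s \<omega> \<omega>')) w"
    unfolding follows_game_def
  proof (intro allI)
    fix i n
    have m: "snd (glue s \<omega> \<omega>' i n) = (if n < cnt (\<omega> i) s then snd (\<omega> i n) else snd (\<omega>' i (n - cnt (\<omega> i) s)))"
      by (simp add: glue_def snd_splice[OF pr s])
    have T: "ptime (glue s \<omega> \<omega>' i) n = (if n < cnt (\<omega> i) s then ptime (\<omega> i) n else s + ptime (\<omega>' i) (n - cnt (\<omega> i) s))"
      by (simp add: glue_def ptime_splice[OF pr s])
    show "w i n = (mark (smp x (glue s \<omega> \<omega>')) i n <
        p (nbhd (config_before (smp x (glue s \<omega> \<omega>')) w (play_time (smp x (glue s \<omega> \<omega>')) i n)) i))"
    proof (cases "n < cnt (\<omega> i) s")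
      case True
      then have "ptime (\<omega> i) n < s" by (simp add: less_cnt_iff[OF pr(1)])
      then have "nbhd (config_before (smp x (glue s \<omega> \<omega>')) w (ptime (\<omega> i) n)) i = nbhd (X p x \<omega> (ptime (\<omega> i) n)) i"
        by (intro nbhd_cong early) auto
      with True show ?thesis by (simp add: m T w_def out_unfold[OF gd(1)])
    next
      case False
      let ?n = "n - cnt (\<omega> i) s"
      have "nbhd (config_before (smp x (glue s \<omega> \<omega>')) w (s + ptime (\<omega>' i) ?n)) i
          = nbhd (X p (X p x \<omega> s) \<omega>' (ptime (\<omega>' i) ?n)) i"
        by (intro nbhd_cong late proper_ptime_pos pr)
      with False show ?thesis by (simp add: m T w_def out_unfold[OF gd(2)])
    qed
  qed
  from follows_game_unique[OF gd(3) this] show ?thesis by (simp add: w_def fun_eq_iff)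
qed

lemma X_glue_le:
  assumes "t \<le> s" shows "X p x (glue s \<omega> \<omega>') t = X p x \<omega> t"
proof
  fix j show "X p x (glue s \<omega> \<omega>') t j = X p x \<omega> t j"
    using assms cnt_mono[OF pr(1) assms, of j] by (auto simp: X_eq cnt_glue out_glue split: nat.split)
qed

lemma X_glue_ge:
  assumes "t \<ge> 0" shows "X p x (glue s \<omega> \<omega>') (s + t) = X p (X p x \<omega> s) \<omega>' t"
proof
  fix j show "X p x (glue s \<omega> \<omega>') (s + t) j = X p (X p x \<omega> s) \<omega>' t j"
  proof (cases "t = 0")
    case True
    then show ?thesis using X_glue_le[of s x] X_0[OF gd(2)] by simp
  next
    case False
    with assms show ?thesis by (cases "cnt (\<omega>' j) t"; cases "cnt (\<omega> j) s")
      (auto simp: X_eq cnt_glue out_glue split: nat.split)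
  qed
qed

end

subsection \<open>A law of large numbers\<close>

text \<open>Monotonicity encloses \<open>s n\<close> between the values at the two neighbouring
  squares, and the ratio of consecutive squares tends to 1.\<close>

lemma mono_average_interpolate:
  fixes s :: "nat \<Rightarrow> real"
  assumes mono: "mono s" and s0: "s 0 \<ge> 0" and lim: "(\<lambda>m. s ((Suc m)^2) / real ((Suc m)^2)) \<longlonglongrightarrow> b"
  shows "(\<lambda>n. s n / real n) \<longlonglongrightarrow> b"
proof -
  define r where "r n = nat \<lfloor>sqrt (real n)\<rfloor>" for n :: nat
  have r1: "(r n)^2 \<le> n" for n
  proof -
    have "real (r n) \<le> sqrt (real n)" by (simp add: r_def)
    then have "(real (r n))^2 \<le> (sqrt (real n))^2" by (intro power_mono) auto
    then show ?thesis by (simp flip: of_nat_power)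
  qed
  have r2: "n < (Suc (r n))^2" for n
  proof -
    have "sqrt (real n) < real (Suc (r n))" unfolding r_def by linarith
    then have "(sqrt (real n))^2 < (real (Suc (r n)))^2" by (intro power_strict_mono) auto
    then have "real n < real ((Suc (r n))^2)" by (simp only: of_nat_power real_sqrt_pow2 of_nat_0_le_iff)
    then show ?thesis by (simp only: of_nat_less_iff)
  qed
  have rlim: "filterlim r at_top sequentially"
  proof (rule filterlim_at_top[THEN iffD2], rule allI)
    fix Z
    show "\<forall>\<^sub>F n in sequentially. Z \<le> r n"
      using eventually_ge_at_top[of "Z^2"]
    proof eventually_elim
      case (elim n)
      then have "real (Z^2) \<le> real n" by (simp only: of_nat_le_iff)
      then have "real Z \<le> sqrt (real n)" by (intro real_le_rsqrt) simp
      then show ?case unfolding r_def by linarith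
    qed
  qed
  define L where "L m = s (Suc m ^ 2) / real (Suc m ^ 2)" for m
  have sn: "s n \<ge> 0" for n using monoD[OF mono, of 0 n] s0 by simp
  have q: "(\<lambda>m::nat. (real m / real (Suc m))^2) \<longlonglongrightarrow> 1"
    using tendsto_power[OF LIMSEQ_n_over_Suc_n[where 'a=real], of 2] by simp
  have lo: "(\<lambda>n. L (r n - 1) * (real (r n) / real (Suc (r n)))^2) \<longlonglongrightarrow> b * 1"
  proof (intro tendsto_mult)
    have "filterlim (\<lambda>n. r n - 1) at_top sequentially"
      by (rule filterlim_compose[OF filterlim_minus_const_nat_at_top rlim])
    from filterlim_compose[OF lim this] show "(\<lambda>n. L (r n - 1)) \<longlonglongrightarrow> b" by (simp add: L_def)
    show "(\<lambda>n. (real (r n) / real (Suc (r n)))^2) \<longlonglongrightarrow> 1"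
      by (rule filterlim_compose[OF q rlim])
  qed
  have hi: "(\<lambda>n. L (r n) / (real (r n) / real (Suc (r n)))^2) \<longlonglongrightarrow> b / 1"
  proof (intro tendsto_divide)
    from filterlim_compose[OF lim rlim] show "(\<lambda>n. L (r n)) \<longlonglongrightarrow> b" by (simp add: L_def)
    show "(\<lambda>n. (real (r n) / real (Suc (r n)))^2) \<longlonglongrightarrow> 1"
      by (rule filterlim_compose[OF q rlim])
  qed simp
  have ev: "\<forall>\<^sub>F n in sequentially. 1 \<le> r n"
    using rlim by (auto simp: filterlim_at_top)
  show ?thesis
  proof (rule tendsto_sandwich)
    show "\<forall>\<^sub>F n in sequentially. L (r n - 1) * (real (r n) / real (Suc (r n)))\<^sup>2 \<le> s n / real n"
      using ev
    proof eventually_elim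
      case (elim n)
      have n: "n > 0" using r1[of n] elim by (cases "n = 0") auto
      have "L (r n - 1) * (real (r n) / real (Suc (r n)))\<^sup>2 = s ((r n)^2) / (1 + real (r n))\<^sup>2"
        using elim by (simp add: L_def power_divide)
      also have "\<dots> \<le> s n / (1 + real (r n))\<^sup>2"
        by (intro divide_right_mono monoD[OF mono] r1) simp
      also have "\<dots> \<le> s n / real n"
        using r2[of n] n by (intro divide_left_mono sn) (auto simp flip: of_nat_Suc of_nat_power intro!: mult_pos_pos)
      finally show ?case .
    qed
    show "\<forall>\<^sub>F n in sequentially. s n / real n \<le> L (r n) / (real (r n) / real (Suc (r n)))\<^sup>2"
      using ev
    proof eventually_elim
      case (elim n)
      have n: "n > 0" using r1[of n] elim by (cases "n = 0") auto
      have "s n / real n \<le> s ((Suc (r n))^2) / real n"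
        using r2[of n] by (intro divide_right_mono monoD[OF mono]) auto
      also have "\<dots> \<le> s ((Suc (r n))^2) / (real (r n))^2"
        using r1[of n] elim n by (intro divide_left_mono sn) (auto simp flip: of_nat_power intro!: mult_pos_pos)
      also have "\<dots> = L (r n) / (real (r n) / real (Suc (r n)))\<^sup>2"
        by (simp add: L_def power_divide)
      finally show ?case .
    qed
  qed (use lo hi in simp_all)
qed

text \<open>By orthogonality the n-th partial sum has second moment at most \<open>n V\<close>, so
  along the squares the squared averages have summable expectations. The one-sided bound then closes
  the gaps, because adding \<open>B n\<close> makes the partial sums increasing. It is one-sided in
  view of the waiting times, which are unbounded above.\<close>

lemma (in prob_space) orthogonal_LLN:
  fixes Y :: "nat \<Rightarrow> 'a \<Rightarrow> real"
  assumes meas[measurable]: "\<And>k. Y k \<in> borel_measurable M"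
    and int: "\<And>k. integrable M (\<lambda>x. (Y k x)^2)"
    and bound: "\<And>k. expectation (\<lambda>x. (Y k x)^2) \<le> V"
    and orth: "\<And>j k. j < k \<Longrightarrow> expectation (\<lambda>x. Y j x * Y k x) = 0"
    and low: "\<And>k. AE x in M. - B \<le> Y k x" and B: "B \<ge> 0"
  shows "AE x in M. (\<lambda>n. (\<Sum>k<n. Y k x) / real n) \<longlonglongrightarrow> 0"
proof -
  have int2: "integrable M (\<lambda>x. Y j x * Y k x)" for j k
  proof (rule Bochner_Integration.integrable_bound)
    show "integrable M (\<lambda>x. (Y j x)^2 + (Y k x)^2)" using int by auto
    show "AE x in M. norm (Y j x * Y k x) \<le> norm ((Y j x)^2 + (Y k x)^2)"
    proof (intro AE_I2)
      fix x
      have "2 * (\<bar>Y j x\<bar> * \<bar>Y k x\<bar>) \<le> (Y j x)^2 + (Y k x)^2"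
        using sum_squares_bound[of "\<bar>Y j x\<bar>" "\<bar>Y k x\<bar>"] by simp
      then show "norm (Y j x * Y k x) \<le> norm ((Y j x)^2 + (Y k x)^2)"
        using abs_ge_zero[of "Y j x * Y k x"] unfolding real_norm_def abs_mult by linarith
    qed
  qed measurable
  define S where "S n x = (\<Sum>k<n. Y k x)" for n x
  have [measurable]: "S n \<in> borel_measurable M" for n unfolding S_def by measurable
  have ES: "integrable M (\<lambda>x. (S n x)^2) \<and> expectation (\<lambda>x. (S n x)^2) \<le> real n * V" for n
  proof (induction n)
    case 0 then show ?case by (simp add: S_def)
  next
    case (Suc n)
    have eq: "(S (Suc n) x)^2 = (S n x)^2 + 2 * (\<Sum>j<n. Y j x * Y n x) + (Y n x)^2" for x
      by (simp add: S_def power2_sum sum_distrib_right)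
    have "expectation (\<lambda>x. (S (Suc n) x)^2)
        = expectation (\<lambda>x. (S n x)^2) + 2 * (\<Sum>j<n. expectation (\<lambda>x. Y j x * Y n x)) + expectation (\<lambda>x. (Y n x)^2)"
      unfolding eq using Suc int int2 by simp
    also have "\<dots> \<le> real n * V + 2 * 0 + V"
      using Suc bound[of n] orth by simp
    finally show ?case using Suc int int2 by (simp add: eq algebra_simps)
  qed
  define Z where "Z m x = (S (Suc m ^ 2) x / real (Suc m ^ 2))^2" for m x
  have [measurable]: "Z m \<in> borel_measurable M" for m unfolding Z_def by measurable
  have V: "V \<ge> 0" using bound[of 0] by (rule order_trans[rotated]) simp
  have EZ: "(\<integral>\<^sup>+x. ennreal (Z m x) \<partial>M) \<le> ennreal (V / real (Suc m)^2)" for m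
  proof -
    have Zeq: "Z m x = (S (Suc m ^ 2) x)^2 / real (Suc m) ^ 4" for x
      by (simp add: Z_def power_divide flip: power_mult)
    have "expectation (Z m) = expectation (\<lambda>x. (S (Suc m ^ 2) x)^2) / real (Suc m) ^ 4"
      unfolding Zeq by simp
    also have "\<dots> \<le> real (Suc m ^ 2) * V / real (Suc m) ^ 4"
      using ES[of "Suc m ^ 2"] by (intro divide_right_mono) (simp_all del: of_nat_power of_nat_Suc)
    also have "\<dots> = V / real (Suc m)^2"
      by (simp add: divide_simps power_eq_if) (simp add: algebra_simps)
    finally have "expectation (Z m) \<le> V / real (Suc m)^2" .
    moreover have "(\<integral>\<^sup>+x. ennreal (Z m x) \<partial>M) = ennreal (expectation (Z m))"
      using ES[of "Suc m ^ 2"] by (intro nn_integral_eq_integral) (auto simp: Zeq)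
    ultimately show ?thesis by (simp add: ennreal_leI)
  qed
  have "(\<integral>\<^sup>+x. (\<Sum>m. ennreal (Z m x)) \<partial>M) = (\<Sum>m. \<integral>\<^sup>+x. ennreal (Z m x) \<partial>M)"
    by (rule nn_integral_suminf) simp
  also have "\<dots> \<le> (\<Sum>m. ennreal (V / real (Suc m)^2))"
    by (intro suminf_le EZ) auto
  also have "\<dots> < top"
  proof -
    have "summable (\<lambda>m. V / real (Suc m)^2)"
      using summable_mult[OF inverse_power_summable[of 2, where 'a=real, unfolded summable_Suc_iff[symmetric, of "\<lambda>n. inverse (of_nat n ^ 2)"]], of V]
      by (simp add: field_simps)
    then show ?thesis using V by (subst suminf_ennreal2) auto
  qed
  finally have "AE x in M. (\<Sum>m. ennreal (Z m x)) \<noteq> \<infinity>"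
    by (intro nn_integral_PInf_AE) auto
  moreover have "AE x in M. \<forall>k. - B \<le> Y k x" using low by (simp add: AE_all_countable)
  ultimately show ?thesis
  proof eventually_elim
    case (elim x)
    have "summable (\<lambda>m. Z m x)"
      by (rule summable_suminf_not_top) (use elim in \<open>auto simp: Z_def\<close>)
    then have "(\<lambda>m. Z m x) \<longlonglongrightarrow> 0" by (rule summable_LIMSEQ_zero)
    then have "(\<lambda>m. sqrt (Z m x)) \<longlonglongrightarrow> sqrt 0" by (rule tendsto_real_sqrt)
    then have "(\<lambda>m. \<bar>S (Suc m ^ 2) x / real (Suc m ^ 2)\<bar>) \<longlonglongrightarrow> 0"
      by (simp add: Z_def)
    then have "(\<lambda>m. S (Suc m ^ 2) x / real (Suc m ^ 2)) \<longlonglongrightarrow> 0"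
      by (simp only: tendsto_rabs_zero_iff)
    then have "(\<lambda>m. S (Suc m ^ 2) x / real (Suc m ^ 2) + B) \<longlonglongrightarrow> 0 + B"
      by (intro tendsto_intros)
    then have "(\<lambda>m. (S (Suc m ^ 2) x + B * real (Suc m ^ 2)) / real (Suc m ^ 2)) \<longlonglongrightarrow> B"
      by (simp add: add_divide_distrib)
    then have "(\<lambda>n. (S n x + B * real n) / real n) \<longlonglongrightarrow> B"
    proof (rule mono_average_interpolate[rotated 2])
      show "mono (\<lambda>n. S n x + B * real n)"
      proof (rule mono_iff_le_Suc[THEN iffD2], rule allI)
        fix n show "S n x + B * real n \<le> S (Suc n) x + B * real (Suc n)"
          using elim(2)[rule_format, of n] by (simp add: S_def algebra_simps)
      qed
    qed (simp add: S_def)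
    then have "(\<lambda>n. (S n x + B * real n) / real n - B) \<longlonglongrightarrow> B - B"
      by (intro tendsto_intros)
    moreover have "\<forall>\<^sub>F n in sequentially. (S n x + B * real n) / real n - B = S n x / real n"
      using eventually_gt_at_top[of 0] by eventually_elim (simp add: field_simps)
    ultimately show ?case
      by (simp add: S_def filterlim_cong[OF refl refl])
  qed
qed

subsection \<open>Almost every noise is good\<close>

abbreviation "wait_law \<equiv> density lborel (exponential_density 1)"

lemma distr_step_fst: "distr step_law wait_law fst = wait_law"
  unfolding step_law_def by (rule unif.distr_pair_fst)

lemma measurable_fst_step[measurable]: "fst \<in> measurable step_law wait_law"
  unfolding step_law_def by (rule measurable_fst)

abbreviation "mark_law \<equiv> uniform_measure lborel {0..1::real}"

lemma measurable_snd_step[measurable]: "snd \<in> measurable step_law mark_law"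
  unfolding step_law_def by (rule measurable_snd)

lemma distr_step_snd: "distr step_law mark_law snd = mark_law"
proof (rule measure_eqI)
  fix A assume "A \<in> sets (distr step_law mark_law snd)"
  then have A: "A \<in> sets mark_law" by simp
  have "emeasure (distr step_law mark_law snd) A = emeasure step_law (snd -` A \<inter> space step_law)"
    by (rule emeasure_distr[OF measurable_snd_step A])
  also have "snd -` A \<inter> space step_law = space wait_law \<times> A" by auto
  also have "emeasure step_law (space wait_law \<times> A) = emeasure wait_law (space wait_law) * emeasure mark_law A"
    unfolding step_law_def by (rule unif.emeasure_pair_measure_Times) (use A in auto)
  finally show "emeasure (distr step_law mark_law snd) A = emeasure mark_law A"
    by (simp only: wait.emeasure_space_1 mult_1)
qed simp

lemma borel_measurable_fst_step[measurable]: "fst \<in> borel_measurable step_law"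
  by (simp add: measurable_cong_sets[OF sets_step_law refl])

lemma site_prob_UNIV[simp]: "measure site_law UNIV = 1"
  by (simp add: measure_def site.emeasure_space_1[simplified])

lemma noise_prob_UNIV[simp]: "measure noise_law UNIV = 1"
  using noise.emeasure_space_1 by (simp add: measure_def)

lemma prob_wait_ge: "t \<ge> 0 \<Longrightarrow> measure wait_law {t..} = exp (- t)"
proof -
  assume t: "t \<ge> 0"
  have D: "distributed wait_law lborel (\<lambda>x. x) (exponential_density 1)"
    by (auto simp: distributed_def intro!: distr_id2)
  have "measure wait_law {x \<in> space wait_law. t < x} = exp (- t)"
    using wait.exponential_distributedD_gt[OF D t] by simp
  moreover have "measure wait_law {t..} = measure wait_law {x \<in> space wait_law. t < x}"
  proof (rule measure_eq_AE)
    have "AE x in lborel. x \<noteq> t" by (rule AE_lborel_singleton)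
    then show "AE x in wait_law. (x \<in> {t..}) = (x \<in> {x \<in> space wait_law. t < x})"
      by (subst AE_density) auto
  qed auto
  ultimately show ?thesis by simp
qed

lemma AE_wait_pos: "AE x in wait_law. 0 < x"
proof (subst AE_density)
  have "AE x in lborel. x \<noteq> (0::real)" by (rule AE_lborel_singleton)
  then show "AE x in lborel. 0 < ennreal (exponential_density 1 x) \<longrightarrow> 0 < x"
    by eventually_elim (auto simp: exponential_density_def)
qed simp

lemma AE_wait_neq: "AE x in wait_law. x \<noteq> c"
proof (subst AE_density)
  have "AE x in lborel. x \<noteq> c" by (rule AE_lborel_singleton)
  then show "AE x in lborel. 0 < ennreal (exponential_density 1 x) \<longrightarrow> x \<noteq> c"
    by eventually_elim auto
qed simp

lemma AE_step_fst: "AE x in wait_law. P x \<Longrightarrow> AE a in step_law. P (fst a)"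
  by (rule AE_distrD[OF measurable_fst_step]) (unfold distr_step_fst)

lemma nn_integral_wait_power:
  "(\<integral>\<^sup>+a. ennreal (fst a ^ k) \<partial>step_law) = ennreal (fact k)"
proof -
  have "(\<integral>\<^sup>+a. ennreal (fst a ^ k) \<partial>step_law) = (\<integral>\<^sup>+e. ennreal (e ^ k) \<partial>distr step_law wait_law fst)"
    by (rule nn_integral_distr[symmetric]) simp_all
  also have "\<dots> = (\<integral>\<^sup>+x. ennreal (exponential_density 1 x) * ennreal (x ^ k) \<partial>lborel)"
    unfolding distr_step_fst by (rule nn_integral_density) simp_all
  also have "\<dots> = (\<integral>\<^sup>+x. ennreal (x ^ k * exp (- x)) * indicator {0..} x \<partial>lborel)"
    by (intro nn_integral_cong) (auto simp: exponential_density_def indicator_def ennreal_mult[symmetric] mult.commute)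
  also have "\<dots> = ennreal (fact k)"
    by (subst nn_intergal_power_times_exp_Ici) (simp add: fact_ge_zero)
  finally show ?thesis .
qed

lemma AE_step_pos: "AE a in step_law. 0 < fst a"
  by (rule AE_step_fst[OF AE_wait_pos])

lemma AE_step_mark: "AE a in step_law. 0 \<le> snd a \<and> snd a < 1"
proof -
  have u: "AE u in uniform_measure lborel {0..1::real}. 0 \<le> u \<and> u < 1"
  proof (rule AE_uniform_measureI)
    have "AE x in lborel. x \<noteq> (1::real)" by (rule AE_lborel_singleton)
    then show "AE x in lborel. x \<in> {0..1::real} \<longrightarrow> 0 \<le> x \<and> x < 1"
      by eventually_elim auto
  qed simp
  have "AE a in step_law. 0 \<le> snd a \<and> snd a < 1"
    by (rule AE_distrD[OF measurable_snd_step]) (unfold distr_step_snd, rule u)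
  then show ?thesis .
qed

lemma AE_step_neq: "AE a in step_law. fst a \<noteq> c"
  by (rule AE_step_fst[OF AE_wait_neq])

lemma AE_site_component:
  assumes "AE a in step_law. P a"
  shows "AE e in site_law. \<forall>n. P (e n)"
  unfolding AE_all_countable
proof
  fix n show "AE e in site_law. P (e n)"
    using site.AE_component[of n P] assms by simp
qed

lemma AE_noise_component:
  assumes "AE e in site_law. P e"
  shows "AE \<omega> in noise_law. \<forall>i. P (\<omega> i)"
  unfolding AE_all_countable
proof
  fix i show "AE \<omega> in noise_law. P (\<omega> i)"
    using noise.AE_component[of i P] assms by simp
qed

lemma site_LLN: "AE e in site_law. (\<lambda>n. (\<Sum>k<n. fst (e k)) / real n) \<longlonglongrightarrow> 1"
proof -
  have pos: "AE e in site_law. \<forall>n. 0 < fst (e n)" by (rule AE_site_component[OF AE_step_pos])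
  have comp: "(\<integral>\<^sup>+e. ennreal (fst (e k) ^ m) \<partial>site_law) = ennreal (fact m)" for k m
    using nn_integral_PiM_prod[OF step.prob_space_axioms, of "{k}" "\<lambda>_ a. ennreal (fst a ^ m)"]
    by (simp add: nn_integral_wait_power site_law_def[symmetric] measurable_cong_sets[OF sets_step_law refl])
  have prod: "(\<integral>\<^sup>+e. ennreal (fst (e j)) * ennreal (fst (e k)) \<partial>site_law) = 1" if "j \<noteq> k" for j k
    using nn_integral_PiM_prod[OF step.prob_space_axioms, of "{j, k}" "\<lambda>_ a. ennreal (fst a)"] that
    by (simp add: nn_integral_wait_power[of 1, simplified] site_law_def[symmetric] measurable_cong_sets[OF sets_step_law refl])
  have I: "integrable site_law (\<lambda>e. fst (e k) ^ m)" "(\<integral>e. fst (e k) ^ m \<partial>site_law) = fact m" for k m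
  proof -
    have ae: "AE e in site_law. 0 \<le> fst (e k) ^ m"
      using pos by eventually_elim (simp add: less_imp_le)
    show "integrable site_law (\<lambda>e. fst (e k) ^ m)"
      by (rule integrableI_nonneg[OF _ ae]) (simp_all add: comp)
    show "(\<integral>e. fst (e k) ^ m \<partial>site_law) = fact m"
      by (subst integral_eq_nn_integral[OF _ ae]) (simp_all add: comp)
  qed
  note I1 = I[of _ 1, simplified] and I2 = I[of _ 2]
  have J: "integrable site_law (\<lambda>e. fst (e j) * fst (e k))" "(\<integral>e. fst (e j) * fst (e k) \<partial>site_law) = 1"
    if "j \<noteq> k" for j k
  proof -
    have ae: "AE e in site_law. 0 \<le> fst (e j) * fst (e k)"
      using pos by eventually_elim (simp add: less_imp_le)
    have nn: "(\<integral>\<^sup>+e. ennreal (fst (e j) * fst (e k)) \<partial>site_law) = 1"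
    proof -
      have "(\<integral>\<^sup>+e. ennreal (fst (e j) * fst (e k)) \<partial>site_law) = (\<integral>\<^sup>+e. ennreal (fst (e j)) * ennreal (fst (e k)) \<partial>site_law)"
        using pos by (intro nn_integral_cong_AE, eventually_elim) (simp add: ennreal_mult less_imp_le)
      with prod[OF that] show ?thesis by simp
    qed
    show "integrable site_law (\<lambda>e. fst (e j) * fst (e k))"
      by (rule integrableI_nonneg[OF _ ae]) (simp_all add: nn)
    show "(\<integral>e. fst (e j) * fst (e k) \<partial>site_law) = 1"
      by (subst integral_eq_nn_integral[OF _ ae]) (simp_all add: nn)
  qed
  have "AE e in site_law. (\<lambda>n. (\<Sum>k<n. fst (e k) - 1) / real n) \<longlonglongrightarrow> 0"
  \<comment> \<open>A waiting time has mean 1 and second moment 2, hence variance 1, and being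
    positive it is at least its mean minus 1.\<close>
  proof (rule site.orthogonal_LLN[where V=1 and B=1])
    show "integrable site_law (\<lambda>e. (fst (e k) - 1)^2)" for k
      using I1 I2 by (simp add: power2_diff)
    show "(\<integral>e. (fst (e k) - 1)^2 \<partial>site_law) \<le> 1" for k
      using I1 I2 by (simp add: power2_diff site.prob_space[simplified])
    show "(\<integral>e. (fst (e j) - 1) * (fst (e k) - 1) \<partial>site_law) = 0" if "j < k" for j k
      using I1 J[of j k] that by (simp add: algebra_simps)
    show "AE e in site_law. - 1 \<le> fst (e k) - 1" for k
      using pos by eventually_elim (simp add: less_imp_le)
  qed simp_all
  then show ?thesis
  proof eventually_elim
    case (elim e)
    then have "(\<lambda>n. (\<Sum>k<n. fst (e k) - 1) / real n + 1) \<longlonglongrightarrow> 0 + 1"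
      by (intro tendsto_intros)
    moreover have "\<forall>\<^sub>F n in sequentially. (\<Sum>k<n. fst (e k) - 1) / real n + 1 = (\<Sum>k<n. fst (e k)) / real n"
      using eventually_gt_at_top[of 0] by eventually_elim (simp add: sum_subtractf field_simps)
    ultimately show ?case by (simp add: filterlim_cong[OF refl refl])
  qed
qed

text \<open>The strong law excludes an accumulation of plays: the first n waiting times eventually
  add up to more than n / 2.\<close>

lemma AE_proper: "AE e in site_law. proper e"
  using AE_site_component[OF AE_step_pos] site_LLN
proof eventually_elim
  case (elim e)
  show ?case
    unfolding proper_def
  proof (intro conjI allI)
    fix t
    have "\<forall>\<^sub>F n in sequentially. (\<Sum>k<n. fst (e k)) / real n > 1/2"
      using elim(2) by (rule order_tendstoD) simp
    moreover have "\<forall>\<^sub>F n in sequentially. real n \<ge> 2 * \<bar>t\<bar> + 1"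
      using filterlim_real_sequentially by (auto simp: filterlim_at_top)
    ultimately have "\<forall>\<^sub>F n in sequentially. t \<le> (\<Sum>k<n. fst (e k))"
    proof eventually_elim
      case (elim n)
      then have "real n > 0" by linarith
      with elim(1) have "real n / 2 < (\<Sum>k<n. fst (e k))" by (simp add: field_simps)
      with elim(2) show ?case by linarith
    qed
    then obtain n where "t \<le> (\<Sum>k<n. fst (e k))" by (auto simp: eventually_sequentially)
    then have "t \<le> (\<Sum>k\<le>n. fst (e k))"
      using elim(1)[rule_format, of n] by (simp add: lessThan_Suc_atMost[symmetric])
    then show "\<exists>n. t \<le> ptime e n" by (auto simp: ptime_def)
  qed (use elim in auto)
qed

lemma prob_first_wait_ge:
  assumes "t \<ge> 0"
  shows "measure site_law {e. t \<le> fst (e 0)} = exp (- t)"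
proof -
  have A: "{a. t \<le> fst a} \<in> sets step_law"
    using measurable_sets[OF measurable_fst_step, of "{t..}"] by (simp add: vimage_def)
  have "measure site_law {e. t \<le> fst (e 0)} = measure step_law {a. t \<le> fst a}"
    using site.emeasure_PiM_Collect_single[of 0 "{a. t \<le> fst a}"] A by (simp add: measure_def)
  also have "\<dots> = measure (distr step_law wait_law fst) {t..}"
    by (subst measure_distr) (auto simp: vimage_def)
  finally show ?thesis
    unfolding distr_step_fst using prob_wait_ge[OF assms] by simp
qed

lemma first_wait_sets[measurable]: "{e. t \<le> fst (e 0)} \<in> sets site_law" "{e. fst (e 0) < t} \<in> sets site_law"
proof -
  have "{e \<in> space site_law. t \<le> fst (e 0)} \<in> sets site_law" "{e \<in> space site_law. fst (e 0) < t} \<in> sets site_law"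
    by measurable
  then show "{e. t \<le> fst (e 0)} \<in> sets site_law" "{e. fst (e 0) < t} \<in> sets site_law" by simp_all
qed

text \<open>Each player is silent before \<open>t\<close> with the same positive probability
  \<open>exp (- t)\<close>, independently of the others, and infinitely many such chances cannot all
  fail.\<close>

lemma AE_quiet:
  fixes I :: "int set"
  assumes "infinite I" "t \<ge> 0"
  shows "AE \<omega> in noise_law. \<exists>j\<in>I. t \<le> fst (\<omega> j 0)"
proof -
  define A where "A = {e :: nat \<Rightarrow> real \<times> real. fst (e 0) < t}"
  define N where "N = {\<omega> :: noise. \<forall>j\<in>I. \<omega> j \<in> A}"
  have A: "A \<in> sets site_law" unfolding A_def by measurable
  have "A = space site_law - {e. t \<le> fst (e 0)}" by (auto simp: A_def)
  then have pA: "measure site_law A = 1 - exp (- t)"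
    using site.prob_compl[of "{e. t \<le> fst (e 0)}"] prob_first_wait_ge[OF assms(2)] by simp
  have "{\<omega> \<in> space noise_law. \<forall>j\<in>I. \<omega> j \<in> A} \<in> sets noise_law"
    by (rule sets.sets_Collect_countable_Ball) (use measurable_sets[OF measurable_noise_component[OF measurable_ident] A] in \<open>auto simp: vimage_def\<close>)
  then have N: "N \<in> sets noise_law" by (simp add: N_def)
  have le: "measure noise_law N \<le> (1 - exp (- t)) ^ k" for k
  proof -
    obtain J where J: "finite J" "card J = k" "J \<subseteq> I"
      using infinite_arbitrarily_large[OF assms(1)] by blast
    have "emeasure noise_law {x \<in> space noise_law. \<forall>i\<in>J. x i \<in> A} = (\<Prod>i\<in>J. emeasure site_law A)"
      by (rule noise.emeasure_PiM_Collect) (use J A in auto)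
    also have "\<dots> = ennreal ((1 - exp (- t)) ^ k)"
      using J assms(2) by (simp add: site.emeasure_eq_measure pA ennreal_power)
    finally have *: "emeasure noise_law {x. \<forall>i\<in>J. x i \<in> A} = ennreal ((1 - exp (- t)) ^ k)" by simp
    have "emeasure noise_law N \<le> emeasure noise_law {x. \<forall>i\<in>J. x i \<in> A}"
    proof (rule emeasure_mono)
      have "{x \<in> space noise_law. \<forall>j\<in>J. x j \<in> A} \<in> sets noise_law"
        by (rule sets.sets_Collect_countable_Ball) (use measurable_sets[OF measurable_noise_component[OF measurable_ident] A] in \<open>auto simp: vimage_def\<close>)
      then show "{x. \<forall>i\<in>J. x i \<in> A} \<in> sets noise_law" by simp
    qed (use J in \<open>auto simp: N_def\<close>)
    with * show ?thesis using assms(2) by (simp add: noise.emeasure_eq_measure)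
  qed
  have "(\<lambda>k. (1 - exp (- t)) ^ k) \<longlonglongrightarrow> 0"
    using assms(2) by (intro LIMSEQ_realpow_zero) auto
  then have "measure noise_law N \<le> 0"
    by (rule LIMSEQ_le_const) (use le in auto)
  then have "emeasure noise_law N = 0"
    using measure_nonneg[of noise_law N] by (simp add: noise.emeasure_eq_measure)
  with N have "AE \<omega> in noise_law. \<omega> \<notin> N" by (intro AE_not_in) (simp add: null_sets_def)
  then show ?thesis by eventually_elim (auto simp: N_def A_def not_less)
qed

lemma measurable_fst_site:
  "e \<in> measurable M site_law \<Longrightarrow> (\<lambda>x. fst (e x n)) \<in> borel_measurable M"
  by (rule measurable_compose[OF measurable_site_component measurable_fst])

lemma measurable_snd_site:
  "e \<in> measurable M site_law \<Longrightarrow> (\<lambda>x. snd (e x n)) \<in> borel_measurable M"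
  by (rule measurable_compose[OF measurable_site_component measurable_snd])

lemma measurable_ptime[measurable]:
  "e \<in> measurable M site_law \<Longrightarrow> (\<lambda>x. ptime (e x) n) \<in> borel_measurable M"
  unfolding ptime_def by (intro borel_measurable_sum measurable_fst_site)

text \<open>Given the later waiting times, the first one would have to take a single prescribed
  value, which a law with a density does not charge.\<close>

lemma AE_ptime_neq: "AE e in site_law. ptime e n \<noteq> c"
proof -
  interpret P: pair_sigma_finite step_law site_law ..
  have step_neq: "AE a in step_law. fst a + d \<noteq> c" for d
    using AE_step_neq[of "c - d"] by eventually_elim auto
  have split: "ptime (case_nat a e) n = fst a + (case n of 0 \<Rightarrow> 0 | Suc k \<Rightarrow> ptime e k)" for a e
    by (cases n) (simp_all add: ptime_shift)
  have m: "{z \<in> space (step_law \<Otimes>\<^sub>M site_law). ptime (case_nat (fst z) (snd z)) n \<noteq> c} \<in> sets (step_law \<Otimes>\<^sub>M site_law)"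
    by measurable
  have "AE z in step_law \<Otimes>\<^sub>M site_law. ptime (case_nat (fst z) (snd z)) n \<noteq> c"
  proof (rule P.AE_pair_measure[OF m])
    have "AE e in site_law. AE a in step_law. ptime (case_nat a e) n \<noteq> c"
      unfolding split using step_neq by simp
    then show "AE a in step_law. AE e in site_law. ptime (case_nat (fst (a, e)) (snd (a, e))) n \<noteq> c"
      unfolding fst_conv snd_conv by (subst P.AE_commute) (use m in auto)
  qed
  then have "AE e in distr (step_law \<Otimes>\<^sub>M site_law) site_law (\<lambda>(s, \<omega>). case_nat s \<omega>). ptime e n \<noteq> c"
  proof (subst AE_distr_iff)
    show "{e \<in> space site_law. ptime e n \<noteq> c} \<in> sets site_law" by measurable
  qed (simp_all add: split_beta')
  then show ?thesis unfolding site.PiM_iter .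
qed

text \<open>Fubini with the sequence of player \<open>i\<close> as a separate factor: the play time
  of the neighbour is then a constant, to which \<open>AE_ptime_neq\<close> applies.\<close>

lemma AE_no_tie: "AE \<omega> in noise_law. ptime (\<omega> i) n \<noteq> ptime (\<omega> (i + 1)) m"
proof -
  let ?R = "PiM (UNIV - {i}) (\<lambda>_. site_law)"
  interpret R: prob_space ?R by (rule prob_space_PiM) unfold_locales
  interpret P: pair_sigma_finite site_law ?R ..
  have upd: "(\<lambda>z. (snd z)(i := fst z)) \<in> measurable (site_law \<Otimes>\<^sub>M ?R) noise_law"
    unfolding noise_law_def
    unfolding fun_upd_def
  proof (rule measurable_abs_UNIV)
    fix k show "(\<lambda>z. if k = i then fst z else snd z k) \<in> measurable (site_law \<Otimes>\<^sub>M ?R) site_law"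
      by (cases "k = i") auto
  qed
  have m: "{z \<in> space (site_law \<Otimes>\<^sub>M ?R). ptime (fst z) n \<noteq> ptime (snd z (i + 1)) m} \<in> sets (site_law \<Otimes>\<^sub>M ?R)"
  proof (intro borel_measurable_neq measurable_ptime measurable_fst)
    show "(\<lambda>z. snd z (i + 1)) \<in> measurable (site_law \<Otimes>\<^sub>M ?R) site_law"
      by (rule measurable_compose[OF measurable_snd measurable_component_singleton]) auto
  qed
  have "AE \<eta> in ?R. AE e in site_law. ptime e n \<noteq> ptime (\<eta> (i + 1)) m"
    by (intro AE_I2 AE_ptime_neq)
  then have "AE e in site_law. AE \<eta> in ?R. ptime e n \<noteq> ptime (\<eta> (i + 1)) m"
    using P.AE_commute[of "\<lambda>e \<eta>. ptime e n \<noteq> ptime (\<eta> (i + 1)) m", OF m] by blast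
  then have *: "AE z in site_law \<Otimes>\<^sub>M ?R. ptime (fst z) n \<noteq> ptime (snd z (i + 1)) m"
    by (intro P.AE_pair_measure[OF m]) (simp only: fst_conv snd_conv)
  have m': "{\<omega> \<in> space noise_law. ptime (\<omega> i) n \<noteq> ptime (\<omega> (i + 1)) m} \<in> sets noise_law"
    by (intro borel_measurable_neq measurable_ptime measurable_noise_component measurable_ident_sets refl)
  have ae: "AE \<omega> in distr (site_law \<Otimes>\<^sub>M ?R) noise_law (\<lambda>z. (snd z)(i := fst z)). ptime (\<omega> i) n \<noteq> ptime (\<omega> (i + 1)) m"
    using * AE_distr_iff[OF upd m'] by simp
  have eq: "distr (site_law \<Otimes>\<^sub>M ?R) noise_law (\<lambda>z. (snd z)(i := fst z)) = noise_law"
  proof -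
    have "insert i (UNIV - {i}) = UNIV" by auto
    with distr_pair_PiM_eq_PiM[of "UNIV - {i}" "\<lambda>_. site_law" i] site.prob_space_axioms
    show ?thesis unfolding noise_law_def split_beta' by simp
  qed
  from ae show ?thesis unfolding eq .
qed

lemma AE_good: "AE \<omega> in noise_law. good \<omega>"
proof -
  have 1: "AE \<omega> in noise_law. \<forall>i. proper (\<omega> i)"
    by (rule AE_noise_component[OF AE_proper])
  \<comment> \<open>Times bounded by natural numbers suffice and keep the number of null sets
    countable.\<close>
  have 2: "AE \<omega> in noise_law. \<forall>k::nat. \<forall>i. \<exists>j\<in>{i<..}. real k \<le> fst (\<omega> j 0)"
    unfolding AE_all_countable using infinite_Ioi by (intro allI AE_quiet) auto
  have 3: "AE \<omega> in noise_law. \<forall>k::nat. \<forall>i. \<exists>j\<in>{..<i}. real k \<le> fst (\<omega> j 0)"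
    unfolding AE_all_countable using infinite_Iio by (intro allI AE_quiet) auto
  have 4: "AE \<omega> in noise_law. \<forall>i n m. ptime (\<omega> i) n \<noteq> ptime (\<omega> (i + 1)) m"
    unfolding AE_all_countable using AE_no_tie by blast
  have 5: "AE \<omega> in noise_law. \<forall>i n. 0 \<le> snd (\<omega> i n) \<and> snd (\<omega> i n) < 1"
    by (rule AE_noise_component[OF AE_site_component[OF AE_step_mark]])
  from 1 2 3 4 5 show ?thesis
  proof eventually_elim
    case (elim \<omega>)
    have "\<exists>j>i. t \<le> fst (\<omega> j 0)" "\<exists>j<i. t \<le> fst (\<omega> j 0)" for t i
    proof -
      obtain k :: nat where k: "t \<le> real k" using real_arch_simple by blast
      show "\<exists>j>i. t \<le> fst (\<omega> j 0)" "\<exists>j<i. t \<le> fst (\<omega> j 0)"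
        using elim(2,3)[rule_format, of i k] k by (auto intro: order_trans)
    qed
    with elim show ?case by (simp add: good_def)
  qed
qed

declare measurable_site_component[measurable del] measurable_noise_component[measurable del]

subsection \<open>Measurability\<close>

lemma measurable_cnt[measurable]:
  assumes "e \<in> measurable M site_law" "t \<in> borel_measurable M"
  shows "(\<lambda>z. cnt (e z) (t z)) \<in> measurable M (count_space UNIV)"
  unfolding cnt_def
proof (rule measurable_card)
  fix n show "{z \<in> space M. n \<in> {n. ptime (e z) n < t z}} \<in> sets M"
    using borel_measurable_less[OF measurable_ptime[OF assms(1), of n] assms(2)] by simp
qed

lemma measurable_config_component:
  "x \<in> measurable M config_space \<Longrightarrow> Measurable.pred M (\<lambda>z. x z i)"
  unfolding config_space_def by (rule measurable_compose[OF _ measurable_component_singleton]) auto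

lemma measurable_configI:
  assumes "\<And>i. Measurable.pred M (\<lambda>z. x z i)"
  shows "x \<in> measurable M config_space"
  unfolding config_space_def by (rule measurable_abs_UNIV) (rule assms)

lemma space_config_space[simp]: "space config_space = UNIV"
  by (auto simp: config_space_def space_PiM)

lemma measurable_game_nbhd:
  assumes "\<And>j. Measurable.pred M (\<lambda>z. c z j)"
  shows "(\<lambda>z. (p :: game) (nbhd (c z) i)) \<in> borel_measurable M"
proof -
  have [measurable]: "Measurable.pred M (\<lambda>z. c z (i - 1))" "Measurable.pred M (\<lambda>z. c z (i + 1))"
    by (rule assms)+
  have "(\<lambda>z. p (nbhd (c z) i)) = (\<lambda>z. if c z (i - 1) then (if c z (i + 1) then p 3 else p 2)
      else (if c z (i + 1) then p 1 else p 0))"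
    by (auto simp: nbhd_def fun_eq_iff numeral_3_eq_3 numeral_2_eq_2)
  then show ?thesis by simp
qed

lemma pred_config_before:
  assumes x: "x \<in> measurable M config_space" and \<omega>: "\<omega> \<in> measurable M noise_law" and t: "t \<in> borel_measurable M"
    and w: "\<And>k. Measurable.pred M (\<lambda>z. w z i k)"
  shows "Measurable.pred M (\<lambda>z. config_before (smp (x z) (\<omega> z)) (w z) (t z) i)"
proof -
  have [measurable]: "(\<lambda>z. cnt (\<omega> z i) (t z)) \<in> measurable M (count_space UNIV)"
    by (rule measurable_cnt[OF measurable_noise_component[OF \<omega>] t])
  note [measurable] = w measurable_config_component[OF x, of i]
  have "(\<lambda>z. config_before (smp (x z) (\<omega> z)) (w z) (t z) i)
      = (\<lambda>z. cnt (\<omega> z i) (t z) = 0 \<and> x z i \<or> (\<exists>k. cnt (\<omega> z i) (t z) = Suc k \<and> w z i k))"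
    by (auto simp: fun_eq_iff config_before_smp split: nat.split)
  then show ?thesis by simp
qed

lemma pred_out_iter:
  assumes x: "x \<in> measurable M config_space" and \<omega>: "\<omega> \<in> measurable M noise_law"
  shows "Measurable.pred M (\<lambda>z. out_iter p (x z) (\<omega> z) k i n)"
proof (induction k arbitrary: i n)
  case (Suc k)
  have "(\<lambda>z. snd (\<omega> z i n)) \<in> borel_measurable M"
    by (rule measurable_snd_site[OF measurable_noise_component[OF \<omega>]])
  moreover have "(\<lambda>z. p (nbhd (config_before (smp (x z) (\<omega> z)) (out_iter p (x z) (\<omega> z) k) (ptime (\<omega> z i) n)) i)) \<in> borel_measurable M"
    by (intro measurable_game_nbhd pred_config_before x \<omega> Suc measurable_ptime measurable_noise_component)
  ultimately show ?case by simp
qed simp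

lemma pred_out:
  assumes x: "x \<in> measurable M config_space" and \<omega>: "\<omega> \<in> measurable M noise_law"
  shows "Measurable.pred M (\<lambda>z. out p (x z) (\<omega> z) i n)"
proof -
  note [measurable] = pred_out_iter[OF assms]
  show ?thesis unfolding out_def by measurable
qed

lemma pred_X[measurable]:
  assumes "x \<in> measurable M config_space" "\<omega> \<in> measurable M noise_law"
  shows "Measurable.pred M (\<lambda>z. X p (x z) (\<omega> z) t i)"
  unfolding X_def by (intro pred_config_before pred_out assms) simp

lemma measurable_X[measurable]:
  assumes "x \<in> measurable M config_space" "\<omega> \<in> measurable M noise_law"
  shows "(\<lambda>z. X p (x z) (\<omega> z) t) \<in> measurable M config_space"
  by (intro measurable_configI pred_X assms)

lemma measurable_X1: "(\<lambda>\<omega>. X p x \<omega> t) \<in> measurable noise_law config_space"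
  by (rule measurable_X) simp_all

subsection \<open>The sample space and the noise\<close>

text \<open>A cylinder over pairs splits into one cylinder per player: \<open>A i\<close> collects
  the conditions on the plays \<open>n\<close> with \<open>(i, n)\<close> in
  \<open>J\<close>.\<close>

lemma distr_uncurry_noise:
  "distr noise_law (PiM UNIV (\<lambda>_. step_law)) (\<lambda>\<omega> (i, n). \<omega> i n) = PiM UNIV (\<lambda>_. step_law)"
    (is "distr _ ?P ?u = ?P")
proof -
  interpret P: product_prob_space "\<lambda>_. step_law" "UNIV :: (int \<times> nat) set" by unfold_locales
  have u: "?u \<in> measurable noise_law ?P"
  proof (rule measurable_PiM_single')
    fix k :: "int \<times> nat"
    show "(\<lambda>\<omega>. case k of (i, n) \<Rightarrow> \<omega> i n) \<in> measurable noise_law step_law"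
      using measurable_site_component[OF measurable_noise_component[OF measurable_ident_sets[OF refl]], of "fst k" "snd k"]
      by (simp add: split_beta' measurable_cong_sets[OF refl sets_step_law])
  qed (auto simp: space_PiM)
  show ?thesis
  proof (rule P.PiM_eq)
    fix J :: "(int \<times> nat) set" and F assume J: "finite J" "J \<subseteq> UNIV" and F: "\<And>j. j \<in> J \<Longrightarrow> F j \<in> sets step_law"
    let ?X = "prod_emb UNIV (\<lambda>_. step_law) J (\<Pi>\<^sub>E j\<in>J. F j)"
    have X: "?X \<in> sets ?P" using J F by (intro sets_PiM_I) auto
    define A where "A i = {e. \<forall>n\<in>Pair i -` J. e n \<in> F (i, n)}" for i
    have fin: "finite (Pair i -` J)" for i
      using J by (intro finite_vimageI) (auto simp: inj_on_def)
    have Ai: "A i \<in> sets site_law \<and> emeasure site_law (A i) = (\<Prod>n\<in>Pair i -` J. emeasure step_law (F (i, n)))" for i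
    proof -
      have "A i = prod_emb UNIV (\<lambda>_. step_law) (Pair i -` J) (\<Pi>\<^sub>E n\<in>Pair i -` J. F (i, n))"
        by (auto simp: A_def prod_emb_def PiE_iff extensional_def)
      moreover have "prod_emb UNIV (\<lambda>_. step_law) (Pair i -` J) (\<Pi>\<^sub>E n\<in>Pair i -` J. F (i, n)) \<in> sets site_law"
        unfolding site_law_def using fin F by (intro sets_PiM_I) auto
      moreover have "emeasure site_law (prod_emb UNIV (\<lambda>_. step_law) (Pair i -` J) (\<Pi>\<^sub>E n\<in>Pair i -` J. F (i, n)))
          = (\<Prod>n\<in>Pair i -` J. emeasure step_law (F (i, n)))"
        using fin F by (intro site.emeasure_PiM_emb) auto
      ultimately show ?thesis by simp
    qed
    have "emeasure (distr noise_law ?P ?u) ?X = emeasure noise_law (?u -` ?X \<inter> space noise_law)"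
      by (rule emeasure_distr[OF u X])
    also have "?u -` ?X \<inter> space noise_law = {\<omega> \<in> space noise_law. \<forall>i\<in>fst ` J. \<omega> i \<in> A i}"
      by (fastforce simp: prod_emb_def PiE_iff A_def extensional_def)
    also have "emeasure noise_law \<dots> = (\<Prod>i\<in>fst ` J. emeasure site_law (A i))"
      by (rule noise.emeasure_PiM_Collect) (use J Ai in auto)
    also have "\<dots> = (\<Prod>i\<in>fst ` J. \<Prod>n\<in>Pair i -` J. emeasure step_law (F (i, n)))"
      using Ai by simp
    also have "\<dots> = (\<Prod>j\<in>Sigma (fst ` J) (\<lambda>i. Pair i -` J). emeasure step_law (F j))"
      using J fin by (subst prod.Sigma) (auto simp: split_beta')
    also have "Sigma (fst ` J) (\<lambda>i. Pair i -` J) = J" by force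
    finally show "emeasure (distr noise_law ?P ?u) ?X = (\<Prod>j\<in>J. emeasure step_law (F j))" .
  qed simp
qed

lemma measurable_uncurry_noise: "(\<lambda>\<omega> (i, n). \<omega> i n) \<in> measurable noise_law (PiM UNIV (\<lambda>_. step_law))"
proof (rule measurable_PiM_single')
  fix k :: "int \<times> nat"
  show "(\<lambda>\<omega>. case k of (i, n) \<Rightarrow> \<omega> i n) \<in> measurable noise_law step_law"
    using measurable_site_component[OF measurable_noise_component[OF measurable_ident_sets[OF refl]], of "fst k" "snd k"]
    by (simp add: split_beta' measurable_cong_sets[OF refl sets_step_law])
qed (auto simp: space_PiM)

abbreviation mark_noise_law :: "((int \<times> nat \<Rightarrow> real) \<times> (int \<times> nat \<Rightarrow> real)) measure" where
  "mark_noise_law \<equiv> PiM UNIV (\<lambda>_. wait_law) \<Otimes>\<^sub>M PiM UNIV (\<lambda>_. mark_law)"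

lemma zip_noise:
  "distr mark_noise_law (PiM UNIV (\<lambda>_. step_law)) (\<lambda>(e, u) k. (e k, u k)) = PiM UNIV (\<lambda>_. step_law)"
  unfolding step_law_def
  using distr_PiM_zip[OF wait.prob_space_axioms unif.prob_space_axioms measurable_ident_sets[OF refl]]
  by (simp add: distr_id2 split_beta')

lemma measurable_zip_noise:
  "(\<lambda>(e, u) k. (e k, u k)) \<in> measurable mark_noise_law (PiM UNIV (\<lambda>_. step_law))"
  unfolding step_law_def split_beta'
  by (intro measurable_abs_UNIV measurable_Pair measurable_compose[OF measurable_fst measurable_component_singleton]
      measurable_compose[OF measurable_snd measurable_component_singleton]) auto

lemma measurable_unzip_noise:
  "(\<lambda>z. (\<lambda>k. fst (z k), \<lambda>k. snd (z k))) \<in> measurable (PiM UNIV (\<lambda>_. step_law)) mark_noise_law"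
  by (intro measurable_Pair measurable_abs_UNIV measurable_compose[OF _ measurable_fst_step]
      measurable_compose[OF _ measurable_snd_step] measurable_component_singleton UNIV_I)

lemma measurable_curry_noise:
  "(\<lambda>z i n. z (i, n)) \<in> measurable (PiM UNIV (\<lambda>_. step_law)) noise_law"
  unfolding noise_law_def site_law_def
  by (intro measurable_abs_UNIV measurable_component_singleton) auto

lemma distr_noise_marks:
  "distr noise_law mark_noise_law (\<lambda>\<omega>. (\<lambda>(i, n). fst (\<omega> i n), \<lambda>(i, n). snd (\<omega> i n))) = mark_noise_law"
  "distr mark_noise_law noise_law (\<lambda>(e, u) i n. (e (i, n), u (i, n))) = noise_law"
proof -
  let ?P = "PiM (UNIV :: (int \<times> nat) set) (\<lambda>_. step_law)"
  have "distr ?P mark_noise_law (\<lambda>z. (\<lambda>k. fst (z k), \<lambda>k. snd (z k)))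
      = distr (distr mark_noise_law ?P (\<lambda>(e, u) k. (e k, u k))) mark_noise_law (\<lambda>z. (\<lambda>k. fst (z k), \<lambda>k. snd (z k)))"
    by (simp only: zip_noise)
  also have "\<dots> = mark_noise_law"
    by (subst distr_distr[OF measurable_unzip_noise measurable_zip_noise]) (simp add: comp_def split_beta' distr_id2)
  finally have un: "distr ?P mark_noise_law (\<lambda>z. (\<lambda>k. fst (z k), \<lambda>k. snd (z k))) = mark_noise_law" .
  have "mark_noise_law = distr (distr noise_law ?P (\<lambda>\<omega> (i, n). \<omega> i n)) mark_noise_law (\<lambda>z. (\<lambda>k. fst (z k), \<lambda>k. snd (z k)))"
    by (simp only: distr_uncurry_noise un)
  also have "\<dots> = distr noise_law mark_noise_law (\<lambda>\<omega>. (\<lambda>(i, n). fst (\<omega> i n), \<lambda>(i, n). snd (\<omega> i n)))"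
    by (subst distr_distr[OF measurable_unzip_noise measurable_uncurry_noise]) (simp add: comp_def split_beta')
  finally show "distr noise_law mark_noise_law (\<lambda>\<omega>. (\<lambda>(i, n). fst (\<omega> i n), \<lambda>(i, n). snd (\<omega> i n))) = mark_noise_law"
    by (rule sym)
  have "distr ?P noise_law (\<lambda>z i n. z (i, n)) = distr (distr noise_law ?P (\<lambda>\<omega> (i, n). \<omega> i n)) noise_law (\<lambda>z i n. z (i, n))"
    by (simp only: distr_uncurry_noise)
  also have "\<dots> = noise_law"
    by (subst distr_distr[OF measurable_curry_noise measurable_uncurry_noise]) (simp add: comp_def distr_id2)
  finally have cu: "distr ?P noise_law (\<lambda>z i n. z (i, n)) = noise_law" .
  have "noise_law = distr (distr mark_noise_law ?P (\<lambda>(e, u) k. (e k, u k))) noise_law (\<lambda>z i n. z (i, n))"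
    by (simp only: zip_noise cu)
  also have "\<dots> = distr mark_noise_law noise_law (\<lambda>(e, u) i n. (e (i, n), u (i, n)))"
    by (subst distr_distr[OF measurable_curry_noise measurable_zip_noise]) (simp add: comp_def split_beta')
  finally show "distr mark_noise_law noise_law (\<lambda>(e, u) i n. (e (i, n), u (i, n))) = noise_law"
    by (rule sym)
qed

text \<open>\<open>P\<close> is arbitrary, without measurability, as the convergence in
  \<open>has_mean_profit\<close> demands. An image measure then hands an almost sure statement back
  to its source, but not forward, so the two mutually inverse maps \<open>f\<close> and
  \<open>g\<close> are used, one for each direction.\<close>

lemma AE_sample_space_iff:
  assumes "prob_space \<nu>"
  shows "(AE s in sample_space \<nu>. P s) \<longleftrightarrow> (AE z in \<nu> \<Otimes>\<^sub>M noise_law. P (smp (fst z) (snd z)))"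
proof -
  interpret \<nu>: prob_space \<nu> by fact
  define f where "f = (\<lambda>\<omega> :: noise. (\<lambda>(i, n). fst (\<omega> i n), \<lambda>(i, n). snd (\<omega> i n)))"
  define g :: "_ \<Rightarrow> noise" where "g = (\<lambda>(e, u) i n. (e (i, n), u (i, n)))"
  have fm: "f \<in> measurable noise_law mark_noise_law"
    using measurable_comp[OF measurable_uncurry_noise measurable_unzip_noise] by (simp add: f_def comp_def split_beta')
  have gm: "g \<in> measurable mark_noise_law noise_law"
    using measurable_comp[OF measurable_zip_noise measurable_curry_noise] by (simp add: g_def comp_def split_beta')
  have S: "sample_space \<nu> = \<nu> \<Otimes>\<^sub>M mark_noise_law" by (simp add: sample_space_def)
  have Q: "sigma_finite_measure mark_noise_law"
    by (rule prob_space_imp_sigma_finite[OF prob_space_pair[OF prob_space_PiM[OF wait.prob_space_axioms]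
      prob_space_PiM[OF unif.prob_space_axioms]]])
  have R: "sigma_finite_measure noise_law"
    by (rule prob_space_imp_sigma_finite) (rule noise.prob_space_axioms)
  have "\<nu> \<Otimes>\<^sub>M mark_noise_law = distr \<nu> \<nu> (\<lambda>x. x) \<Otimes>\<^sub>M distr noise_law mark_noise_law f"
    by (simp only: f_def distr_noise_marks distr_id2)
  also have "\<dots> = distr (\<nu> \<Otimes>\<^sub>M noise_law) (\<nu> \<Otimes>\<^sub>M mark_noise_law) (\<lambda>(x, \<omega>). (x, f \<omega>))"
  proof (rule pair_measure_distr[OF measurable_ident_sets[OF refl] fm])
    show "sigma_finite_measure (distr noise_law mark_noise_law f)"
      unfolding f_def distr_noise_marks by (rule Q)
  qed
  finally have 1: "sample_space \<nu> = distr (\<nu> \<Otimes>\<^sub>M noise_law) (\<nu> \<Otimes>\<^sub>M mark_noise_law) (\<lambda>(x, \<omega>). (x, f \<omega>))"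
    unfolding S .
  have "\<nu> \<Otimes>\<^sub>M noise_law = distr \<nu> \<nu> (\<lambda>x. x) \<Otimes>\<^sub>M distr mark_noise_law noise_law g"
    by (simp only: g_def distr_noise_marks distr_id2)
  also have "\<dots> = distr (\<nu> \<Otimes>\<^sub>M mark_noise_law) (\<nu> \<Otimes>\<^sub>M noise_law) (\<lambda>(x, \<omega>). (x, g \<omega>))"
  proof (rule pair_measure_distr[OF measurable_ident_sets[OF refl] gm])
    show "sigma_finite_measure (distr mark_noise_law noise_law g)"
      unfolding g_def distr_noise_marks by (rule R)
  qed
  finally have 2: "\<nu> \<Otimes>\<^sub>M noise_law = distr (\<nu> \<Otimes>\<^sub>M mark_noise_law) (\<nu> \<Otimes>\<^sub>M noise_law) (\<lambda>(x, \<omega>). (x, g \<omega>))" .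
  have fg: "smp x (g y) = (x, y)" for x y
    by (simp add: smp_def g_def split_beta')
  have m1: "(\<lambda>(x, \<omega>). (x, f \<omega>)) \<in> measurable (\<nu> \<Otimes>\<^sub>M noise_law) (\<nu> \<Otimes>\<^sub>M mark_noise_law)"
    unfolding split_beta' by (intro measurable_Pair measurable_fst measurable_compose[OF measurable_snd fm])
  have m2: "(\<lambda>(x, \<omega>). (x, g \<omega>)) \<in> measurable (\<nu> \<Otimes>\<^sub>M mark_noise_law) (\<nu> \<Otimes>\<^sub>M noise_law)"
    unfolding split_beta' by (intro measurable_Pair measurable_fst measurable_compose[OF measurable_snd gm])
  show ?thesis
  proof
    assume "AE s in sample_space \<nu>. P s"
    then have "AE z in \<nu> \<Otimes>\<^sub>M noise_law. P ((\<lambda>(x, \<omega>). (x, f \<omega>)) z)"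
      unfolding 1 by (rule AE_distrD[OF m1])
    moreover have "(\<lambda>(x, \<omega>). (x, f \<omega>)) z = smp (fst z) (snd z)" for z
      by (simp add: smp_def f_def split_beta')
    ultimately show "AE z in \<nu> \<Otimes>\<^sub>M noise_law. P (smp (fst z) (snd z))" by (simp only:)
  next
    assume "AE z in \<nu> \<Otimes>\<^sub>M noise_law. P (smp (fst z) (snd z))"
    then have "AE z in distr (\<nu> \<Otimes>\<^sub>M mark_noise_law) (\<nu> \<Otimes>\<^sub>M noise_law) (\<lambda>(x, \<omega>). (x, g \<omega>)). P (smp (fst z) (snd z))"
      unfolding 2[symmetric] .
    then have "AE z in \<nu> \<Otimes>\<^sub>M mark_noise_law. P (smp (fst ((\<lambda>(x, \<omega>). (x, g \<omega>)) z)) (snd ((\<lambda>(x, \<omega>). (x, g \<omega>)) z)))"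
      by (rule AE_distrD[OF m2])
    moreover have "smp (fst ((\<lambda>(x, \<omega>). (x, g \<omega>)) z)) (snd ((\<lambda>(x, \<omega>). (x, g \<omega>)) z)) = z" for z
      by (simp add: split_beta' fg)
    ultimately show "AE s in sample_space \<nu>. P s" unfolding S by (simp only:)
  qed
qed

subsection \<open>Reduction to a fixed initial configuration\<close>

lemma AE_pair_fstI:
  assumes "prob_space N" "AE x in M. P x"
  shows "AE z in M \<Otimes>\<^sub>M N. P (fst z)"
proof (rule AE_distrD[OF measurable_fst])
  show "AE z in distr (M \<Otimes>\<^sub>M N) M fst. P z"
    unfolding prob_space.distr_pair_fst[OF assms(1)] by (rule assms(2))
qed

lemma AE_pair_sndI:
  assumes "prob_space M" "prob_space N" "AE y in N. P y"
  shows "AE z in M \<Otimes>\<^sub>M N. P (snd z)"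
proof -
  obtain A where A: "{y \<in> space N. \<not> P y} \<subseteq> A" "A \<in> sets N" "emeasure N A = 0"
    by (rule AE_E[OF assms(3)])
  show ?thesis
  proof (rule AE_I)
    show "{z \<in> space (M \<Otimes>\<^sub>M N). \<not> P (snd z)} \<subseteq> space M \<times> A"
      using A by (auto simp: space_pair_measure)
    show "space M \<times> A \<in> sets (M \<Otimes>\<^sub>M N)" by (rule pair_measureI[OF sets.top A(2)])
    show "emeasure (M \<Otimes>\<^sub>M N) (space M \<times> A) = 0"
      using sigma_finite_measure.emeasure_pair_measure_Times[OF prob_space_imp_sigma_finite[OF assms(2)] sets.top A(2)] A(3)
      by simp
  qed
qed

text \<open>Coordinates on S: \<open>w\<close> is the left element of the pair of equal symbols, and
  \<open>b\<close> the phase of the alternating pattern to its left. Under game B only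
  \<open>w\<close> will move.\<close>

definition conf :: "bool \<Rightarrow> int \<Rightarrow> config" where
  "conf b w j = (if j \<le> w then even j = b else even j \<noteq> b)"

lemma almost_alternating_conf:
  assumes "x \<in> almost_alternating"
  obtains b w where "x = conf b w"
proof -
  have "\<exists>!i. x i = x (i + 1)" using assms by (simp only: almost_alternating_def mem_Collect_eq)
  then obtain w where w: "x w = x (w + 1)" and uniq: "\<forall>i. x i = x (i + 1) \<longrightarrow> i = w"
    by (elim ex1E) blast
  have step: "x (i + 1) \<longleftrightarrow> \<not> x i" if "i \<noteq> w" for i using uniq that by blast
  have right: "x (w + 1 + int k) = (x w = even k)" for k
  proof (induction k)
    case (Suc k)
    have "x (w + 1 + int k + 1) \<longleftrightarrow> \<not> x (w + 1 + int k)" by (rule step) simp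
    moreover have "w + 1 + int (Suc k) = w + 1 + int k + 1" by simp
    ultimately have "x (w + 1 + int (Suc k)) \<longleftrightarrow> \<not> x (w + 1 + int k)" by (simp only:)
    then show ?case unfolding Suc even_Suc by blast
  qed (simp add: w)
  have left: "x (w - int k) = (x w = even k)" for k
  proof (induction k)
    case (Suc k)
    have "x (w - int (Suc k) + 1) \<longleftrightarrow> \<not> x (w - int (Suc k))" by (rule step) simp
    moreover have "w - int (Suc k) + 1 = w - int k" by simp
    ultimately have "x (w - int k) \<longleftrightarrow> \<not> x (w - int (Suc k))" by (simp only:)
    then show ?case unfolding Suc even_Suc by blast
  qed simp
  have "x j = conf (even w = x w) w j" for j
  proof (cases "j \<le> w")
    case True
    define k where "k = nat (w - j)"
    have k: "j = w - int k" using True by (simp add: k_def)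
    have "even j \<longleftrightarrow> (even w \<longleftrightarrow> even k)"
      unfolding k by (cases "even w"; cases "even k"; simp)
    moreover have "x j = (x w = even k)" using left[of k] k by simp
    ultimately show ?thesis using True
      by (cases "even w"; cases "even k"; cases "x w"; simp add: conf_def)
  next
    case False
    define k where "k = nat (j - w - 1)"
    have k: "j = w + 1 + int k" using False by (simp add: k_def)
    have "even j \<longleftrightarrow> \<not> (even w \<longleftrightarrow> even k)"
      unfolding k by (cases "even w"; cases "even k"; simp)
    moreover have "x j = (x w = even k)" using right[of k] k by simp
    ultimately show ?thesis using False
      by (cases "even w"; cases "even k"; cases "x w"; simp add: conf_def)
  qed
  then have "x = conf (even w = x w) w" by (rule ext)
  then show thesis by (rule that)
qed

lemma countable_almost_alternating: "countable almost_alternating"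
proof (rule countable_subset)
  show "almost_alternating \<subseteq> (\<lambda>(b, w). conf b w) ` UNIV"
  proof
    fix x assume "x \<in> almost_alternating"
    then obtain b w where "x = conf b w" by (rule almost_alternating_conf)
    then show "x \<in> (\<lambda>(b, w). conf b w) ` UNIV" by (intro image_eqI[of _ _ "(b, w)"]) auto
  qed
qed auto

text \<open>S is countable, so what is almost sure for every fixed start in S is almost sure for all
  of them at once, whatever the initial law.\<close>

lemma AE_sample_spaceI:
  assumes \<nu>: "concentrated_on_S \<nu>" and P: "\<And>b w. AE \<omega> in noise_law. P (smp (conf b w) \<omega>)"
  shows "AE s in sample_space \<nu>. P s"
proof -
  interpret \<nu>: prob_space \<nu> using \<nu> by (simp add: concentrated_on_S_def)
  have "AE x in \<nu>. x \<in> almost_alternating"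
    using \<nu> by (intro \<nu>.AE_prob_1) (simp add: concentrated_on_S_def)
  then have 1: "AE z in \<nu> \<Otimes>\<^sub>M noise_law. fst z \<in> almost_alternating"
    by (rule AE_pair_fstI[OF noise.prob_space_axioms])
  have P': "AE \<omega> in noise_law. P (smp x \<omega>)" if "x \<in> almost_alternating" for x
    using almost_alternating_conf[OF that] P by metis
  have 2: "AE z in \<nu> \<Otimes>\<^sub>M noise_law. \<forall>x\<in>almost_alternating. P (smp x (snd z))"
    unfolding AE_ball_countable[OF countable_almost_alternating]
    by (intro ballI AE_pair_sndI[OF \<nu>.prob_space_axioms noise.prob_space_axioms] P')
  show ?thesis
    unfolding AE_sample_space_iff[OF \<nu>.prob_space_axioms] using 1 2 by eventually_elim auto
qed

text \<open>By Fubini almost every start inherits the almost sure event, and a single start in S is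
  all that a refutation needs.\<close>

lemma AE_sample_spaceD:
  assumes \<nu>: "concentrated_on_S \<nu>" and P: "AE s in sample_space \<nu>. P s"
  obtains b w where "AE \<omega> in noise_law. P (smp (conf b w) \<omega>)"
proof -
  interpret \<nu>: prob_space \<nu> using \<nu> by (simp add: concentrated_on_S_def)
  have R: "sigma_finite_measure noise_law"
    by (rule prob_space_imp_sigma_finite) (rule noise.prob_space_axioms)
  have psf: "pair_sigma_finite \<nu> noise_law"
    by (intro pair_sigma_finite.intro R \<nu>.sigma_finite_measure_axioms)
  have "AE x in \<nu>. x \<in> almost_alternating"
    using \<nu> by (intro \<nu>.AE_prob_1) (simp add: concentrated_on_S_def)
  moreover have "AE x in \<nu>. AE \<omega> in noise_law. P (smp x \<omega>)"
    using pair_sigma_finite.AE_pair[OF psf P[unfolded AE_sample_space_iff[OF \<nu>.prob_space_axioms]]]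
    by (simp only: fst_conv snd_conv)
  ultimately have "AE x in \<nu>. x \<in> almost_alternating \<and> (AE \<omega> in noise_law. P (smp x \<omega>))"
    by eventually_elim blast
  from eventually_happens'[OF \<nu>.ae_filter_bot this]
  obtain x where x: "x \<in> almost_alternating" "AE \<omega> in noise_law. P (smp x \<omega>)" by blast
  obtain b w where "x = conf b w" by (rule almost_alternating_conf[OF x(1)])
  with x(2) show thesis by (intro that[of b w]) (simp only:)
qed

subsection \<open>The Markov property\<close>

definition good3 :: "real \<Rightarrow> noise \<Rightarrow> noise \<Rightarrow> bool" where
  "good3 s \<omega> \<omega>' \<longleftrightarrow> good \<omega> \<and> good \<omega>' \<and> good (glue s \<omega> \<omega>')"

lemma measurable_glue_pair: "(\<lambda>(\<omega>, \<omega>'). glue s \<omega> \<omega>') \<in> measurable (noise_law \<Otimes>\<^sub>M noise_law) noise_law"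
  unfolding split_beta' by (rule measurable_glue) (rule measurable_fst, rule measurable_snd)

lemma AE_good3:
  assumes "s \<ge> 0"
  shows "AE z in noise_law \<Otimes>\<^sub>M noise_law. good3 s (fst z) (snd z)"
proof -
  have 1: "AE z in noise_law \<Otimes>\<^sub>M noise_law. good (fst z)"
    by (rule AE_pair_fstI[OF noise.prob_space_axioms AE_good])
  have 2: "AE z in noise_law \<Otimes>\<^sub>M noise_law. good (snd z)"
    by (rule AE_pair_sndI[OF noise.prob_space_axioms noise.prob_space_axioms AE_good])
  have 3: "AE z in noise_law \<Otimes>\<^sub>M noise_law. good ((\<lambda>(\<omega>, \<omega>'). glue s \<omega> \<omega>') z)"
    by (rule AE_distrD[OF measurable_glue_pair]) (unfold distr_glue[OF assms], rule AE_good)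
  from 1 2 3 show ?thesis by eventually_elim (auto simp: good3_def)
qed

lemma integrable_noise_bounded:
  "f \<in> borel_measurable noise_law \<Longrightarrow> (\<And>\<omega>. \<bar>f \<omega>\<bar> \<le> B) \<Longrightarrow> integrable noise_law (f :: noise \<Rightarrow> real)"
  by (rule noise.integrable_const_bound[where B=B]) auto

lemma noise_integral_le:
  assumes "f \<in> borel_measurable noise_law" "\<And>\<omega>. \<bar>f \<omega>\<bar> \<le> B"
    and "g \<in> borel_measurable noise_law" "\<And>\<omega>. \<bar>g \<omega>\<bar> \<le> C" "\<And>\<omega>. good \<omega> \<Longrightarrow> f \<omega> \<le> g \<omega>"
  shows "(\<integral>\<omega>. f \<omega> \<partial>noise_law) \<le> (\<integral>\<omega>. (g \<omega> :: real) \<partial>noise_law)"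
  using assms AE_good
  by (intro integral_mono_AE integrable_noise_bounded) (auto elim: eventually_mono)

lemma noise_integral_abs_le:
  assumes "f \<in> borel_measurable noise_law" "\<And>\<omega>. \<bar>f \<omega>\<bar> \<le> (B :: real)"
  shows "\<bar>\<integral>\<omega>. f \<omega> \<partial>noise_law\<bar> \<le> B"
proof -
  have "\<bar>\<integral>\<omega>. f \<omega> \<partial>noise_law\<bar> \<le> (\<integral>\<omega>. \<bar>f \<omega>\<bar> \<partial>noise_law)" by (rule integral_abs_bound)
  also have "\<dots> \<le> (\<integral>\<omega>. B \<partial>noise_law)"
    using assms order_trans[OF abs_ge_zero assms(2)]
    by (intro integral_mono integrable_noise_bounded[where B=B] integrable_abs) auto
  finally show ?thesis by simp
qed

text \<open>The Markov property in the form used below: averaging over one noise equals averaging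
  over a past and then over an independent future. \<open>g\<close> expresses \<open>f\<close> on
  the glued noise where past, future and glued noise are all good.\<close>

lemma integral_glue:
  fixes f :: "noise \<Rightarrow> real" and g :: "noise \<Rightarrow> noise \<Rightarrow> real"
  assumes s: "s \<ge> 0" and f: "f \<in> borel_measurable noise_law" "\<And>\<omega>. \<bar>f \<omega>\<bar> \<le> B"
    and g: "(\<lambda>z. g (fst z) (snd z)) \<in> borel_measurable (noise_law \<Otimes>\<^sub>M noise_law)"
    and fg: "\<And>\<omega> \<omega>'. good3 s \<omega> \<omega>' \<Longrightarrow> f (glue s \<omega> \<omega>') = g \<omega> \<omega>'"
  shows "(\<integral>\<omega>. f \<omega> \<partial>noise_law) = (\<integral>\<omega>. \<integral>\<omega>'. g \<omega> \<omega>' \<partial>noise_law \<partial>noise_law)"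
proof -
  have R: "sigma_finite_measure noise_law"
    by (rule prob_space_imp_sigma_finite) (rule noise.prob_space_axioms)
  have psf: "pair_sigma_finite noise_law noise_law"
    by (intro pair_sigma_finite.intro R)
  have PP: "prob_space (noise_law \<Otimes>\<^sub>M noise_law)"
    by (intro prob_space_pair noise.prob_space_axioms)
  have ae: "AE z in noise_law \<Otimes>\<^sub>M noise_law. f (glue s (fst z) (snd z)) = g (fst z) (snd z)"
    using AE_good3[OF s] by eventually_elim (rule fg)
  have fm: "(\<lambda>z. f (glue s (fst z) (snd z))) \<in> borel_measurable (noise_law \<Otimes>\<^sub>M noise_law)"
    using measurable_compose[OF measurable_glue_pair f(1)] by (simp add: split_beta')
  have "(\<integral>\<omega>. f \<omega> \<partial>noise_law) = (\<integral>\<omega>. f \<omega> \<partial>distr (noise_law \<Otimes>\<^sub>M noise_law) noise_law (\<lambda>(\<omega>, \<omega>'). glue s \<omega> \<omega>'))"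
    unfolding distr_glue[OF s] ..
  also have "\<dots> = (\<integral>z. f ((\<lambda>(\<omega>, \<omega>'). glue s \<omega> \<omega>') z) \<partial>(noise_law \<Otimes>\<^sub>M noise_law))"
    by (rule integral_distr[OF measurable_glue_pair f(1)])
  also have "\<dots> = (\<integral>z. g (fst z) (snd z) \<partial>(noise_law \<Otimes>\<^sub>M noise_law))"
    by (rule integral_cong_AE) (use ae fm g in \<open>simp_all add: split_beta'\<close>)
  also have "\<dots> = (\<integral>\<omega>. \<integral>\<omega>'. g \<omega> \<omega>' \<partial>noise_law \<partial>noise_law)"
  proof -
    have "integrable (noise_law \<Otimes>\<^sub>M noise_law) (\<lambda>z. g (fst z) (snd z))"
    proof (rule finite_measure.integrable_const_bound[where B=B])
      show "finite_measure (noise_law \<Otimes>\<^sub>M noise_law)" using PP by (simp add: prob_space_def)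
      show "AE z in noise_law \<Otimes>\<^sub>M noise_law. norm (g (fst z) (snd z)) \<le> B"
        using ae by eventually_elim (metis f(2) real_norm_def)
    qed (rule g)
    from pair_sigma_finite.integral_fst'[OF psf this] show ?thesis by simp
  qed
  finally show ?thesis .
qed

lemma X_glue_le3: "good3 s \<omega> \<omega>' \<Longrightarrow> 0 \<le> s \<Longrightarrow> t \<le> s \<Longrightarrow> X p x (glue s \<omega> \<omega>') t = X p x \<omega> t"
  and X_glue_ge3: "good3 s \<omega> \<omega>' \<Longrightarrow> 0 \<le> s \<Longrightarrow> 0 \<le> t \<Longrightarrow> X p x (glue s \<omega> \<omega>') (s + t) = X p (X p x \<omega> s) \<omega>' t"
  and cnt_glue3: "good3 s \<omega> \<omega>' \<Longrightarrow> 0 \<le> s \<Longrightarrow>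
    cnt (glue s \<omega> \<omega>' i) t = (if t \<le> s then cnt (\<omega> i) t else cnt (\<omega> i) s + cnt (\<omega>' i) (t - s))"
  by (simp_all add: good3_def X_glue_le X_glue_ge cnt_glue)

text \<open>The Markov semigroup of the spin system, acting on functions of the state;
  \<open>avg_add\<close> is its semigroup law.\<close>

definition avg :: "game \<Rightarrow> real \<Rightarrow> (config \<Rightarrow> real) \<Rightarrow> config \<Rightarrow> real" where
  "avg p t F x = (\<integral>\<omega>. F (X p x \<omega> t) \<partial>noise_law)"

lemma measurable_X_pair: "(\<lambda>z. X p (fst z) (snd z) t) \<in> measurable (config_space \<Otimes>\<^sub>M noise_law) config_space"
  by (rule measurable_X[OF measurable_fst measurable_snd])

lemma measurable_avg:
  assumes "F \<in> borel_measurable config_space"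
  shows "avg p t F \<in> borel_measurable config_space"
  unfolding avg_def[abs_def]
  by (rule noise.borel_measurable_lebesgue_integral)
     (use measurable_compose[OF measurable_X_pair assms] in \<open>simp add: split_beta'\<close>)

lemma measurable_FX:
  "F \<in> borel_measurable config_space \<Longrightarrow> (\<lambda>\<omega>. F (X p x \<omega> t)) \<in> borel_measurable noise_law"
  by (rule measurable_compose[OF measurable_X1])

lemma avg_abs_le:
  "F \<in> borel_measurable config_space \<Longrightarrow> (\<And>x. \<bar>F x\<bar> \<le> B) \<Longrightarrow> \<bar>avg p t F x\<bar> \<le> B"
  unfolding avg_def by (rule noise_integral_abs_le) (auto intro: measurable_FX)

lemma avg_add:
  assumes F: "F \<in> borel_measurable config_space" "\<And>x. \<bar>F x\<bar> \<le> B" and st: "s \<ge> 0" "t \<ge> 0"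
  shows "avg p (s + t) F x = avg p s (avg p t F) x"
  unfolding avg_def
proof (rule integral_glue[OF st(1)])
  show "(\<lambda>z. F (X p (X p x (fst z) s) (snd z) t)) \<in> borel_measurable (noise_law \<Otimes>\<^sub>M noise_law)"
    by (intro measurable_compose[OF _ F(1)] measurable_X measurable_fst measurable_snd measurable_const) simp
qed (use F st in \<open>auto intro: measurable_FX simp: X_glue_ge3\<close>)

text \<open>\<open>Y k\<close> is an observable of block \<open>k\<close>, and its conditional mean
  given the state at time \<open>k h\<close> is subtracted. The differences are bounded martingale
  increments, hence orthogonal. The hypotheses \<open>ge\<close> and \<open>le\<close> say, through
  gluing, that \<open>Y k\<close> is a function of that state and of fresh noise, and that the
  earlier \<open>Y j\<close> do not see the fresh noise.\<close>

lemma block_LLN: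
  fixes \<Gamma> :: "config \<Rightarrow> noise \<Rightarrow> real" and Y :: "nat \<Rightarrow> noise \<Rightarrow> real"
  assumes h: "h \<ge> 0" and G: "(\<lambda>z. \<Gamma> (fst z) (snd z)) \<in> borel_measurable (config_space \<Otimes>\<^sub>M noise_law)"
    and GB: "\<And>x \<omega>. \<bar>\<Gamma> x \<omega>\<bar> \<le> B"
    and Y: "\<And>k. Y k \<in> borel_measurable noise_law" and YB: "\<And>k \<omega>. \<bar>Y k \<omega>\<bar> \<le> B"
    and ge: "\<And>k \<omega> \<omega>'. good3 (real k * h) \<omega> \<omega>' \<Longrightarrow> Y k (glue (real k * h) \<omega> \<omega>') = \<Gamma> (X p x \<omega> (real k * h)) \<omega>'"
    and le: "\<And>j k \<omega> \<omega>'. j < k \<Longrightarrow> good3 (real k * h) \<omega> \<omega>' \<Longrightarrow> Y j (glue (real k * h) \<omega> \<omega>') = Y j \<omega>"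
  shows "AE \<omega> in noise_law. (\<lambda>n. (\<Sum>k<n. Y k \<omega> - (\<integral>\<omega>'. \<Gamma> (X p x \<omega> (real k * h)) \<omega>' \<partial>noise_law)) / real n) \<longlonglongrightarrow> 0"
proof -
  define \<gamma> where "\<gamma> y = (\<integral>\<omega>'. \<Gamma> y \<omega>' \<partial>noise_law)" for y
  define D where "D k \<omega> = Y k \<omega> - \<gamma> (X p x \<omega> (real k * h))" for k \<omega>
  have \<gamma>m: "\<gamma> \<in> borel_measurable config_space"
    unfolding \<gamma>_def[abs_def] by (rule noise.borel_measurable_lebesgue_integral) (use G in \<open>simp add: split_beta'\<close>)
  have Gm: "\<Gamma> y \<in> borel_measurable noise_law" for y
    using measurable_compose[OF measurable_Pair[OF measurable_const measurable_ident_sets[OF refl]] G, of y] by simp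
  have \<gamma>B: "\<bar>\<gamma> y\<bar> \<le> B" for y unfolding \<gamma>_def by (rule noise_integral_abs_le[OF Gm GB])
  have B: "B \<ge> 0" using \<gamma>B[of undefined] by linarith
  have Dm: "D k \<in> borel_measurable noise_law" for k
    unfolding D_def[abs_def] by (intro borel_measurable_diff Y measurable_FX \<gamma>m)
  have DB: "\<bar>D k \<omega>\<bar> \<le> 2 * B" for k \<omega>
    using YB[of k \<omega>] \<gamma>B[of "X p x \<omega> (real k * h)"] by (simp add: D_def)
  have D2B: "\<bar>D j \<omega> * D k \<omega>\<bar> \<le> (2 * B) * (2 * B)" for j k \<omega>
    unfolding abs_mult by (intro mult_mono DB) (use B in auto)
  have orth: "(\<integral>\<omega>. D j \<omega> * D k \<omega> \<partial>noise_law) = 0" if jk: "j < k" for j k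
  proof -
    let ?s = "real k * h"
    have s: "?s \<ge> 0" using h by simp
    have inner: "(\<integral>\<omega>'. D j \<omega> * (\<Gamma> (X p x \<omega> ?s) \<omega>' - \<gamma> (X p x \<omega> ?s)) \<partial>noise_law) = 0" for \<omega>
      using integrable_noise_bounded[OF Gm GB, of "X p x \<omega> ?s"] by (simp add: \<gamma>_def)
    have "(\<integral>\<omega>. D j \<omega> * D k \<omega> \<partial>noise_law)
        = (\<integral>\<omega>. \<integral>\<omega>'. D j \<omega> * (\<Gamma> (X p x \<omega> ?s) \<omega>' - \<gamma> (X p x \<omega> ?s)) \<partial>noise_law \<partial>noise_law)"
    proof (rule integral_glue[OF s _ D2B])
      show "(\<lambda>\<omega>. D j \<omega> * D k \<omega>) \<in> borel_measurable noise_law" by (intro borel_measurable_times Dm)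
      have "(\<lambda>z. \<Gamma> (X p x (fst z) ?s) (snd z)) \<in> borel_measurable (noise_law \<Otimes>\<^sub>M noise_law)"
        using measurable_compose[OF measurable_Pair[OF measurable_compose[OF measurable_fst measurable_X1] measurable_snd] G]
        by simp
      then show "(\<lambda>z. D j (fst z) * (\<Gamma> (X p x (fst z) ?s) (snd z) - \<gamma> (X p x (fst z) ?s))) \<in> borel_measurable (noise_law \<Otimes>\<^sub>M noise_law)"
        by (intro borel_measurable_times borel_measurable_diff measurable_compose[OF measurable_fst Dm]
            measurable_compose[OF measurable_fst measurable_FX[OF \<gamma>m]])
      fix \<omega> \<omega>' assume g3: "good3 ?s \<omega> \<omega>'"
      have "real j * h \<le> ?s" using jk h by (intro mult_right_mono) auto
      then have "D j (glue ?s \<omega> \<omega>') = D j \<omega>"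
        using le[OF jk g3] X_glue_le3[OF g3 s] by (simp add: D_def)
      moreover have "D k (glue ?s \<omega> \<omega>') = \<Gamma> (X p x \<omega> ?s) \<omega>' - \<gamma> (X p x \<omega> ?s)"
        using ge[OF g3] X_glue_le3[OF g3 s order_refl] by (simp add: D_def)
      ultimately show "D j (glue ?s \<omega> \<omega>') * D k (glue ?s \<omega> \<omega>') = D j \<omega> * (\<Gamma> (X p x \<omega> ?s) \<omega>' - \<gamma> (X p x \<omega> ?s))"
        by simp
    qed
    also have "\<dots> = 0" by (simp only: inner integral_zero)
    finally show ?thesis .
  qed
  have "AE \<omega> in noise_law. (\<lambda>n. (\<Sum>k<n. D k \<omega>) / real n) \<longlonglongrightarrow> 0"
  proof (rule noise.orthogonal_LLN[where V="(2 * B) * (2 * B)" and B="2 * B"])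
    show "integrable noise_law (\<lambda>\<omega>. (D k \<omega>)\<^sup>2)" for k
      unfolding power2_eq_square by (rule integrable_noise_bounded[OF _ D2B]) (intro borel_measurable_times Dm)
    show "(\<integral>\<omega>. (D k \<omega>)\<^sup>2 \<partial>noise_law) \<le> (2 * B) * (2 * B)" for k
    proof -
      have "\<bar>\<integral>\<omega>. D k \<omega> * D k \<omega> \<partial>noise_law\<bar> \<le> (2 * B) * (2 * B)"
        by (rule noise_integral_abs_le[OF _ D2B]) (intro borel_measurable_times Dm)
      then show ?thesis unfolding power2_eq_square by (rule order_trans[OF abs_ge_self])
    qed
    show "AE \<omega> in noise_law. - (2 * B) \<le> D k \<omega>" for k
      using DB[of k] by (intro AE_I2) (simp add: abs_le_iff, smt (verit))
  qed (use Dm orth B in auto)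
  then show ?thesis by (simp add: D_def \<gamma>_def)
qed

subsection \<open>Short blocks\<close>

definition quiet :: "int set \<Rightarrow> real \<Rightarrow> noise \<Rightarrow> bool" where
  "quiet K h \<omega> \<longleftrightarrow> (\<forall>j\<in>K. cnt (\<omega> j) h = 0)"

definition single :: "int set \<Rightarrow> int \<Rightarrow> real \<Rightarrow> noise \<Rightarrow> bool" where
  "single K i h \<omega> \<longleftrightarrow> cnt (\<omega> i) h = 1 \<and> (\<forall>j\<in>K - {i}. cnt (\<omega> j) h = 0)"

lemma cnt_sets: "{e. cnt e h = n} \<in> sets site_law"
  using measurable_sets[OF measurable_cnt[of "\<lambda>e. e" site_law "\<lambda>_. h", OF measurable_ident_sets[OF refl] measurable_const], of "{n}"]
  by (simp add: vimage_def)

lemma cnt_mark_sets: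
  assumes "B \<in> sets borel"
  shows "{e. cnt e h = n \<and> snd (e 0) \<in> B} \<in> sets site_law"
proof -
  have "{e. snd (e 0) \<in> B} \<in> sets site_law"
    using measurable_sets[OF measurable_snd_site[of "\<lambda>e. e" site_law 0, OF measurable_ident_sets[OF refl]] assms]
    by (simp add: vimage_def)
  moreover have "{e. cnt e h = n \<and> snd (e 0) \<in> B} = {e. cnt e h = n} \<inter> {e. snd (e 0) \<in> B}" by blast
  ultimately show ?thesis by (simp only: sets.Int[OF cnt_sets])
qed

lemma prob_cnt_0:
  assumes "h \<ge> 0" shows "measure site_law {e. cnt e h = 0} = exp (- h)"
proof -
  have "measure site_law {e. cnt e h = 0} = measure site_law {e. h \<le> fst (e 0)}"
  proof (rule measure_eq_AE)
    show "AE e in site_law. (e \<in> {e. cnt e h = 0}) = (e \<in> {e. h \<le> fst (e 0)})"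
      using AE_proper by eventually_elim (simp add: cnt_eq_0_iff)
  qed (rule cnt_sets first_wait_sets)+
  with prob_first_wait_ge[OF assms] show ?thesis by simp
qed

text \<open>The single play falls at some \<open>t\<close> in \<open>[0, h)\<close>, with density
  \<open>exp (- t)\<close>, and silence must follow, with probability \<open>exp (t - h)\<close>.
  The product does not depend on \<open>t\<close>, and the mark is independent of both.\<close>

lemma prob_cnt_1:
  assumes h: "h \<ge> 0" and B: "B \<in> sets borel"
  shows "measure site_law {e. cnt e h = 1 \<and> snd (e 0) \<in> B} = h * exp (- h) * measure mark_law B"
proof -
  define G where "G e = (indicator {..<h} (fst (e 0)) * indicator B (snd (e 0)) * indicator {h..} (fst (e 0) + fst (e 1)) :: ennreal)"
    for e :: "nat \<Rightarrow> real \<times> real"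
  have f: "(\<lambda>e. fst (e k)) \<in> borel_measurable site_law" "(\<lambda>e. snd (e k)) \<in> borel_measurable site_law" for k
    by (rule measurable_fst_site measurable_snd_site; rule measurable_ident_sets[OF refl])+
  have Gm: "G \<in> borel_measurable site_law"
    unfolding G_def[abs_def]
    by (intro borel_measurable_times_ennreal measurable_compose[OF f(1)] measurable_compose[OF f(2)]
        measurable_compose[OF borel_measurable_add[OF f(1) f(1)]] borel_measurable_indicator B) simp_all
  have "emeasure site_law {e. cnt e h = 1 \<and> snd (e 0) \<in> B} = (\<integral>\<^sup>+e. indicator {e. cnt e h = 1 \<and> snd (e 0) \<in> B} e \<partial>site_law)"
    using cnt_mark_sets[OF B] by simp
  also have "\<dots> = (\<integral>\<^sup>+e. G e \<partial>site_law)"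
  proof (rule nn_integral_cong_AE)
    show "AE e in site_law. indicator {e. cnt e h = 1 \<and> snd (e 0) \<in> B} e = G e"
      using AE_proper by eventually_elim (auto simp: cnt_eq_1_iff[unfolded One_nat_def] G_def indicator_def)
  qed
  also have "\<dots> = (\<integral>\<^sup>+a. \<integral>\<^sup>+e. G (case_nat a e) \<partial>site_law \<partial>step_law)"
    by (rule nn_integral_site_Cons[OF Gm])
  also have "\<dots> = (\<integral>\<^sup>+a. indicator {..<h} (fst a) * ennreal (exp (fst a - h)) * indicator B (snd a) \<partial>step_law)"
  proof (rule nn_integral_cong)
    fix a :: "real \<times> real"
    have "(\<integral>\<^sup>+e. G (case_nat a e) \<partial>site_law)
        = (\<integral>\<^sup>+e. (indicator {..<h} (fst a) * indicator B (snd a)) * indicator {e. h - fst a \<le> fst (e 0)} e \<partial>site_law)"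
      by (intro nn_integral_cong) (auto simp: G_def indicator_def)
    also have "\<dots> = (indicator {..<h} (fst a) * indicator B (snd a)) * emeasure site_law {e. h - fst a \<le> fst (e 0)}"
      by (rule nn_integral_cmult_indicator) (rule first_wait_sets)
    also have "\<dots> = indicator {..<h} (fst a) * ennreal (exp (fst a - h)) * indicator B (snd a)"
      using prob_first_wait_ge[of "h - fst a"] by (auto simp: site.emeasure_eq_measure indicator_def)
    finally show "(\<integral>\<^sup>+e. G (case_nat a e) \<partial>site_law) = indicator {..<h} (fst a) * ennreal (exp (fst a - h)) * indicator B (snd a)" .
  qed
  also have "\<dots> = (\<integral>\<^sup>+t. \<integral>\<^sup>+u. indicator {..<h} t * ennreal (exp (t - h)) * indicator B u \<partial>mark_law \<partial>wait_law)"
  proof -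
    have "(\<lambda>a :: real \<times> real. indicator {..<h} (fst a) * ennreal (exp (fst a - h)) * indicator B (snd a)) \<in> borel_measurable (borel \<Otimes>\<^sub>M borel)"
      by (intro borel_measurable_times_ennreal measurable_compose[OF measurable_fst] measurable_compose[OF measurable_snd]
          borel_measurable_indicator B) simp_all
    then have "(\<lambda>a :: real \<times> real. indicator {..<h} (fst a) * ennreal (exp (fst a - h)) * indicator B (snd a)) \<in> borel_measurable (wait_law \<Otimes>\<^sub>M mark_law)"
      by (simp add: measurable_cong_sets[OF sets_pair_measure_cong refl, of wait_law borel mark_law borel])
    from unif.nn_integral_fst[OF this] show ?thesis by (simp add: step_law_def)
  qed
  also have "\<dots> = (\<integral>\<^sup>+t. indicator {..<h} t * ennreal (exp (t - h)) * emeasure mark_law B \<partial>wait_law)"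
    by (intro nn_integral_cong nn_integral_cmult_indicator) (use B in simp)
  also have "\<dots> = (\<integral>\<^sup>+t. indicator {..<h} t * ennreal (exp (t - h)) \<partial>wait_law) * emeasure mark_law B"
    by (rule nn_integral_multc) simp
  also have "(\<integral>\<^sup>+t. indicator {..<h} t * ennreal (exp (t - h)) \<partial>wait_law)
      = (\<integral>\<^sup>+t. ennreal (exponential_density 1 t) * (indicator {..<h} t * ennreal (exp (t - h))) \<partial>lborel)"
    by (rule nn_integral_density) simp_all
  also have "\<dots> = (\<integral>\<^sup>+t. ennreal (exp (- h)) * indicator {0..<h} t \<partial>lborel)"
    by (intro nn_integral_cong)
       (auto simp: exponential_density_def indicator_def ennreal_mult[symmetric] exp_add[symmetric])
  also have "\<dots> = ennreal (exp (- h)) * emeasure lborel {0..<h}"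
    by (rule nn_integral_cmult_indicator) simp
  also have "\<dots> = ennreal (h * exp (- h))"
    using h by (simp add: ennreal_mult[symmetric] mult.commute)
  finally show ?thesis
    using h by (simp add: site.emeasure_eq_measure unif.emeasure_eq_measure ennreal_mult[symmetric])
qed

lemma prob_quiet:
  assumes "h \<ge> 0" "finite K"
  shows "{\<omega>. quiet K h \<omega>} \<in> sets noise_law" "measure noise_law {\<omega>. quiet K h \<omega>} = exp (- h * card K)"
proof -
  have eq: "{\<omega>. quiet K h \<omega>} = {\<omega> \<in> space noise_law. \<forall>j\<in>K. \<omega> j \<in> {e. cnt e h = 0}}"
    by (auto simp: quiet_def)
  have "{\<omega> \<in> space noise_law. \<omega> j \<in> {e. cnt e h = 0}} \<in> sets noise_law" for j
    using measurable_sets[OF measurable_noise_component[OF measurable_ident_sets[OF refl]] cnt_sets] by (simp add: vimage_def)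
  then show "{\<omega>. quiet K h \<omega>} \<in> sets noise_law"
    unfolding eq by (intro sets.sets_Collect_finite_All assms)
  have "emeasure noise_law {\<omega>. quiet K h \<omega>} = (\<Prod>j\<in>K. emeasure site_law {e. cnt e h = 0})"
    unfolding eq by (rule noise.emeasure_PiM_Collect) (use assms cnt_sets in auto)
  also have "\<dots> = (\<Prod>j\<in>K. ennreal (exp (- h)))"
    by (simp only: site.emeasure_eq_measure prob_cnt_0[OF assms(1)])
  also have "\<dots> = ennreal (exp (- h) ^ card K)"
    by (simp add: ennreal_power)
  also have "exp (- h) ^ card K = exp (- h * card K)" by (simp add: exp_of_nat_mult[symmetric] mult.commute)
  finally show "measure noise_law {\<omega>. quiet K h \<omega>} = exp (- h * card K)"
    by (simp add: noise.emeasure_eq_measure)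
qed

lemma prob_single:
  assumes "h \<ge> 0" "finite K" "i \<in> K" "B \<in> sets borel"
  shows "{\<omega>. single K i h \<omega> \<and> snd (\<omega> i 0) \<in> B} \<in> sets noise_law"
    and "measure noise_law {\<omega>. single K i h \<omega> \<and> snd (\<omega> i 0) \<in> B} = h * exp (- h * card K) * measure mark_law B"
proof -
  define A where "A j = (if j = i then {e. cnt e h = 1 \<and> snd (e 0) \<in> B} else {e. cnt e h = 0})" for j
  have As: "A j \<in> sets site_law" for j
    using cnt_sets cnt_mark_sets[OF assms(4)] by (simp add: A_def)
  have eq: "{\<omega>. single K i h \<omega> \<and> snd (\<omega> i 0) \<in> B} = {\<omega> \<in> space noise_law. \<forall>j\<in>K. \<omega> j \<in> A j}"
    using assms(3) by (auto simp: single_def A_def)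
  have "{\<omega> \<in> space noise_law. \<omega> j \<in> A j} \<in> sets noise_law" for j
    using measurable_sets[OF measurable_noise_component[OF measurable_ident_sets[OF refl]] As] by (simp add: vimage_def)
  then show "{\<omega>. single K i h \<omega> \<and> snd (\<omega> i 0) \<in> B} \<in> sets noise_law"
    unfolding eq by (intro sets.sets_Collect_finite_All assms)
  have "emeasure noise_law {\<omega>. single K i h \<omega> \<and> snd (\<omega> i 0) \<in> B} = (\<Prod>j\<in>K. emeasure site_law (A j))"
    unfolding eq by (rule noise.emeasure_PiM_Collect) (use assms As in auto)
  also have "\<dots> = emeasure site_law (A i) * (\<Prod>j\<in>K - {i}. emeasure site_law (A j))"
    by (rule prod.remove) (use assms in auto)
  also have "(\<Prod>j\<in>K - {i}. emeasure site_law (A j)) = (\<Prod>j\<in>K - {i}. ennreal (exp (- h)))"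
    by (intro prod.cong) (auto simp: A_def site.emeasure_eq_measure prob_cnt_0 assms)
  also have "\<dots> = ennreal (exp (- h) ^ (card K - 1))"
    using assms by (simp add: ennreal_power)
  also have "emeasure site_law (A i) = ennreal (h * exp (- h) * measure mark_law B)"
    using prob_cnt_1[OF assms(1,4)] by (simp add: A_def site.emeasure_eq_measure)
  also have "ennreal (h * exp (- h) * measure mark_law B) * ennreal (exp (- h) ^ (card K - 1))
      = ennreal (h * (exp (- h) * exp (- h) ^ (card K - 1)) * measure mark_law B)"
    using assms by (subst ennreal_mult[symmetric]) (auto simp: ac_simps)
  also have "exp (- h) * exp (- h) ^ (card K - 1) = exp (- h * card K)"
  proof -
    have "card K > 0" using assms by (auto simp: card_gt_0_iff)
    then have "exp (- h) * exp (- h) ^ (card K - 1) = exp (- h) ^ card K" by (cases "card K") auto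
    then show ?thesis by (simp add: exp_of_nat_mult[symmetric] mult.commute)
  qed
  finally show "measure noise_law {\<omega>. single K i h \<omega> \<and> snd (\<omega> i 0) \<in> B} = h * exp (- h * card K) * measure mark_law B"
    using assms by (simp add: noise.emeasure_eq_measure)
qed

lemma mark_law_abs_le: "\<bar>a\<bar> \<le> M \<Longrightarrow> \<bar>b\<bar> \<le> M \<Longrightarrow> \<bar>a * (1 - measure mark_law B) + b * measure mark_law B\<bar> \<le> M"
proof -
  assume ab: "\<bar>a\<bar> \<le> M" "\<bar>b\<bar> \<le> M"
  let ?u = "measure mark_law B"
  have u: "0 \<le> ?u" "?u \<le> 1" using unif.prob_le_1 by auto
  have "\<bar>a * (1 - ?u) + b * ?u\<bar> \<le> \<bar>a * (1 - ?u)\<bar> + \<bar>b * ?u\<bar>" by (rule abs_triangle_ineq)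
  also have "\<dots> = \<bar>a\<bar> * (1 - ?u) + \<bar>b\<bar> * ?u" using u by (simp add: abs_mult)
  also have "\<dots> \<le> M * (1 - ?u) + M * ?u" by (intro add_mono mult_right_mono ab) (use u in auto)
  finally show ?thesis by (simp add: algebra_simps)
qed

text \<open>A first-order expansion in \<open>h\<close>. Two or more plays in the window
  \<open>K\<close> have probability O(h^2), so \<open>\<Psi>\<close> has to be known only when
  nobody in \<open>K\<close> plays and when exactly one player does, whose mark then selects between
  \<open>b i\<close> and \<open>a i\<close>.\<close>

lemma block_expansion:
  fixes \<Psi> :: "noise \<Rightarrow> real"
  assumes h: "h \<ge> 0" and K: "finite K" and m: "\<Psi> \<in> borel_measurable noise_law" and M: "\<And>\<omega>. \<bar>\<Psi> \<omega>\<bar> \<le> M"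
    and c0: "\<And>\<omega>. good \<omega> \<Longrightarrow> quiet K h \<omega> \<Longrightarrow> \<Psi> \<omega> = c"
    and c1: "\<And>\<omega> i. good \<omega> \<Longrightarrow> i \<in> K \<Longrightarrow> single K i h \<omega> \<Longrightarrow> \<Psi> \<omega> = (if snd (\<omega> i 0) \<in> B i then b i else a i)"
    and B: "\<And>i. i \<in> K \<Longrightarrow> B i \<in> sets borel" and cM: "\<bar>c\<bar> \<le> M"
    and ab: "\<And>i. i \<in> K \<Longrightarrow> \<bar>a i\<bar> \<le> M" "\<And>i. i \<in> K \<Longrightarrow> \<bar>b i\<bar> \<le> M"
  shows "\<bar>(\<integral>\<omega>. \<Psi> \<omega> \<partial>noise_law)
      - (c + h * (\<Sum>i\<in>K. (a i * (1 - measure mark_law (B i)) + b i * measure mark_law (B i)) - c))\<bar>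
    \<le> 2 * M * (real (card K) * h)^2"
proof -
  let ?Q = "{\<omega>. quiet K h \<omega>}"
  define Sin where "Sin i = {\<omega>. single K i h \<omega> \<and> snd (\<omega> i 0) \<in> B i}" for i
  define Sout where "Sout i = {\<omega>. single K i h \<omega> \<and> snd (\<omega> i 0) \<in> - B i}" for i
  let ?u = "\<lambda>i. measure mark_law (B i)"
  define E where "E = exp (- h * card K)"
  define x where "x = real (card K) * h"
  have x: "x \<ge> 0" using h by (simp add: x_def)
  have E: "1 - x \<le> E" "E \<le> 1" using exp_ge_add_one_self[of "-x"] x by (simp_all add: E_def x_def mult.commute)
  have Q: "?Q \<in> sets noise_law" "measure noise_law ?Q = E"
    using prob_quiet[OF h K] by (simp_all add: E_def)
  have Sin: "Sin i \<in> sets noise_law" "measure noise_law (Sin i) = h * E * ?u i" if "i \<in> K" for i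
    using prob_single[OF h K that B[OF that]] by (simp_all add: E_def Sin_def)
  have Sout: "Sout i \<in> sets noise_law" "measure noise_law (Sout i) = h * E * (1 - ?u i)" if "i \<in> K" for i
  proof -
    have Bc: "- B i \<in> sets borel" using B[OF that] by (rule borel_comp)
    have "measure mark_law (space mark_law - B i) = 1 - ?u i"
      using B[OF that] by (intro unif.prob_compl) simp
    then have "measure mark_law (- B i) = 1 - ?u i" by (simp add: Compl_eq_Diff_UNIV)
    with prob_single[OF h K that Bc] show "Sout i \<in> sets noise_law" "measure noise_law (Sout i) = h * E * (1 - ?u i)"
      by (simp_all add: E_def Sout_def)
  qed
  have Mnn: "M \<ge> 0" using order_trans[OF abs_ge_zero cM] .
  let ?i = "\<lambda>A \<omega>. indicator A \<omega> :: real"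
  \<comment> \<open>\<open>\<phi>\<close> is the value of \<open>\<Psi>\<close> on at most one play
    in \<open>K\<close>, and \<open>r\<close> below is \<open>M\<close> times the indicator of at
    least two plays, so that \<open>r\<close> dominates the difference.\<close>
  define \<phi> where "\<phi> \<omega> = c * ?i ?Q \<omega> + (\<Sum>i\<in>K. b i * ?i (Sin i) \<omega> + a i * ?i (Sout i) \<omega>)" for \<omega>
  define r where "r \<omega> = M * (1 - ?i ?Q \<omega> - (\<Sum>i\<in>K. ?i (Sin i) \<omega> + ?i (Sout i) \<omega>))" for \<omega>
  have int: "integrable noise_law (?i A)" if "A \<in> sets noise_law" for A
    by (rule integrable_noise_bounded[where B=1]) (use that in \<open>auto simp: indicator_def\<close>)
  have I: "(\<integral>\<omega>. ?i A \<omega> \<partial>noise_law) = measure noise_law A" if "A \<in> sets noise_law" for A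
    by simp
  have int\<phi>: "integrable noise_law \<phi>"
    unfolding \<phi>_def[abs_def]
    by (intro Bochner_Integration.integrable_add Bochner_Integration.integrable_sum integrable_mult_right int Q Sin Sout)
  have intr: "integrable noise_law r"
    unfolding r_def[abs_def]
    by (intro Bochner_Integration.integrable_diff integrable_mult_right Bochner_Integration.integrable_add
        Bochner_Integration.integrable_sum int Q Sin Sout) (rule integrable_noise_bounded[where B=1]; simp)
  have int\<Psi>: "integrable noise_law \<Psi>" by (rule integrable_noise_bounded[OF m M])
  have I\<phi>: "(\<integral>\<omega>. \<phi> \<omega> \<partial>noise_law) = c * E + (\<Sum>i\<in>K. h * E * (a i * (1 - ?u i) + b i * ?u i))"
  proof -
    have "(\<integral>\<omega>. \<phi> \<omega> \<partial>noise_law) = c * measure noise_law ?Q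
        + (\<Sum>i\<in>K. b i * measure noise_law (Sin i) + a i * measure noise_law (Sout i))"
      unfolding \<phi>_def using int Q(1) Sin(1) Sout(1) I by (simp add: Bochner_Integration.integral_sum)
    then show ?thesis by (simp add: Q(2) Sin(2) Sout(2) algebra_simps)
  qed
  have Ir: "(\<integral>\<omega>. r \<omega> \<partial>noise_law) = M * (1 - E - x * E)"
  proof -
    have "(\<integral>\<omega>. r \<omega> \<partial>noise_law) = M * (1 - measure noise_law ?Q
        - (\<Sum>i\<in>K. measure noise_law (Sin i) + measure noise_law (Sout i)))"
      unfolding r_def using int Q(1) Sin(1) Sout(1) I by (simp add: Bochner_Integration.integral_sum)
    also have "(\<Sum>i\<in>K. measure noise_law (Sin i) + measure noise_law (Sout i)) = (\<Sum>i\<in>K. h * E)"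
      by (intro sum.cong refl) (simp add: Sin(2) Sout(2) algebra_simps)
    finally show ?thesis by (simp add: Q(2) x_def)
  qed
  have le: "\<bar>\<Psi> \<omega> - \<phi> \<omega>\<bar> \<le> r \<omega>" if g: "good \<omega>" for \<omega>
  proof (cases "quiet K h \<omega>")
    case True
    then have "?i (Sin i) \<omega> = 0" "?i (Sout i) \<omega> = 0" if "i \<in> K" for i
      using that by (auto simp: Sin_def Sout_def single_def quiet_def indicator_def)
    then show ?thesis using c0[OF g True] True by (simp add: \<phi>_def r_def)
  next
    case nq: False
    show ?thesis
    proof (cases "\<exists>i\<in>K. single K i h \<omega>")
      case True
      then obtain i where i: "i \<in> K" "single K i h \<omega>" by auto
      have other: "?i (Sin j) \<omega> = 0" "?i (Sout j) \<omega> = 0" if "j \<in> K - {i}" for j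
        using that i by (auto simp: Sin_def Sout_def single_def indicator_def)
      have sum: "(\<Sum>j\<in>K. f j * ?i (Sin j) \<omega> + g j * ?i (Sout j) \<omega>) = f i * ?i (Sin i) \<omega> + g i * ?i (Sout i) \<omega>"
        for f g :: "int \<Rightarrow> real"
        using other by (subst sum.remove[OF K i(1)]) simp
      have "\<Psi> \<omega> = \<phi> \<omega>"
        using c1[OF g i] i nq by (simp add: \<phi>_def sum) (simp add: Sin_def Sout_def indicator_def)
      moreover have "r \<omega> = 0"
        using sum[of "\<lambda>_. 1" "\<lambda>_. 1"] i nq by (simp add: r_def) (simp add: Sin_def Sout_def indicator_def)
      ultimately show ?thesis by simp
    next
      case False
      then have "?i (Sin i) \<omega> = 0" "?i (Sout i) \<omega> = 0" if "i \<in> K" for i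
        using that by (auto simp: Sin_def Sout_def indicator_def)
      then show ?thesis using M[of \<omega>] nq by (simp add: \<phi>_def r_def)
    qed
  qed
  have "\<bar>(\<integral>\<omega>. \<Psi> \<omega> \<partial>noise_law) - (\<integral>\<omega>. \<phi> \<omega> \<partial>noise_law)\<bar> \<le> (\<integral>\<omega>. \<bar>\<Psi> \<omega> - \<phi> \<omega>\<bar> \<partial>noise_law)"
    using integral_abs_bound[of noise_law "\<lambda>\<omega>. \<Psi> \<omega> - \<phi> \<omega>"] int\<Psi> int\<phi> by simp
  also have "\<dots> \<le> (\<integral>\<omega>. r \<omega> \<partial>noise_law)"
    using AE_good le by (intro integral_mono_AE intr integrable_abs Bochner_Integration.integrable_diff int\<Psi> int\<phi>)
      (auto elim: eventually_mono)
  finally have 1: "\<bar>(\<integral>\<omega>. \<Psi> \<omega> \<partial>noise_law) - (\<integral>\<omega>. \<phi> \<omega> \<partial>noise_law)\<bar> \<le> M * (1 - E - x * E)"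
    unfolding Ir .
  define s where "s = (\<Sum>i\<in>K. a i * (1 - ?u i) + b i * ?u i)"
  have s: "h * \<bar>s\<bar> \<le> x * M"
  proof -
    have "\<bar>s\<bar> \<le> (\<Sum>i\<in>K. \<bar>a i * (1 - ?u i) + b i * ?u i\<bar>)" unfolding s_def by (rule sum_abs)
    also have "\<dots> \<le> (\<Sum>i\<in>K. M)" by (intro sum_mono mark_law_abs_le ab)
    finally have "h * \<bar>s\<bar> \<le> h * (real (card K) * M)" using h by (intro mult_left_mono) auto
    then show ?thesis by (simp add: x_def ac_simps)
  qed
  have "(\<integral>\<omega>. \<phi> \<omega> \<partial>noise_law) - (c + h * (\<Sum>i\<in>K. (a i * (1 - ?u i) + b i * ?u i) - c))
      = c * (E - 1 + x) - (1 - E) * (h * s)"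
  proof -
    have "(\<Sum>i\<in>K. h * E * (a i * (1 - ?u i) + b i * ?u i)) = h * E * s"
      by (simp only: s_def sum_distrib_left)
    moreover have "(\<Sum>i\<in>K. (a i * (1 - ?u i) + b i * ?u i) - c) = s - real (card K) * c"
      by (simp add: s_def sum_subtractf)
    ultimately show ?thesis unfolding I\<phi> by (simp only:) (simp add: x_def algebra_simps)
  qed
  also have "\<bar>\<dots>\<bar> \<le> \<bar>c\<bar> * (E - 1 + x) + (1 - E) * (h * \<bar>s\<bar>)"
    using E h by (intro order_trans[OF abs_triangle_ineq4]) (simp add: abs_mult)
  also have "\<dots> \<le> M * (E - 1 + x) + (1 - E) * (x * M)"
    using E by (intro add_mono mult_right_mono mult_left_mono cM s) auto
  finally have 2: "\<bar>(\<integral>\<omega>. \<phi> \<omega> \<partial>noise_law) - (c + h * (\<Sum>i\<in>K. (a i * (1 - ?u i) + b i * ?u i) - c))\<bar>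
      \<le> M * (E - 1 + x) + (1 - E) * (x * M)" .
  \<comment> \<open>Both errors have been kept exact so far because their first-order parts cancel;
    what remains is of second order by \<open>1 - E \<le> x\<close>.\<close>
  have "M * (1 - E - x * E) + (M * (E - 1 + x) + (1 - E) * (x * M)) = 2 * M * (x * (1 - E))"
    by (simp add: algebra_simps)
  also have "\<dots> \<le> 2 * M * (x * x)"
    using E x Mnn by (intro mult_left_mono) auto
  finally show ?thesis using 1 2 by (simp add: x_def power2_eq_square)
qed

lemma prob_mark_less:
  assumes "0 \<le> c" "c \<le> 1"
  shows "measure mark_law {..<c} = c"
proof -
  have "emeasure mark_law {..<c} = emeasure lborel ({0..1} \<inter> {..<c}) / emeasure lborel {0..1::real}"
    by (rule emeasure_uniform_measure) auto
  also have "{0..1} \<inter> {..<c} = {0..<c}" using assms by auto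
  also have "emeasure lborel {0..<c} / emeasure lborel {0..1::real} = ennreal c / ennreal 1"
    using assms by simp
  also have "\<dots> = ennreal c" using assms by (simp add: divide_ennreal del: ennreal_1)
  finally show ?thesis using assms by (simp add: measure_def)
qed

lemma X_unchanged: "cnt (\<omega> i) t = 0 \<Longrightarrow> X p x \<omega> t i = x i"
  by (simp add: X_eq)

text \<open>\<open>K\<close> contains both neighbours, so at the moment of the play they still show
  their initial status.\<close>

lemma X_single:
  assumes g: "good \<omega>" and s: "single K i h \<omega>" and K: "i - 1 \<in> K" "i + 1 \<in> K"
  shows "X p x \<omega> h i \<longleftrightarrow> snd (\<omega> i 0) < p (nbhd x i)"
proof -
  have 1: "cnt (\<omega> i) h = 1" and 0: "cnt (\<omega> (i - 1)) h = 0" "cnt (\<omega> (i + 1)) h = 0"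
    using s K by (auto simp: single_def)
  let ?t = "ptime (\<omega> i) 0"
  have t: "?t \<le> h" using less_cnt_iff[OF good_proper[OF g], of 0 i h] 1 by simp
  have "cnt (\<omega> j) ?t = 0" if "cnt (\<omega> j) h = 0" for j
    using cnt_mono[OF good_proper[OF g] t, of j] that by simp
  then have "nbhd (X p x \<omega> ?t) i = nbhd x i"
    using 0 by (intro nbhd_cong X_unchanged) auto
  then show ?thesis using 1 out_unfold[OF g, of p x i 0] by (simp add: X_eq)
qed

lemma X_single_other:
  "single K i h \<omega> \<Longrightarrow> j \<in> K \<Longrightarrow> j \<noteq> i \<Longrightarrow> X p x \<omega> h j = x j"
  by (rule X_unchanged) (simp add: single_def)

lemma X_quiet: "quiet K h \<omega> \<Longrightarrow> j \<in> K \<Longrightarrow> X p x \<omega> h j = x j"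
  by (rule X_unchanged) (simp add: quiet_def)

lemma good_cnt_add:
  assumes "good3 s \<omega> \<omega>'" "0 \<le> s" "0 \<le> t"
  shows "cnt (glue s \<omega> \<omega>' i) (s + t) = cnt (\<omega> i) s + cnt (\<omega>' i) t"
  using assms by (cases "t = 0") (auto simp: cnt_glue3 good3_def good_proper)

lemma measurable_cnt_noise:
  "\<omega> \<in> measurable M noise_law \<Longrightarrow> (\<lambda>z. cnt (\<omega> z i) t) \<in> measurable M (count_space UNIV)"
  by (rule measurable_cnt[OF measurable_noise_component measurable_const]) simp_all

subsection \<open>Long-run averages along a skeleton\<close>

text \<open>\<open>F\<close> at time \<open>(k + 1) h\<close> minus \<open>avg p h F\<close> at time
  \<open>k h\<close> is centred given the past, and shifting the index of \<open>F\<close> by one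
  costs a bounded amount in the whole sum. The lemma says that the drift of \<open>F\<close>
  vanishes in the long run; a function with a known drift then yields information on time
  averages.\<close>

lemma skeleton_LLN:
  assumes h: "h \<ge> 0" and F: "F \<in> borel_measurable config_space" "\<And>x. \<bar>F x\<bar> \<le> B"
  shows "AE \<omega> in noise_law. (\<lambda>n. (\<Sum>k<n. F (X p x \<omega> (real k * h)) - avg p h F (X p x \<omega> (real k * h))) / real n) \<longlonglongrightarrow> 0"
proof -
  have B: "B \<ge> 0" using F(2)[of undefined] by linarith
  have Y: "F (X p x (glue (real k * h) \<omega> \<omega>') (real (Suc k) * h)) = F (X p (X p x \<omega> (real k * h)) \<omega>' h)"
    if "good3 (real k * h) \<omega> \<omega>'" for k \<omega> \<omega>'
    using X_glue_ge3[OF that _ h, of p x] h by (simp add: distrib_right add.commute)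
  have "AE \<omega> in noise_law. (\<lambda>n. (\<Sum>k<n. F (X p x \<omega> (real (Suc k) * h)) -
      (\<integral>\<omega>'. F (X p (X p x \<omega> (real k * h)) \<omega>' h) \<partial>noise_law)) / real n) \<longlonglongrightarrow> 0"
  proof (rule block_LLN[where B=B and \<Gamma>="\<lambda>y \<omega>'. F (X p y \<omega>' h)" and Y="\<lambda>k \<omega>. F (X p x \<omega> (real (Suc k) * h))"])
    show "(\<lambda>z. F (X p (fst z) (snd z) h)) \<in> borel_measurable (config_space \<Otimes>\<^sub>M noise_law)"
      by (rule measurable_compose[OF measurable_X_pair F(1)])
    show "(\<lambda>\<omega>. F (X p x \<omega> (real (Suc k) * h))) \<in> borel_measurable noise_law" for k
      by (rule measurable_FX[OF F(1)])
    show "F (X p x (glue (real k * h) \<omega> \<omega>') (real (Suc j) * h)) = F (X p x \<omega> (real (Suc j) * h))"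
      if "j < k" "good3 (real k * h) \<omega> \<omega>'" for j k \<omega> \<omega>'
    proof -
      have "real (Suc j) * h \<le> real k * h" using that h by (intro mult_right_mono) auto
      then show ?thesis using X_glue_le3[OF that(2)] h by simp
    qed
  qed (use h F Y in auto)
  then show ?thesis
  proof eventually_elim
    case (elim \<omega>)
    define u where "u k = F (X p x \<omega> (real k * h))" for k
    define v where "v k = avg p h F (X p x \<omega> (real k * h))" for k
    have lim: "(\<lambda>n. (\<Sum>k<n. u (Suc k) - v k) / real n) \<longlonglongrightarrow> 0"
      using elim unfolding u_def v_def avg_def .
    have "(\<lambda>n. (u n - u 0) / real n) \<longlonglongrightarrow> 0"
    proof (rule tendsto_0_le[where K="2 * B"])
      show "(\<lambda>n. 1 / real n) \<longlonglongrightarrow> 0" by (rule lim_1_over_n)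
      show "\<forall>\<^sub>F n in sequentially. norm ((u n - u 0) / real n) \<le> norm (1 / real n) * (2 * B)"
      proof (rule always_eventually, rule allI)
        fix n
        have "\<bar>u n - u 0\<bar> \<le> 2 * B" 
          using abs_triangle_ineq4[of "u n" "u 0"] F(2)[of "X p x \<omega> (real n * h)"] F(2)[of "X p x \<omega> (real 0 * h)"]
          unfolding u_def by linarith
        then have "\<bar>u n - u 0\<bar> / real n \<le> 2 * B / real n" by (rule divide_right_mono) simp
        then show "norm ((u n - u 0) / real n) \<le> norm (1 / real n) * (2 * B)" by simp
      qed
    qed
    from tendsto_diff[OF lim this]
    have "(\<lambda>n. (\<Sum>k<n. u (Suc k) - v k) / real n - (u n - u 0) / real n) \<longlonglongrightarrow> 0" by simp
    moreover have "(\<Sum>k<n. u (Suc k) - v k) / real n - (u n - u 0) / real n = (\<Sum>k<n. u k - v k) / real n" for n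
    proof -
      have "(\<Sum>k<n. u (Suc k) - v k) - (u n - u 0) = (\<Sum>k<n. u k - v k)"
        by (induction n) auto
      then show ?thesis by (simp flip: diff_divide_distrib)
    qed
    ultimately show ?case by (simp add: u_def v_def)
  qed
qed

text \<open>A time block of length \<open>h\<close> contributes to the profit of player \<open>i\<close> up to
  \<open>O(h^2)\<close> only if he plays once in it and his two neighbours do not play, and then the state at
  the beginning of the block decides with which probability he wins.\<close>

definition clean :: "int \<Rightarrow> real \<Rightarrow> bool \<Rightarrow> game \<Rightarrow> config \<Rightarrow> noise \<Rightarrow> bool" where
  "clean i h b p x \<omega> \<longleftrightarrow> single {i - 1, i, i + 1} i h \<omega> \<and> X p x \<omega> h i = b"

text \<open>The event \<open>clean\<close> for block \<open>k\<close> of one long noise, in terms of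
  increments of the play counts, so that it can be evaluated without decomposing the noise.\<close>

definition clean_block :: "int \<Rightarrow> real \<Rightarrow> bool \<Rightarrow> game \<Rightarrow> config \<Rightarrow> nat \<Rightarrow> noise \<Rightarrow> bool" where
  "clean_block i h b p x k \<omega> \<longleftrightarrow> cnt (\<omega> i) (real (Suc k) * h) = Suc (cnt (\<omega> i) (real k * h)) \<and>
     cnt (\<omega> (i - 1)) (real (Suc k) * h) = cnt (\<omega> (i - 1)) (real k * h) \<and>
     cnt (\<omega> (i + 1)) (real (Suc k) * h) = cnt (\<omega> (i + 1)) (real k * h) \<and> X p x \<omega> (real (Suc k) * h) i = b"

lemma single3: "single {i - 1, i, i + 1 :: int} i h \<omega> \<longleftrightarrow> cnt (\<omega> i) h = 1 \<and> cnt (\<omega> (i - 1)) h = 0 \<and> cnt (\<omega> (i + 1)) h = 0"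
  by (auto simp: single_def)

lemma pred_cnt_eq:
  "\<omega> \<in> measurable M noise_law \<Longrightarrow> Measurable.pred M (\<lambda>z. cnt (\<omega> z i) t = n)"
  by (rule measurable_compose[OF measurable_cnt_noise]) auto

lemma pred_clean:
  assumes x: "x \<in> measurable M config_space" and \<omega>: "\<omega> \<in> measurable M noise_law"
  shows "Measurable.pred M (\<lambda>z. clean i h b p (x z) (\<omega> z))"
proof -
  note [measurable] = pred_cnt_eq[OF \<omega>] pred_X[OF x \<omega>]
  show ?thesis unfolding clean_def single3 by measurable
qed

lemma pred_clean_block:
  assumes x: "x \<in> measurable M config_space" and \<omega>: "\<omega> \<in> measurable M noise_law"
  shows "Measurable.pred M (\<lambda>z. clean_block i h b p (x z) k (\<omega> z))"
proof -
  note [measurable] = pred_cnt_eq[OF \<omega>] pred_X[OF x \<omega>]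
  have *: "cnt a s = Suc (cnt b t) \<longleftrightarrow> (\<exists>n. cnt b t = n \<and> cnt a s = Suc n)"
    "cnt a s = cnt b t \<longleftrightarrow> (\<exists>n. cnt b t = n \<and> cnt a s = n)" for a b s t
    by auto
  show ?thesis unfolding clean_block_def * by measurable
qed

lemma integral_clean:
  assumes h: "h \<ge> 0" and p: "0 \<le> p (nbhd x i)" "p (nbhd x i) \<le> 1"
  shows "(\<integral>\<omega>. of_bool (clean i h b p x \<omega>) \<partial>noise_law)
    = h * exp (- 3 * h) * (if b then p (nbhd x i) else 1 - p (nbhd x i))"
proof -
  let ?K = "{i - 1, i, i + 1}"
  define B where "B = (if b then {..<p (nbhd x i)} else {p (nbhd x i)..})"
  have B: "B \<in> sets borel" by (simp add: B_def)
  have "measure mark_law {p (nbhd x i)..} = 1 - p (nbhd x i)"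
  proof -
    have "measure mark_law (space mark_law - {..<p (nbhd x i)}) = 1 - measure mark_law {..<p (nbhd x i)}"
      by (rule unif.prob_compl) simp
    moreover have "space mark_law - {..<p (nbhd x i)} = {p (nbhd x i)..}" by auto
    ultimately show ?thesis using prob_mark_less[OF p] by (simp only:)
  qed
  then have u: "measure mark_law B = (if b then p (nbhd x i) else 1 - p (nbhd x i))"
    using prob_mark_less[OF p] by (simp add: B_def)
  let ?S = "{\<omega>. single ?K i h \<omega> \<and> snd (\<omega> i 0) \<in> B}"
  have S: "?S \<in> sets noise_law" "measure noise_law ?S = h * exp (- h * card ?K) * measure mark_law B"
    using prob_single[OF h, of ?K i B] B by simp_all
  have "(\<integral>\<omega>. of_bool (clean i h b p x \<omega>) \<partial>noise_law) = (\<integral>\<omega>. (indicator ?S \<omega> :: real) \<partial>noise_law)"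
  proof (rule integral_cong_AE)
    have "Measurable.pred noise_law (\<lambda>\<omega>. clean i h b p x \<omega>)"
      by (rule pred_clean) simp_all
    then show "(\<lambda>\<omega>. of_bool (clean i h b p x \<omega>) :: real) \<in> borel_measurable noise_law" by simp
    show "(indicator ?S :: _ \<Rightarrow> real) \<in> borel_measurable noise_law" using S by simp
    show "AE \<omega> in noise_law. of_bool (clean i h b p x \<omega>) = (indicator ?S \<omega> :: real)"
      using AE_good
    proof eventually_elim
      case (elim \<omega>)
      have "clean i h b p x \<omega> \<longleftrightarrow> \<omega> \<in> ?S"
        using X_single[OF elim, of ?K i h p x] by (cases b) (auto simp: clean_def B_def)
      then show ?case by (simp add: indicator_def)
    qed
  qed
  also have "\<dots> = measure noise_law ?S" using S by simp
  also have "\<dots> = h * exp (- 3 * h) * (if b then p (nbhd x i) else 1 - p (nbhd x i))"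
    unfolding S u by (simp add: mult.commute)
  finally show ?thesis .
qed

lemma clean_LLN:
  assumes h: "h > 0" and p: "\<And>y i. 0 \<le> p (nbhd y i)" "\<And>y i. p (nbhd y i) \<le> 1"
  shows "AE \<omega> in noise_law. (\<lambda>n. (\<Sum>k<n. of_bool (clean_block i h b p x k \<omega>) - h * exp (- 3 * h) *
      (if b then p (nbhd (X p x \<omega> (real k * h)) i) else 1 - p (nbhd (X p x \<omega> (real k * h)) i))) / real n) \<longlonglongrightarrow> 0"
proof -
  have "AE \<omega> in noise_law. (\<lambda>n. (\<Sum>k<n. of_bool (clean_block i h b p x k \<omega>) -
      (\<integral>\<omega>'. of_bool (clean i h b p (X p x \<omega> (real k * h)) \<omega>') \<partial>noise_law)) / real n) \<longlonglongrightarrow> 0"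
  proof (rule block_LLN[where B=1 and \<Gamma>="\<lambda>y \<omega>'. of_bool (clean i h b p y \<omega>')"
        and Y="\<lambda>k \<omega>. of_bool (clean_block i h b p x k \<omega>)"])
    have "Measurable.pred (config_space \<Otimes>\<^sub>M noise_law) (\<lambda>z. clean i h b p (fst z) (snd z))"
      by (rule pred_clean[OF measurable_fst measurable_snd])
    then show "(\<lambda>z. of_bool (clean i h b p (fst z) (snd z)) :: real) \<in> borel_measurable (config_space \<Otimes>\<^sub>M noise_law)"
      by simp
    fix k
    have "Measurable.pred noise_law (\<lambda>\<omega>. clean_block i h b p x k \<omega>)"
      by (rule pred_clean_block) simp_all
    then show "(\<lambda>\<omega>. of_bool (clean_block i h b p x k \<omega>) :: real) \<in> borel_measurable noise_law" by simp
    fix \<omega> \<omega>' assume g3: "good3 (real k * h) \<omega> \<omega>'"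
    have kh: "real k * h \<ge> 0" using h by simp
    have Suc: "real (Suc k) * h = real k * h + h" by (simp add: distrib_right)
    show "of_bool (clean_block i h b p x k (glue (real k * h) \<omega> \<omega>')) = (of_bool (clean i h b p (X p x \<omega> (real k * h)) \<omega>') :: real)"
      using good_cnt_add[OF g3 kh, of h] good_cnt_add[OF g3 kh, of 0] X_glue_ge3[OF g3 kh, of h p x] h g3
      unfolding clean_block_def clean_def single3 Suc
      by (simp add: good3_def good_proper)
    fix j assume "j < k"
    then have "real (Suc j) * h \<le> real k * h" "real j * h \<le> real k * h" using h by (auto intro!: mult_right_mono)
    then show "of_bool (clean_block i h b p x j (glue (real k * h) \<omega> \<omega>')) = (of_bool (clean_block i h b p x j \<omega>) :: real)"
      unfolding clean_block_def by (simp only: cnt_glue3[OF g3 kh] X_glue_le3[OF g3 kh] if_True)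
  qed (use h in auto)
  then show ?thesis using h p by (simp only: integral_clean less_imp_le)
qed

text \<open>Clean blocks bound the numbers of wins and of losses from below only; the upper bounds
  come from this bound on their sum.\<close>

lemma play_count_upper:
  assumes pr: "proper e" and L: "(\<lambda>n. (\<Sum>k<n. fst (e k)) / real n) \<longlonglongrightarrow> 1" and \<epsilon>: "\<epsilon> > 0"
  shows "\<forall>\<^sub>F t in at_top. real (card {n. ptime e n \<le> t}) \<le> (1 + \<epsilon>) * t"
proof -
  have "1 / (1 + \<epsilon>) < 1" using \<epsilon> by simp
  then have "\<forall>\<^sub>F n in sequentially. 1 / (1 + \<epsilon>) < (\<Sum>k<n. fst (e k)) / real n"
    by (rule order_tendstoD(1)[OF L])
  then obtain n0 where n0: "\<And>n. n \<ge> n0 \<Longrightarrow> 1 / (1 + \<epsilon>) < (\<Sum>k<n. fst (e k)) / real n"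
    by (auto simp: eventually_sequentially)
  have "\<forall>\<^sub>F t in at_top. real n0 \<le> t" by (rule eventually_ge_at_top)
  then show ?thesis
  proof eventually_elim
    case (elim t)
    define c where "c = card {n. ptime e n \<le> t}"
    have le: "real c \<le> (1 + \<epsilon>) * t"
    proof (cases "c \<le> n0 \<or> c = 0")
      case True
      have "t \<le> (1 + \<epsilon>) * t" using \<epsilon> elim by (simp add: distrib_right)
      moreover have "real c \<le> t" using True elim by auto
      ultimately show ?thesis by linarith
    next
      case False
      then obtain m where m: "c = Suc m" by (cases c) auto
      have "ptime e m \<le> t"
      proof (rule ccontr)
        assume "\<not> ptime e m \<le> t"
        then have "{n. ptime e n \<le> t} \<subseteq> {..<m}"
          using strict_mono_less_eq[OF proper_strict_mono[OF pr]] by (auto simp: not_le[symmetric]) (meson le_cases order_trans not_le)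
        then have "c \<le> m" unfolding c_def using card_mono[of "{..<m}"] by simp
        with m show False by simp
      qed
      then have "(\<Sum>k<c. fst (e k)) \<le> t" by (simp add: m ptime_def lessThan_Suc_atMost)
      moreover have "1 / (1 + \<epsilon>) < (\<Sum>k<c. fst (e k)) / real c" using False by (intro n0) simp
      then have "real c < (1 + \<epsilon>) * (\<Sum>k<c. fst (e k))" using \<epsilon> m by (simp add: field_simps)
      moreover have "(1 + \<epsilon>) * (\<Sum>k<c. fst (e k)) \<le> (1 + \<epsilon>) * t"
        using \<epsilon> calculation(1) by (intro mult_left_mono) auto
      ultimately show ?thesis by linarith
    qed
    then show ?case by (simp add: c_def)
  qed
qed

text \<open>Block \<open>k\<close> is sent to the number of its only play,
  \<open>cnt (\<omega> i) (real k * h)\<close>. The count grows in a clean block, so this map is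
  injective.\<close>

lemma clean_blocks_le:
  assumes g: "good \<omega>" and h: "h > 0" and mt: "real m * h \<le> t"
  shows "(\<Sum>k<m. of_bool (clean_block i h b p x k \<omega>)) \<le> card {n. ptime (\<omega> i) n \<le> t \<and> out p x \<omega> i n = b}"
proof -
  have pr: "proper (\<omega> i)" by (rule good_proper[OF g])
  let ?B = "{k. k < m \<and> clean_block i h b p x k \<omega>}"
  let ?f = "\<lambda>k. cnt (\<omega> i) (real k * h)"
  have "(\<Sum>k<m. of_bool (clean_block i h b p x k \<omega>)) = card ?B"
    by (simp add: of_bool_def sum.If_cases Int_def)
  also have "\<dots> = card (?f ` ?B)"
  proof (rule card_image[symmetric], rule linorder_inj_onI)
    fix k k' assume kk: "k < k'" "k \<in> ?B" "k' \<in> ?B"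
    have "?f k < cnt (\<omega> i) (real (Suc k) * h)" using kk by (simp add: clean_block_def)
    also have "\<dots> \<le> ?f k'" using kk h by (intro cnt_mono[OF pr] mult_right_mono) auto
    finally show "?f k \<noteq> ?f k'" by simp
  qed auto
  also have "\<dots> \<le> card {n. ptime (\<omega> i) n \<le> t \<and> out p x \<omega> i n = b}"
  proof (rule card_mono)
    have "{n. ptime (\<omega> i) n \<le> t \<and> out p x \<omega> i n = b} \<subseteq> {..<cnt (\<omega> i) (t + 1)}"
      by (auto simp: less_cnt_iff[OF pr])
    then show "finite {n. ptime (\<omega> i) n \<le> t \<and> out p x \<omega> i n = b}" by (rule finite_subset) simp
    show "?f ` ?B \<subseteq> {n. ptime (\<omega> i) n \<le> t \<and> out p x \<omega> i n = b}"
    proof clarify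
      fix k assume k: "k < m" "clean_block i h b p x k \<omega>"
      have c: "cnt (\<omega> i) (real (Suc k) * h) = Suc (?f k)" using k by (simp add: clean_block_def)
      then have "ptime (\<omega> i) (?f k) < real (Suc k) * h" by (rule cnt_SucD[OF pr])
      also have "\<dots> \<le> real m * h" using k h by (intro mult_right_mono) auto
      finally have "ptime (\<omega> i) (?f k) \<le> t" using mt by simp
      moreover have "out p x \<omega> i (?f k) = b"
        using k(2) c by (simp add: clean_block_def X_eq del: of_nat_Suc)
      ultimately show "ptime (\<omega> i) (?f k) \<le> t \<and> out p x \<omega> i (?f k) = b" by simp
    qed
  qed
  finally show ?thesis .
qed

definition site_profit :: "game \<Rightarrow> config \<Rightarrow> noise \<Rightarrow> int \<Rightarrow> real \<Rightarrow> real" where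
  "site_profit p x \<omega> i t = (\<Sum>n | ptime (\<omega> i) n \<le> t. if out p x \<omega> i n then 1 else - 1)"

definition skel_avg :: "real \<Rightarrow> game \<Rightarrow> config \<Rightarrow> noise \<Rightarrow> (config \<Rightarrow> real) \<Rightarrow> nat \<Rightarrow> real" where
  "skel_avg h p x \<omega> F n = (\<Sum>k<n. F (X p x \<omega> (real k * h))) / real n"

lemma site_profit_eq:
  assumes pr: "proper (\<omega> i)"
  shows "site_profit p x \<omega> i t = real (card {n. ptime (\<omega> i) n \<le> t \<and> out p x \<omega> i n = True})
      - real (card {n. ptime (\<omega> i) n \<le> t \<and> out p x \<omega> i n = False})"
    and "card {n. ptime (\<omega> i) n \<le> t} = card {n. ptime (\<omega> i) n \<le> t \<and> out p x \<omega> i n = True}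
      + card {n. ptime (\<omega> i) n \<le> t \<and> out p x \<omega> i n = False}"
proof -
  have "{n. ptime (\<omega> i) n \<le> t} \<subseteq> {..<cnt (\<omega> i) (t + 1)}"
    by (auto simp: less_cnt_iff[OF pr])
  then have fin: "finite {n. ptime (\<omega> i) n \<le> t}" by (rule finite_subset) simp
  show "site_profit p x \<omega> i t = real (card {n. ptime (\<omega> i) n \<le> t \<and> out p x \<omega> i n = True})
      - real (card {n. ptime (\<omega> i) n \<le> t \<and> out p x \<omega> i n = False})"
    unfolding site_profit_def using fin by (simp add: sum.If_cases Int_def)
  show "card {n. ptime (\<omega> i) n \<le> t} = card {n. ptime (\<omega> i) n \<le> t \<and> out p x \<omega> i n = True}
      + card {n. ptime (\<omega> i) n \<le> t \<and> out p x \<omega> i n = False}" (is "card ?A = card ?B + card ?C")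
  proof -
    have "?A = ?B \<union> ?C" by blast
    then have "card ?A = card (?B \<union> ?C)" by (rule arg_cong)
    also have "\<dots> = card ?B + card ?C"
    proof (rule card_Un_disjoint)
      show "finite ?B" "finite ?C" by (rule finite_subset[OF _ fin], blast)+
    qed blast
    finally show ?thesis .
  qed
qed

text \<open>Let \<open>a\<close> be the average winning probability along the skeleton. Wins and
  losses per unit of time are at least \<open>E * a\<close> and \<open>E * (1 - a)\<close>, up to
  small terms, and together at most 1. So their difference is within \<open>2 * (1 - E)\<close> of
  \<open>2 * a - 1\<close>, and \<open>1 - E \<le> 3 * h\<close>.\<close>

lemma site_profit_avg:
  assumes h: "h > 0" and p: "\<And>y i. 0 \<le> p (nbhd y i)" "\<And>y i. p (nbhd y i) \<le> 1"
  shows "AE \<omega> in noise_law. \<forall>\<epsilon>>0. \<forall>\<^sub>F t in at_top.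
    \<bar>site_profit p x \<omega> i t / t - skel_avg h p x \<omega> (\<lambda>y. 2 * p (nbhd y i) - 1) (nat \<lfloor>t / h\<rfloor>)\<bar> \<le> 6 * h + \<epsilon>"
proof -
  have LLN: "AE \<omega> in noise_law. \<forall>i. (\<lambda>n. (\<Sum>k<n. fst (\<omega> i k)) / real n) \<longlonglongrightarrow> 1"
    by (rule AE_noise_component[OF site_LLN])
  show ?thesis
    using AE_good LLN clean_LLN[where b=True, of h p i x, OF h p] clean_LLN[where b=False, of h p i x, OF h p]
  proof eventually_elim
    case (elim \<omega>)
    have pr: "proper (\<omega> i)" by (rule good_proper[OF elim(1)])
    define E where "E = exp (- 3 * h)"
    have E: "1 - 3 * h \<le> E" "E \<le> 1" "0 < E" using exp_ge_add_one_self[of "-3 * h"] h by (simp_all add: E_def)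
    define f where "f k = p (nbhd (X p x \<omega> (real k * h)) i)" for k
    define a where "a n = (\<Sum>k<n. f k) / real n" for n
    have a01: "0 \<le> a n" "a n \<le> 1" for n
    proof -
      show "0 \<le> a n" unfolding a_def f_def by (intro divide_nonneg_nonneg sum_nonneg p) simp
      have "(\<Sum>k<n. f k) \<le> (\<Sum>k<n. 1)" unfolding f_def by (intro sum_mono p)
      then show "a n \<le> 1" unfolding a_def by (cases "n = 0") (simp_all add: divide_le_eq)
    qed
    define c where "c b n = (\<Sum>k<n. of_bool (clean_block i h b p x k \<omega>) :: real)" for b n
    define v where "v b n = (if b then a n else 1 - a n)" for b n
    have cl: "(\<lambda>n. c b n / real n - h * E * v b n) \<longlonglongrightarrow> 0" for b
    proof -
      have eq: "\<forall>\<^sub>F n in sequentially. (\<Sum>k<n. of_bool (clean_block i h b p x k \<omega>) - h * E * (if b then f k else 1 - f k)) / real n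
          = c b n / real n - h * E * v b n"
        using eventually_gt_at_top[of 0]
      proof eventually_elim
        case (elim n)
        then show ?case
          by (cases b) (simp_all add: c_def v_def a_def sum_subtractf diff_divide_distrib sum_distrib_left[symmetric] right_diff_distrib)
      qed
      have "(\<lambda>n. (\<Sum>k<n. of_bool (clean_block i h b p x k \<omega>) - h * E * (if b then f k else 1 - f k)) / real n) \<longlonglongrightarrow> 0"
        using elim(3,4) unfolding f_def E_def by (cases b) (simp_all only: if_True if_False simp_thms)
      then show ?thesis by (simp only: filterlim_cong[OF refl refl eq])
    qed
    define w where "w b t = real (card {n. ptime (\<omega> i) n \<le> t \<and> out p x \<omega> i n = b})" for b t
    have wc: "c b m \<le> w b t" if "real m * h \<le> t" for b m t
    proof -
      have "real (\<Sum>k<m. of_bool (clean_block i h b p x k \<omega>)) \<le> w b t"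
        using clean_blocks_le[OF elim(1) h that, of i b p x] by (simp only: w_def of_nat_le_iff)
      then show ?thesis by (simp add: c_def)
    qed
    show ?case
    proof (intro allI impI)
      fix \<epsilon> :: real assume \<epsilon>: "\<epsilon> > 0"
      \<comment> \<open>Five copies of \<open>d\<close> are lost: a lower bound with
        \<open>2 * d\<close> enters doubled, and the bound on the number of plays enters
        once.\<close>
      define d where "d = \<epsilon> / 5"
      have d: "d > 0" using \<epsilon> by (simp add: d_def)
      define N where "N t = nat \<lfloor>t / h\<rfloor>" for t
      have Nlim: "filterlim N at_top at_top"
      proof -
        have "filterlim (\<lambda>t. t / h) at_top at_top"
          using filterlim_tendsto_pos_mult_at_top[OF tendsto_const[of "inverse h"] _ filterlim_ident] h
          by (simp add: divide_inverse mult.commute)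
        then show ?thesis unfolding N_def
          by (intro filterlim_compose[OF filterlim_nat_sequentially] filterlim_compose[OF filterlim_floor_sequentially])
      qed
      \<comment> \<open>One \<open>d\<close> pays for the law of large numbers, the other for the
        unfinished last block, of length at most \<open>h \<le> d * t\<close>.\<close>
      have low: "\<forall>\<^sub>F t in at_top. E * v b (N t) - 2 * d \<le> w b t / t" for b
      proof -
        have "\<forall>\<^sub>F n in sequentially. \<bar>c b n / real n - h * E * v b n\<bar> < d * h"
          using tendstoD[OF cl[of b], of "d * h"] d h by (simp add: dist_real_def)
        then have "\<forall>\<^sub>F t in at_top. \<bar>c b (N t) / real (N t) - h * E * v b (N t)\<bar> < d * h"
          by (rule eventually_compose_filterlim[OF _ Nlim])
        moreover have "\<forall>\<^sub>F t in at_top. h / d \<le> t" by (rule eventually_ge_at_top)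
        moreover have "\<forall>\<^sub>F t in at_top. h \<le> t" by (rule eventually_ge_at_top)
        ultimately show ?thesis
        proof eventually_elim
          case (elim t)
          let ?n = "N t"
          have t: "t > 0" using elim h by linarith
          have "1 \<le> t / h" using elim h by simp
          then have n1: "?n \<ge> 1" unfolding N_def by linarith
          have nt: "real ?n * h \<le> t"
          proof -
            have "real ?n \<le> t / h" using \<open>1 \<le> t / h\<close> unfolding N_def by linarith
            then show ?thesis using h by (simp add: field_simps)
          qed
          have tn: "t - h \<le> real ?n * h"
          proof -
            have "t / h - 1 \<le> real ?n" unfolding N_def by linarith
            then show ?thesis using h by (simp add: field_simps)
          qed
          have "h * E * v b ?n - d * h \<le> c b ?n / real ?n" using elim(1) by linarith
          then have "(h * E * v b ?n - d * h) * real ?n \<le> c b ?n"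
            using n1 by (simp add: pos_le_divide_eq)
          then have "(E * v b ?n - d) * (real ?n * h) \<le> w b t"
            using wc[OF nt, of b] by (simp add: algebra_simps)
          moreover have "(E * v b ?n) * t - h - d * t \<le> (E * v b ?n - d) * (real ?n * h)"
          proof -
            have v01: "0 \<le> v b ?n" "v b ?n \<le> 1" using a01[of ?n] by (auto simp: v_def)
            have Ev: "0 \<le> E * v b ?n" "E * v b ?n \<le> 1" using v01 E mult_mono[of E 1 "v b ?n" 1] by auto
            have "(E * v b ?n) * (t - real ?n * h) \<le> 1 * h" using Ev nt tn by (intro mult_mono) auto
            moreover have "d * (real ?n * h) \<le> d * t" using d nt by (intro mult_left_mono) auto
            ultimately show ?thesis by (simp add: algebra_simps)
          qed
          moreover have "h \<le> d * t" using elim(2) d by (simp add: field_simps)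
          ultimately have "(E * v b ?n - 2 * d) * t \<le> w b t" by (simp add: algebra_simps)
          then show ?case using t by (simp add: pos_le_divide_eq)
        qed
      qed
      have up: "\<forall>\<^sub>F t in at_top. w True t + w False t \<le> (1 + d) * t"
        using play_count_upper[OF pr elim(2)[rule_format, of i] d]
        by eventually_elim (simp add: w_def site_profit_eq(2)[of \<omega> i _ p x, OF pr])
      show "\<forall>\<^sub>F t in at_top. \<bar>site_profit p x \<omega> i t / t - skel_avg h p x \<omega> (\<lambda>y. 2 * p (nbhd y i) - 1) (nat \<lfloor>t / h\<rfloor>)\<bar> \<le> 6 * h + \<epsilon>"
        using low[of True] low[of False] up eventually_ge_at_top[of h]
      proof eventually_elim
        case (elim t)
        have t: "t > 0" using elim(4) h by linarith
        have "1 \<le> t / h" using elim h by simp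
        then have n1: "N t \<ge> 1" unfolding N_def by linarith
        have sk: "skel_avg h p x \<omega> (\<lambda>y. 2 * p (nbhd y i) - 1) (N t) = 2 * a (N t) - 1"
          using n1 by (simp add: skel_avg_def a_def f_def sum_subtractf diff_divide_distrib sum_distrib_left[symmetric])
        have sp: "site_profit p x \<omega> i t / t = w True t / t - w False t / t"
          by (simp only: site_profit_eq(1)[of \<omega> i, OF pr] w_def diff_divide_distrib)
        have up': "w True t / t + w False t / t \<le> 1 + d"
          using elim(3) t by (simp add: pos_divide_le_eq flip: add_divide_distrib)
        have l1: "E * a (N t) - 2 * d \<le> w True t / t" "E * (1 - a (N t)) - 2 * d \<le> w False t / t"
          using elim(1,2) by (simp_all add: v_def)
        have e1: "(1 - E) * a (N t) \<ge> 0" "(1 - E) * (1 - a (N t)) \<ge> 0"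
          using E a01 by (auto intro!: mult_nonneg_nonneg)
        have "(1 - E) * a (N t) + (1 - E) * (1 - a (N t)) = 1 - E" by (simp add: algebra_simps)
        then have "\<bar>w True t / t - w False t / t - (2 * a (N t) - 1)\<bar> \<le> 6 * h + \<epsilon>"
          using up' l1 e1 E(1) h d_def
          unfolding abs_le_iff left_diff_distrib right_diff_distrib mult_1 mult_1_right by linarith
        then show ?case unfolding sp N_def[symmetric] sk .
      qed
    qed
  qed
qed

subsection \<open>Translation invariance\<close>

lemma out_iter_shift:
  "out_iter p (\<lambda>j. x (j + 1)) (\<lambda>j. \<omega> (j + 1)) k i n = out_iter p x \<omega> k (i + 1) n"
proof (induction k arbitrary: i n)
  case (Suc k)
  have "config_before (smp (\<lambda>j. x (j + 1)) (\<lambda>j. \<omega> (j + 1))) (out_iter p (\<lambda>j. x (j + 1)) (\<lambda>j. \<omega> (j + 1)) k) t j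
      = config_before (smp x \<omega>) (out_iter p x \<omega> k) t (j + 1)" for t j
    by (simp add: config_before_smp Suc split: nat.split)
  then show ?case by (simp add: nbhd_def add.commute)
qed simp

lemma X_shift: "X p (\<lambda>j. x (j + 1)) (\<lambda>j. \<omega> (j + 1)) t i = X p x \<omega> t (i + 1)"
  by (simp add: X_eq out_def out_iter_shift split: nat.split)

lemma noise_shift: "distr noise_law noise_law (\<lambda>\<omega> j. \<omega> (j + 1)) = noise_law"
  using distr_PiM_reindex[of UNIV "\<lambda>_. site_law" "\<lambda>j :: int. j + 1" UNIV] site.prob_space_axioms
  by (simp add: noise_law_def inj_on_def restrict_def)

lemma measurable_noise_shift: "(\<lambda>\<omega> j. \<omega> (j + 1)) \<in> measurable noise_law noise_law"
proof -
  have "(\<lambda>\<omega> j. \<omega> (j + 1)) \<in> measurable noise_law (PiM UNIV (\<lambda>_. site_law))"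
    by (rule measurable_abs_UNIV) (rule measurable_noise_component[OF measurable_ident_sets[OF refl]])
  then show ?thesis by (simp only: noise_law_def)
qed

lemma measurable_status: "(\<lambda>y. of_bool (y i) :: real) \<in> borel_measurable config_space"
proof -
  have "Measurable.pred config_space (\<lambda>y. y i)"
    by (rule measurable_config_component[OF measurable_ident_sets[OF refl]])
  then show ?thesis by simp
qed

text \<open>Used for a constant start, where the shift changes nothing and all sites therefore have
  the same expected status.\<close>

lemma avg_status_shift: "avg p t (\<lambda>y. of_bool (y i)) (\<lambda>j. x (j + 1)) = avg p t (\<lambda>y. of_bool (y (i + 1))) x"
proof -
  have "avg p t (\<lambda>y. of_bool (y i)) (\<lambda>j. x (j + 1))
      = (\<integral>\<omega>. of_bool (X p (\<lambda>j. x (j + 1)) \<omega> t i) \<partial>distr noise_law noise_law (\<lambda>\<omega> j. \<omega> (j + 1)))"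
    unfolding noise_shift avg_def ..
  also have "\<dots> = (\<integral>\<omega>. of_bool (X p (\<lambda>j. x (j + 1)) (\<lambda>j. \<omega> (j + 1)) t i) \<partial>noise_law)"
    by (rule integral_distr[OF measurable_noise_shift measurable_FX[OF measurable_status]])
  finally show ?thesis unfolding X_shift avg_def .
qed

subsection \<open>Loss of memory\<close>

lemma avg_diff_le:
  assumes F: "F \<in> borel_measurable config_space" "\<And>y. \<bar>F y\<bar> \<le> B" and osc: "\<And>y. \<bar>F y - c\<bar> \<le> e"
  shows "\<bar>avg p t F x - c\<bar> \<le> e"
proof -
  have "avg p t F x - c = (\<integral>\<omega>. F (X p x \<omega> t) - c \<partial>noise_law)"
    unfolding avg_def using integrable_noise_bounded[OF measurable_FX[OF F(1)], of p x t B] F(2) by simp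
  also have "\<bar>\<dots>\<bar> \<le> e"
    by (rule noise_integral_abs_le) (intro borel_measurable_diff measurable_FX[OF F(1)] borel_measurable_const osc)+
  finally show ?thesis .
qed

text \<open>Running for time \<open>s + t\<close> averages the values of \<open>avg p t F\<close>
  over random states, and these values lie within \<open>\<epsilon> t\<close> of each other. Hence
  the averages form a Cauchy sequence whose limit does not depend on the start.\<close>

lemma oscillation_limit:
  assumes F: "F \<in> borel_measurable config_space" "\<And>y. \<bar>F y\<bar> \<le> B"
    and osc: "\<And>t x y. t \<ge> 0 \<Longrightarrow> \<bar>avg p t F x - avg p t F y\<bar> \<le> \<epsilon> t"
    and lim: "(\<lambda>n. \<epsilon> (real n)) \<longlonglongrightarrow> 0"
  obtains \<mu> where "\<And>t x. t \<ge> 0 \<Longrightarrow> \<bar>avg p t F x - \<mu>\<bar> \<le> \<epsilon> t"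
proof -
  define a where "a n = avg p (real n) F (\<lambda>_. False)" for n
  have near: "\<bar>avg p (s + t) F z - avg p t F y\<bar> \<le> \<epsilon> t" if "s \<ge> 0" "t \<ge> 0" for s t y z
    unfolding avg_add[OF F that]
    by (rule avg_diff_le[OF measurable_avg[OF F(1)] avg_abs_le[OF F]]) (rule osc[OF that(2)])
  have "Cauchy a"
  proof (rule CauchyI)
    fix e :: real assume "e > 0"
    then have "\<forall>\<^sub>F n in sequentially. \<bar>\<epsilon> (real n)\<bar> < e / 2"
      using tendstoD[OF lim, of "e / 2"] by (simp add: dist_real_def)
    then obtain n0 where n0: "\<bar>\<epsilon> (real n0)\<bar> < e / 2" by (auto simp: eventually_sequentially)
    have 1: "\<bar>a m - a n0\<bar> < e / 2" if "m \<ge> n0" for m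
      using near[of "real m - real n0" "real n0" "\<lambda>_. False" "\<lambda>_. False"] that n0 by (simp add: a_def)
    show "\<exists>M. \<forall>m\<ge>M. \<forall>n\<ge>M. norm (a m - a n) < e"
    proof (intro exI allI impI)
      fix m n assume "m \<ge> n0" "n \<ge> n0"
      then show "norm (a m - a n) < e"
        using 1[of m] 1[of n] unfolding real_norm_def abs_less_iff by linarith
    qed
  qed
  then obtain \<mu> where \<mu>: "a \<longlonglongrightarrow> \<mu>" using Cauchy_convergent convergent_def by blast
  show thesis
  proof (rule that)
    fix t :: real and x assume t: "t \<ge> 0"
    have "(\<lambda>n. \<bar>avg p t F x - a n\<bar>) \<longlonglongrightarrow> \<bar>avg p t F x - \<mu>\<bar>"
      by (intro tendsto_intros \<mu>)
    moreover have "\<forall>\<^sub>F n in sequentially. \<bar>avg p t F x - a n\<bar> \<le> \<epsilon> t"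
    proof -
      have "\<forall>\<^sub>F n in sequentially. t \<le> real n"
        using filterlim_real_sequentially by (simp add: filterlim_at_top)
      then show ?thesis
      proof eventually_elim
        case (elim n)
        then show ?case
          using near[of "real n - t" t "\<lambda>_. False" x] t by (simp add: a_def abs_minus_commute)
      qed
    qed
    ultimately show "\<bar>avg p t F x - \<mu>\<bar> \<le> \<epsilon> t"
      by (intro tendsto_upperbound) auto
  qed
qed

text \<open>\<open>m\<close> applications of \<open>skeleton_LLN\<close> replace \<open>F\<close> by
  its semigroup image at time \<open>m h\<close> in the time average, and that function is uniformly
  within \<open>\<epsilon> (real m * h)\<close> of \<open>\<mu>\<close>. No stationary distribution
  has to be constructed.\<close>

lemma skel_avg_limit:
  assumes F: "F \<in> borel_measurable config_space" "\<And>y. \<bar>F y\<bar> \<le> B" and h: "h > 0"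
    and conv: "\<And>t x. t \<ge> 0 \<Longrightarrow> \<bar>avg p t F x - \<mu>\<bar> \<le> \<epsilon> t" and lim: "(\<lambda>m. \<epsilon> (real m * h)) \<longlonglongrightarrow> 0"
  shows "AE \<omega> in noise_law. skel_avg h p x \<omega> F \<longlonglongrightarrow> \<mu>"
proof -
  have "AE \<omega> in noise_law. \<forall>l. (\<lambda>n. (\<Sum>k<n. avg p (real l * h) F (X p x \<omega> (real k * h))
      - avg p h (avg p (real l * h) F) (X p x \<omega> (real k * h))) / real n) \<longlonglongrightarrow> 0"
    unfolding AE_all_countable
    by (intro allI skeleton_LLN[where B=B] measurable_avg avg_abs_le F) (use h in simp)
  then show ?thesis
    using AE_good
  proof eventually_elim
    case (elim \<omega>)
    define u where "u l k = avg p (real l * h) F (X p x \<omega> (real k * h))" for l k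
    have u0: "u 0 k = F (X p x \<omega> (real k * h))" for k
    proof -
      have "(\<integral>\<omega>'. F (X p y \<omega>' 0) \<partial>noise_law) = (\<integral>\<omega>'. F y \<partial>noise_law)" for y
        by (rule integral_cong_AE[OF measurable_FX[OF F(1)]])
          (use AE_good in \<open>auto elim!: eventually_mono simp: X_0\<close>)
      then show ?thesis by (simp add: u_def avg_def)
    qed
    have step: "(\<lambda>n. (\<Sum>k<n. u l k - u (Suc l) k) / real n) \<longlonglongrightarrow> 0" for l
    proof -
      have "avg p h (avg p (real l * h) F) y = avg p (real (Suc l) * h) F y" for y
        using avg_add[OF F, of h "real l * h" p y] h by (simp add: distrib_right add.commute)
      with elim(1)[rule_format, of l] show ?thesis by (simp add: u_def)
    qed
    have tele: "(\<lambda>n. (\<Sum>k<n. u 0 k - u m k) / real n) \<longlonglongrightarrow> 0" for m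
    proof (induction m)
      case (Suc m)
      have "(\<Sum>k<n. u 0 k - u (Suc m) k) / real n = (\<Sum>k<n. u 0 k - u m k) / real n + (\<Sum>k<n. u m k - u (Suc m) k) / real n" for n
        by (simp add: sum_subtractf flip: add_divide_distrib)
      with tendsto_add[OF Suc step[of m]] show ?case by simp
    qed simp
    show "skel_avg h p x \<omega> F \<longlonglongrightarrow> \<mu>"
    proof (rule LIMSEQ_I)
      fix e :: real assume e: "e > 0"
      then have "\<forall>\<^sub>F m in sequentially. \<bar>\<epsilon> (real m * h)\<bar> < e / 2"
        using tendstoD[OF lim, of "e / 2"] by (simp add: dist_real_def)
      then obtain m where m: "\<bar>\<epsilon> (real m * h)\<bar> < e / 2" by (auto simp: eventually_sequentially)
      have "\<forall>\<^sub>F n in sequentially. \<bar>(\<Sum>k<n. u 0 k - u m k) / real n\<bar> < e / 2"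
        using tendstoD[OF tele[of m], of "e / 2"] e by (simp add: dist_real_def)
      then have "\<forall>\<^sub>F n in sequentially. norm (skel_avg h p x \<omega> F n - \<mu>) < e"
        using eventually_gt_at_top[of 0]
      proof eventually_elim
        case (elim n)
        have "\<bar>(\<Sum>k<n. u m k - \<mu>)\<bar> \<le> (\<Sum>k<n. \<bar>u m k - \<mu>\<bar>)" by (rule sum_abs)
        also have "\<dots> \<le> (\<Sum>k<n. e / 2)"
        proof (rule sum_mono)
          fix k
          have "\<bar>u m k - \<mu>\<bar> \<le> \<epsilon> (real m * h)" unfolding u_def by (rule conv) (use h in simp)
          with m show "\<bar>u m k - \<mu>\<bar> \<le> e / 2" by linarith
        qed
        finally have "\<bar>(\<Sum>k<n. u m k - \<mu>) / real n\<bar> \<le> e / 2"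
          using elim(2) by (simp add: divide_le_eq mult.commute)
        moreover have "skel_avg h p x \<omega> F n - \<mu> = (\<Sum>k<n. u 0 k - u m k) / real n + (\<Sum>k<n. u m k - \<mu>) / real n"
          using elim(2) by (simp add: skel_avg_def u0 sum_subtractf diff_divide_distrib)
        ultimately show ?case using elim(1) unfolding real_norm_def by linarith
      qed
      then show "\<exists>no. \<forall>n\<ge>no. norm (skel_avg h p x \<omega> F n - \<mu>) < e" by (simp add: eventually_sequentially)
    qed
  qed
qed

lemma prob_mark_xor:
  assumes "0 \<le> a" "a \<le> 1" "0 \<le> b" "b \<le> 1"
  shows "measure mark_law {u. (u < a) \<noteq> (u < b)} = \<bar>a - b\<bar>"
proof -
  have *: "measure mark_law {u. (u < a) \<noteq> (u < b)} = b - a" if "0 \<le> a" "a \<le> b" "b \<le> 1" for a b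
  proof -
    have "{u. (u < a) \<noteq> (u < b)} = {..<b} - {..<a}" using that by auto
    moreover have "measure mark_law ({..<b} - {..<a}) = measure mark_law {..<b} - measure mark_law {..<a}"
      by (rule unif.finite_measure_Diff) (use that in auto)
    ultimately show ?thesis using prob_mark_less[of a] prob_mark_less[of b] that by simp
  qed
  show ?thesis
  proof (cases "a \<le> b")
    case False
    have "{u. (u < a) \<noteq> (u < b)} = {u. (u < b) \<noteq> (u < a)}" by auto
    with *[of b a] False assms show ?thesis by simp
  qed (use *[of a b] assms in simp)
qed

lemma skel_avg_affine: "n > 0 \<Longrightarrow> skel_avg h p x \<omega> (\<lambda>y. 2 * F y - 1) n = 2 * skel_avg h p x \<omega> F n - 1"
  by (simp add: skel_avg_def sum_subtractf diff_divide_distrib sum_distrib_left[symmetric])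

text \<open>At a fixed mesh \<open>h\<close>, profit and skeleton average may stay apart by
  \<open>6 * h\<close> for each player, however large \<open>t\<close> is. The meshes
  \<open>hs m\<close> remove this error; being countably many, they share one null set.\<close>

lemma profit_limitI:
  assumes p: "\<And>y i. 0 \<le> p (nbhd y i)" "\<And>y i. p (nbhd y i) \<le> 1" and A: "finite A"
    and hs: "\<And>m. hs m > 0" "hs \<longlonglongrightarrow> 0"
    and \<delta>: "\<delta> \<longlonglongrightarrow> 0"
    and skel: "\<And>m. AE \<omega> in noise_law. \<forall>\<epsilon>>0. \<forall>\<^sub>F n in sequentially.
      \<bar>(\<Sum>i\<in>A. skel_avg (hs m) p x \<omega> (\<lambda>y. 2 * p (nbhd y i) - 1) n) - L\<bar> \<le> \<delta> m + \<epsilon>"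
  shows "AE \<omega> in noise_law. ((\<lambda>t. (\<Sum>i\<in>A. site_profit p x \<omega> i t) / t) \<longlongrightarrow> L) at_top"
proof -
  have 1: "AE \<omega> in noise_law. \<forall>m i. \<forall>\<epsilon>>0. \<forall>\<^sub>F t in at_top.
    \<bar>site_profit p x \<omega> i t / t - skel_avg (hs m) p x \<omega> (\<lambda>y. 2 * p (nbhd y i) - 1) (nat \<lfloor>t / hs m\<rfloor>)\<bar>
      \<le> 6 * hs m + \<epsilon>"
    unfolding AE_all_countable by (intro allI site_profit_avg p hs)
  have 2: "AE \<omega> in noise_law. \<forall>m. \<forall>\<epsilon>>0. \<forall>\<^sub>F n in sequentially.
      \<bar>(\<Sum>i\<in>A. skel_avg (hs m) p x \<omega> (\<lambda>y. 2 * p (nbhd y i) - 1) n) - L\<bar> \<le> \<delta> m + \<epsilon>"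
    unfolding AE_all_countable by (intro allI skel)
  from 1 2 show ?thesis
  proof eventually_elim
    case (elim \<omega>)
    show ?case
    proof (rule tendstoI)
      fix e :: real assume e: "e > 0"
      define a where "a = real (card A)"
      have "(\<lambda>m. a * (6 * hs m) + \<delta> m) \<longlonglongrightarrow> a * (6 * 0) + 0"
        by (intro tendsto_intros \<delta> hs)
      then have "\<forall>\<^sub>F m in sequentially. a * (6 * hs m) + \<delta> m < e / 2"
        by (rule order_tendstoD) (use e in simp)
      then obtain m where m: "a * (6 * hs m) + \<delta> m < e / 2" by (auto simp: eventually_sequentially)
      define h where "h = hs m"
      have h: "h > 0" by (simp add: h_def hs)
      define b where "b = a + 1"
      define \<eta> where "\<eta> = (e / 4) / b"
      have a: "a \<ge> 0" by (simp add: a_def)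
      have b: "b > 0" using a by (simp add: b_def)
      have \<eta>: "\<eta> > 0" using e b by (simp add: \<eta>_def)
      have a\<eta>: "a * \<eta> + \<eta> = e / 4"
      proof -
        have "b * \<eta> = e / 4" using b by (simp add: \<eta>_def)
        then show ?thesis by (simp only: b_def distrib_right mult_1)
      qed
      have "filterlim (\<lambda>t. t / h) at_top at_top"
        using filterlim_tendsto_pos_mult_at_top[OF tendsto_const[of "inverse h"] _ filterlim_ident] h
        by (simp add: divide_inverse mult.commute)
      then have N: "filterlim (\<lambda>t. nat \<lfloor>t / h\<rfloor>) at_top at_top"
        by (intro filterlim_compose[OF filterlim_nat_sequentially] filterlim_compose[OF filterlim_floor_sequentially])
      have "\<forall>\<^sub>F t in at_top. \<bar>(\<Sum>i\<in>A. skel_avg h p x \<omega> (\<lambda>y. 2 * p (nbhd y i) - 1) (nat \<lfloor>t / h\<rfloor>)) - L\<bar> \<le> \<delta> m + \<eta>"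
        by (rule eventually_compose_filterlim[OF _ N]) (use elim(2) \<eta> in \<open>simp add: h_def\<close>)
      moreover have "\<forall>\<^sub>F t in at_top. \<forall>i\<in>A.
          \<bar>site_profit p x \<omega> i t / t - skel_avg h p x \<omega> (\<lambda>y. 2 * p (nbhd y i) - 1) (nat \<lfloor>t / h\<rfloor>)\<bar> \<le> 6 * h + \<eta>"
        using elim(1)[rule_format, OF \<eta>, of _ m, folded h_def] by (intro eventually_ball_finite A ballI)
      ultimately show "\<forall>\<^sub>F t in at_top. dist ((\<Sum>i\<in>A. site_profit p x \<omega> i t) / t) L < e"
      proof eventually_elim
        case (elim t)
        define s where "s i = skel_avg h p x \<omega> (\<lambda>y. 2 * p (nbhd y i) - 1) (nat \<lfloor>t / h\<rfloor>)" for i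
        have "\<bar>(\<Sum>i\<in>A. site_profit p x \<omega> i t) / t - (\<Sum>i\<in>A. s i)\<bar> = \<bar>\<Sum>i\<in>A. site_profit p x \<omega> i t / t - s i\<bar>"
          by (simp add: sum_subtractf sum_divide_distrib)
        also have "\<dots> \<le> (\<Sum>i\<in>A. \<bar>site_profit p x \<omega> i t / t - s i\<bar>)" by (rule sum_abs)
        also have "\<dots> \<le> (\<Sum>i\<in>A. 6 * h + \<eta>)" using elim(2) by (intro sum_mono) (simp add: s_def)
        also have "\<dots> = a * (6 * h) + a * \<eta>" by (simp add: a_def distrib_left)
        finally show ?case
          using elim(1) m a\<eta> e unfolding dist_real_def h_def[symmetric] s_def by linarith
      qed
    qed
  qed
qed

subsection \<open>Game C\<close>

lemma nbhd_eq: "nbhd y i = (if y (i - 1) then (if y (i + 1) then 3 else 2) else (if y (i + 1) then 1 else 0))"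
  by (simp add: nbhd_def)

context
  fixes q :: game and r :: real
  assumes q: "q 0 = 3 / 4" "q 1 = r" "q 2 = r" "q 3 = 1 / 4" and r: "1 / 2 < r" "r < 3 / 4"
begin

private lemma q_nbhd: "q (nbhd y i) = (if y (i - 1) then (if y (i + 1) then 1 / 4 else r) else (if y (i + 1) then r else 3 / 4))"
  using q by (simp add: nbhd_eq)

private lemma q_bounds: "1 / 4 \<le> q (nbhd y i)" "q (nbhd y i) \<le> 3 / 4"
  using r by (simp_all add: q_nbhd)

private lemma q_bounds01: "0 \<le> q (nbhd y i)" "q (nbhd y i) \<le> 1"
  using q_bounds[of y i] by linarith+

text \<open>Changing one neighbour changes the winning probability by \<open>r - 1 / 4\<close> or by
  \<open>3 / 4 - r\<close>, and the first is larger for \<open>r > 1 / 2\<close>.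
  \<open>\<kappa>\<close> is twice this, one share for each neighbour, and \<open>r < 3 / 4\<close>
  makes it less than 1.\<close>

private definition "\<kappa> = 2 * r - 1 / 2"

private lemma \<kappa>: "1 / 2 < \<kappa>" "\<kappa> < 1"
  using r by (simp_all add: \<kappa>_def)

private lemma q_Lipschitz:
  "\<bar>q (nbhd y i) - q (nbhd z i)\<bar> \<le> \<kappa> / 2 * (of_bool (y (i - 1) \<noteq> z (i - 1)) + of_bool (y (i + 1) \<noteq> z (i + 1)))"
  using r by (cases "y (i - 1)"; cases "y (i + 1)"; cases "z (i - 1)"; cases "z (i + 1)") (simp_all add: q_nbhd \<kappa>_def abs_le_iff)

private lemma measurable_qf: "(\<lambda>y. q (nbhd y i)) \<in> borel_measurable config_space"
  by (rule measurable_game_nbhd) (rule measurable_config_component[OF measurable_ident_sets[OF refl]])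

definition discr :: "int \<Rightarrow> real \<Rightarrow> config \<Rightarrow> config \<Rightarrow> real" where
  "discr i t x y = (\<integral>\<omega>. of_bool (X q x \<omega> t i \<noteq> X q y \<omega> t i) \<partial>noise_law)"

private lemma pred_discr:
  assumes "x \<in> measurable M config_space" "y \<in> measurable M config_space" "\<omega> \<in> measurable M noise_law"
  shows "Measurable.pred M (\<lambda>z. X q (x z) (\<omega> z) t i \<noteq> X q (y z) (\<omega> z) t i)"
proof -
  note [measurable] = pred_X[OF assms(1,3)] pred_X[OF assms(2,3)]
  show ?thesis by measurable
qed

private lemma measurable_discr1: "(\<lambda>\<omega>. of_bool (X q x \<omega> t i \<noteq> X q y \<omega> t i) :: real) \<in> borel_measurable noise_law"
proof -
  have "Measurable.pred noise_law (\<lambda>\<omega>. X q x \<omega> t i \<noteq> X q y \<omega> t i)" by (rule pred_discr) simp_all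
  then show ?thesis by simp
qed

text \<open>When player \<open>i\<close> plays, an old disagreement is erased, and a new one arises
  if the common mark falls between the two winning probabilities. The constant is
  \<open>2 * 3^2\<close>, for a window of three players.\<close>

private lemma discr_block:
  assumes h: "h \<ge> 0"
  shows "discr i h x y \<le> (1 - h) * of_bool (x i \<noteq> y i)
    + h * (\<kappa> / 2 * (of_bool (x (i - 1) \<noteq> y (i - 1)) + of_bool (x (i + 1) \<noteq> y (i + 1)))) + 18 * h^2"
proof -
  let ?K = "{i - 1, i, i + 1}" and ?c = "of_bool (x i \<noteq> y i) :: real"
  define B where "B j = (if j = i then {u. (u < q (nbhd x i)) \<noteq> (u < q (nbhd y i))} else {})" for j
  define a where "a j = (if j = i then 0 else ?c)" for j
  define b where "b j = (if j = i then 1 else ?c)" for j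
  have B: "B j \<in> sets borel" for j unfolding B_def by simp
  have "\<bar>discr i h x y - (?c + h * (\<Sum>j\<in>?K. (a j * (1 - measure mark_law (B j)) + b j * measure mark_law (B j)) - ?c))\<bar>
      \<le> 2 * 1 * (real (card ?K) * h)^2"
    unfolding discr_def
  proof (rule block_expansion[OF h])
    show "of_bool (X q x \<omega> h i \<noteq> X q y \<omega> h i) = (if snd (\<omega> j 0) \<in> B j then b j else a j)"
      if "good \<omega>" "j \<in> ?K" "single ?K j h \<omega>" for \<omega> j
      using X_single[OF that(1), of ?K i h q] X_single_other[OF that(3), of i q] that(3)
      by (auto simp: B_def a_def b_def)
  qed (auto simp: X_quiet measurable_discr1 B a_def b_def)
  moreover have "(\<Sum>j\<in>?K. (a j * (1 - measure mark_law (B j)) + b j * measure mark_law (B j)) - ?c)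
      = \<bar>q (nbhd x i) - q (nbhd y i)\<bar> - ?c"
    using prob_mark_xor[OF q_bounds01 q_bounds01, of x i y i] by (simp add: B_def a_def b_def)
  moreover have "real (card ?K) = 3" by simp
  ultimately have "discr i h x y \<le> ?c + h * (\<bar>q (nbhd x i) - q (nbhd y i)\<bar> - ?c) + 18 * h^2"
    by (simp only: abs_le_iff) (simp add: power_mult_distrib)
  moreover have "h * \<bar>q (nbhd x i) - q (nbhd y i)\<bar>
      \<le> h * (\<kappa> / 2 * (of_bool (x (i - 1) \<noteq> y (i - 1)) + of_bool (x (i + 1) \<noteq> y (i + 1))))"
    by (rule mult_left_mono[OF q_Lipschitz h])
  ultimately show ?thesis by (simp only: left_diff_distrib right_diff_distrib mult_1)
qed

private lemma discr_step:
  assumes h: "h \<ge> 0" and t: "t \<ge> 0"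
  shows "discr i (t + h) x y \<le> (1 - h) * discr i t x y + h * (\<kappa> / 2 * (discr (i - 1) t x y + discr (i + 1) t x y)) + 18 * h^2"
proof -
  let ?d = "\<lambda>j \<omega>. of_bool (X q x \<omega> t j \<noteq> X q y \<omega> t j) :: real"
  have m: "(\<lambda>z. of_bool (X q (X q x (fst z) t) (snd z) h i \<noteq> X q (X q y (fst z) t) (snd z) h i) :: real)
      \<in> borel_measurable (noise_law \<Otimes>\<^sub>M noise_law)"
  proof -
    have "Measurable.pred (noise_law \<Otimes>\<^sub>M noise_law) (\<lambda>z. X q (X q x (fst z) t) (snd z) h i \<noteq> X q (X q y (fst z) t) (snd z) h i)"
      by (intro pred_discr measurable_compose[OF measurable_fst measurable_X1] measurable_snd)
    then show ?thesis by simp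
  qed
  have "discr i (t + h) x y = (\<integral>\<omega>. discr i h (X q x \<omega> t) (X q y \<omega> t) \<partial>noise_law)"
    unfolding discr_def
    by (rule integral_glue[OF t measurable_discr1 _ m, where B=1]) (use h t in \<open>simp_all add: X_glue_ge3\<close>)
  also have "\<dots> \<le> (\<integral>\<omega>. (1 - h) * ?d i \<omega> + h * (\<kappa> / 2 * (?d (i - 1) \<omega> + ?d (i + 1) \<omega>)) + 18 * h^2 \<partial>noise_law)"
  proof (rule integral_mono)
    show "integrable noise_law (\<lambda>\<omega>. discr i h (X q x \<omega> t) (X q y \<omega> t))"
    proof (rule integrable_noise_bounded[where B=1])
      show "(\<lambda>\<omega>. discr i h (X q x \<omega> t) (X q y \<omega> t)) \<in> borel_measurable noise_law"
        unfolding discr_def by (rule noise.borel_measurable_lebesgue_integral) (use m in \<open>simp add: split_beta'\<close>)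
      show "\<bar>discr i h (X q x \<omega> t) (X q y \<omega> t)\<bar> \<le> 1" for \<omega>
        unfolding discr_def by (rule noise_integral_abs_le[OF measurable_discr1]) simp
    qed
    have "integrable noise_law (?d j)" for j by (rule integrable_noise_bounded[OF measurable_discr1, of _ _ _ _ 1]) simp
    then show "integrable noise_law (\<lambda>\<omega>. (1 - h) * ?d i \<omega> + h * (\<kappa> / 2 * (?d (i - 1) \<omega> + ?d (i + 1) \<omega>)) + 18 * h^2)"
      by (intro Bochner_Integration.integrable_add integrable_mult_right integrable_noise_bounded[where f="\<lambda>_. 18 * h^2" and B="18 * h^2"]) simp_all
  qed (rule discr_block[OF h])
  also have "\<dots> = (1 - h) * discr i t x y + h * (\<kappa> / 2 * (discr (i - 1) t x y + discr (i + 1) t x y)) + 18 * h^2"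
  proof -
    have "integrable noise_law (?d j)" for j by (rule integrable_noise_bounded[OF measurable_discr1, of _ _ _ _ 1]) simp
    then show ?thesis unfolding discr_def by simp
  qed
  finally show ?thesis .
qed

text \<open>The bound is proved for all sites together, since the disagreement at \<open>i\<close>
  is fed by both neighbours. They feed it with total weight \<open>\<kappa>\<close> against a loss
  at rate 1, hence the decay at rate \<open>1 - \<kappa>\<close> once the mesh \<open>t / n\<close>
  tends to zero.\<close>

private lemma discr_decay:
  assumes t: "t \<ge> 0"
  shows "discr i t x y \<le> exp (- (1 - \<kappa>) * t)"
proof -
  define c where "c = 1 - \<kappa>"
  have c: "0 < c" "c < 1 / 2" using \<kappa> by (simp_all add: c_def)
  \<comment> \<open>\<open>18 * h / c\<close> is the fixed point of the map that takes
    \<open>\<beta>\<close> to \<open>(1 - c * h) * \<beta> + 18 * h^2\<close>, so the block errors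
    do not accumulate.\<close>
  have bound: "discr i (real k * h) x y \<le> (1 - c * h) ^ k + 18 * h / c" if h: "0 \<le> h" "h \<le> 1" for h k i
  proof (induction k arbitrary: i)
    case 0
    have "discr i 0 x y \<le> 1"
      using noise_integral_abs_le[OF measurable_discr1[of x 0 i y], of 1] by (simp add: discr_def abs_le_iff)
    moreover have "18 * h / c \<ge> 0" using h c by simp
    ultimately show ?case by simp
  next
    case (Suc k)
    let ?\<beta> = "(1 - c * h) ^ k + 18 * h / c"
    have "discr i (real k * h + h) x y \<le> (1 - h) * discr i (real k * h) x y
        + h * (\<kappa> / 2 * (discr (i - 1) (real k * h) x y + discr (i + 1) (real k * h) x y)) + 18 * h^2"
      by (rule discr_step) (use h in auto)
    also have "\<dots> \<le> (1 - h) * ?\<beta> + h * (\<kappa> / 2 * (?\<beta> + ?\<beta>)) + 18 * h^2"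
      using Suc.IH \<kappa> h by (intro add_mono mult_left_mono order_refl) auto
    also have "\<dots> = (1 - c * h) * ?\<beta> + 18 * h^2"
    proof -
      have "(1 - h) * b + h * (\<kappa> / 2 * (b + b)) = (1 - c * h) * b" for b by (simp add: c_def algebra_simps)
      then show ?thesis by (simp only:)
    qed
    also have "\<dots> = (1 - c * h) ^ Suc k + 18 * h / c"
      using c by (simp add: field_simps power2_eq_square)
    finally show ?case by (simp add: distrib_right add.commute)
  qed
  have "\<forall>\<^sub>F n in sequentially. discr i t x y \<le> exp (- c * t) + 18 * t / c / real n"
  proof -
    have "\<forall>\<^sub>F n in sequentially. max t 1 \<le> real n"
      using filterlim_real_sequentially unfolding filterlim_at_top by blast
    then show ?thesis
    proof eventually_elim
      case (elim n)
      define h where "h = t / real n"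
      have n: "real n > 0" "t \<le> real n" using elim by auto
      have h: "0 \<le> h" "h \<le> 1" using t n by (simp_all add: h_def)
      have ch: "0 \<le> 1 - c * h" using c h mult_mono[of c 1 h 1] by simp
      have "(1 - c * h) ^ n \<le> exp (- (c * h)) ^ n"
        using exp_ge_add_one_self[of "- (c * h)"] ch by (intro power_mono) simp_all
      also have "\<dots> = exp (- c * t)"
        using n by (simp add: exp_of_nat_mult[symmetric] h_def)
      finally have "(1 - c * h) ^ n \<le> exp (- c * t)" .
      moreover have "discr i t x y \<le> (1 - c * h) ^ n + 18 * h / c"
        using bound[OF h, of i n] n by (simp add: h_def)
      ultimately show ?case by (simp add: h_def ac_simps)
    qed
  qed
  moreover have "(\<lambda>n. exp (- c * t) + 18 * t / c / real n) \<longlonglongrightarrow> exp (- c * t) + 0"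
    by (intro tendsto_intros lim_const_over_n)
  ultimately show ?thesis
    unfolding c_def by (intro tendsto_lowerbound[where F=sequentially]) auto
qed

private definition "rate = 1 - \<kappa>"

private lemma rate: "rate > 0" using \<kappa> by (simp add: rate_def)

private lemma exp_rate_lim: "h > 0 \<Longrightarrow> (\<lambda>n. exp (- rate * (real n * h))) \<longlonglongrightarrow> 0"
proof -
  assume h: "h > 0"
  have "(\<lambda>n. exp (- rate * h) ^ n) \<longlonglongrightarrow> 0"
    using rate h by (intro LIMSEQ_realpow_zero) simp_all
  moreover have "exp (- rate * h) ^ n = exp (- rate * (real n * h))" for n
    by (simp add: exp_of_nat_mult[symmetric] ac_simps)
  ultimately show ?thesis by simp
qed

private lemma discr_le: "t \<ge> 0 \<Longrightarrow> discr i t x y \<le> exp (- rate * t)"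
  unfolding rate_def by (rule discr_decay)

text \<open>A function of two sites inherits the decay of disagreement through its Lipschitz
  constants there.\<close>

private lemma avg_osc:
  assumes F: "F \<in> borel_measurable config_space" "\<And>y. \<bar>F y\<bar> \<le> B" and t: "t \<ge> 0"
    and L: "\<And>y z. \<bar>F y - F z\<bar> \<le> a * of_bool (y i \<noteq> z i) + b * of_bool (y j \<noteq> z j)" and ab: "0 \<le> a" "0 \<le> b"
  shows "\<bar>avg q t F x - avg q t F y\<bar> \<le> (a + b) * exp (- rate * t)"
proof -
  let ?d = "\<lambda>j \<omega>. of_bool (X q x \<omega> t j \<noteq> X q y \<omega> t j) :: real"
  have i: "integrable noise_law (?d j)" for j by (rule integrable_noise_bounded[OF measurable_discr1, of _ _ _ _ 1]) simp
  have iF: "integrable noise_law (\<lambda>\<omega>. F (X q x \<omega> t))" for x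
    by (rule integrable_noise_bounded[OF measurable_FX[OF F(1)] F(2)])
  have "\<bar>avg q t F x - avg q t F y\<bar> = \<bar>\<integral>\<omega>. F (X q x \<omega> t) - F (X q y \<omega> t) \<partial>noise_law\<bar>"
    unfolding avg_def using iF by simp
  also have "\<dots> \<le> (\<integral>\<omega>. \<bar>F (X q x \<omega> t) - F (X q y \<omega> t)\<bar> \<partial>noise_law)" by (rule integral_abs_bound)
  also have "\<dots> \<le> (\<integral>\<omega>. a * ?d i \<omega> + b * ?d j \<omega> \<partial>noise_law)"
    by (intro integral_mono integrable_abs Bochner_Integration.integrable_diff Bochner_Integration.integrable_add
        integrable_mult_right i iF L)
  also have "\<dots> = a * discr i t x y + b * discr j t x y"
    unfolding discr_def using i by simp
  also have "\<dots> \<le> a * exp (- rate * t) + b * exp (- rate * t)"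
    by (intro add_mono mult_left_mono discr_le t ab)
  finally show ?thesis by (simp only: distrib_right)
qed

private lemma avg_expansion:
  assumes h: "h \<ge> 0" and F: "F \<in> borel_measurable config_space" "\<And>y. \<bar>F y\<bar> \<le> 1"
    and K: "finite K" and c0: "\<And>\<omega>. good \<omega> \<Longrightarrow> quiet K h \<omega> \<Longrightarrow> F (X q x \<omega> h) = F x"
    and c1: "\<And>\<omega> i. good \<omega> \<Longrightarrow> i \<in> K \<Longrightarrow> single K i h \<omega> \<Longrightarrow>
      F (X q x \<omega> h) = (if snd (\<omega> i 0) < q (nbhd x i) then b i else a i)"
    and ab: "\<And>i. i \<in> K \<Longrightarrow> \<bar>a i\<bar> \<le> 1" "\<And>i. i \<in> K \<Longrightarrow> \<bar>b i\<bar> \<le> 1"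
  shows "\<bar>avg q h F x - (F x + h * (\<Sum>i\<in>K. a i * (1 - q (nbhd x i)) + b i * q (nbhd x i) - F x))\<bar> \<le> 2 * (real (card K) * h)^2"
proof -
  have "\<bar>avg q h F x - (F x + h * (\<Sum>i\<in>K. (a i * (1 - measure mark_law {..<q (nbhd x i)})
      + b i * measure mark_law {..<q (nbhd x i)}) - F x))\<bar> \<le> 2 * 1 * (real (card K) * h)^2"
    unfolding avg_def
    by (rule block_expansion[OF h K measurable_FX[OF F(1)]]) (use F c0 c1 ab in auto)
  then show ?thesis by (simp only: prob_mark_less q_bounds01 mult_1_right)
qed

private lemma status_block:
  assumes h: "h \<ge> 0"
  shows "\<bar>avg q h (\<lambda>y. of_bool (y i)) x - ((1 - h) * of_bool (x i) + h * q (nbhd x i))\<bar> \<le> 18 * h^2"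
proof -
  let ?K = "{i - 1, i, i + 1}"
  define a where "a j = (if j = i then 0 else of_bool (x i) :: real)" for j
  define b where "b j = (if j = i then 1 else of_bool (x i) :: real)" for j
  have "\<bar>avg q h (\<lambda>y. of_bool (y i)) x - (of_bool (x i) + h * (\<Sum>j\<in>?K. a j * (1 - q (nbhd x j)) + b j * q (nbhd x j) - of_bool (x i)))\<bar>
      \<le> 2 * (real (card ?K) * h)^2"
  proof (rule avg_expansion[OF h measurable_status])
    show "of_bool (X q x \<omega> h i) = (if snd (\<omega> j 0) < q (nbhd x j) then b j else a j)"
      if "good \<omega>" "j \<in> ?K" "single ?K j h \<omega>" for \<omega> j
      using X_single[OF that(1), of ?K i h q] X_single_other[OF that(3), of i q] that(3)
      by (auto simp: a_def b_def)
  qed (auto simp: X_quiet a_def b_def)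
  then show ?thesis by (simp add: a_def b_def power_mult_distrib algebra_simps)
qed

text \<open>A play of \<open>i - 1\<close> or \<open>i + 1\<close> leaves the two different with
  probability at least 1/4 whatever the state, because all winning probabilities lie in [1/4, 3/4];
  an existing difference is lost at rate at most 2. The window must contain the neighbours of both
  players, which gives \<open>50 = 2 * 5^2\<close>.\<close>

private lemma differ_block:
  assumes h: "h \<ge> 0"
  shows "avg q h (\<lambda>y. of_bool (y (i - 1) \<noteq> y (i + 1))) x \<ge> (1 - 2 * h) * of_bool (x (i - 1) \<noteq> x (i + 1)) + h / 2 - 50 * h^2"
proof -
  let ?K = "{i - 2, i - 1, i, i + 1, i + 2}"
  let ?F = "\<lambda>y. of_bool (y (i - 1) \<noteq> y (i + 1)) :: real"
  define a where "a j = (if j = i - 1 then of_bool (x (i + 1)) else if j = i + 1 then of_bool (x (i - 1)) else ?F x)" for j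
  define b where "b j = (if j = i - 1 then of_bool (\<not> x (i + 1)) else if j = i + 1 then of_bool (\<not> x (i - 1)) else ?F x)" for j
  have m: "?F \<in> borel_measurable config_space"
  proof -
    note [measurable] = measurable_config_component[OF measurable_ident_sets[OF refl]]
    have "Measurable.pred config_space (\<lambda>y. y (i - 1) \<noteq> y (i + 1))" by measurable
    then show ?thesis by simp
  qed
  have "\<bar>avg q h ?F x - (?F x + h * (\<Sum>j\<in>?K. a j * (1 - q (nbhd x j)) + b j * q (nbhd x j) - ?F x))\<bar>
      \<le> 2 * (real (card ?K) * h)^2"
  proof (rule avg_expansion[OF h m])
    show "?F (X q x \<omega> h) = (if snd (\<omega> j 0) < q (nbhd x j) then b j else a j)"
      if "good \<omega>" "j \<in> ?K" "single ?K j h \<omega>" for \<omega> j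
    proof -
      consider "j = i - 1" | "j = i + 1" | "j \<noteq> i - 1" "j \<noteq> i + 1" by blast
      then show ?thesis
      proof cases
        case 1
        have "X q x \<omega> h j \<longleftrightarrow> snd (\<omega> j 0) < q (nbhd x j)"
          by (rule X_single[OF that(1,3)]) (simp_all add: 1)
        moreover have "X q x \<omega> h (i + 1) = x (i + 1)" by (rule X_single_other[OF that(3)]) (simp_all add: 1)
        ultimately show ?thesis using 1 by (simp add: a_def b_def)
      next
        case 2
        have "X q x \<omega> h j \<longleftrightarrow> snd (\<omega> j 0) < q (nbhd x j)"
          by (rule X_single[OF that(1,3)]) (simp_all add: 2)
        moreover have "X q x \<omega> h (i - 1) = x (i - 1)" by (rule X_single_other[OF that(3)]) (simp_all add: 2)
        ultimately show ?thesis using 2 by (auto simp: a_def b_def)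
      next
        case 3
        then have "X q x \<omega> h (i + 1) = x (i + 1)" "X q x \<omega> h (i - 1) = x (i - 1)"
          by (auto intro!: X_single_other[OF that(3)])
        with 3 show ?thesis by (simp add: a_def b_def)
      qed
    qed
  qed (auto simp: X_quiet a_def b_def)
  moreover have "(\<Sum>j\<in>?K. a j * (1 - q (nbhd x j)) + b j * q (nbhd x j) - ?F x)
      = a (i - 1) * (1 - q (nbhd x (i - 1))) + b (i - 1) * q (nbhd x (i - 1)) - ?F x
      + (a (i + 1) * (1 - q (nbhd x (i + 1))) + b (i + 1) * q (nbhd x (i + 1)) - ?F x)"
    by (simp add: a_def b_def algebra_simps)
  moreover have "a j * (1 - q (nbhd x j)) + b j * q (nbhd x j) \<ge> 1 / 4" if "j = i - 1 \<or> j = i + 1" for j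
    using that q_bounds[of x j] by (auto simp: a_def b_def)
  then have "1 / 4 \<le> a (i - 1) * (1 - q (nbhd x (i - 1))) + b (i - 1) * q (nbhd x (i - 1))"
    "1 / 4 \<le> a (i + 1) * (1 - q (nbhd x (i + 1))) + b (i + 1) * q (nbhd x (i + 1))" by auto
  then have "h * (1 / 2 - 2 * ?F x) \<le> h * (a (i - 1) * (1 - q (nbhd x (i - 1))) + b (i - 1) * q (nbhd x (i - 1)) - ?F x
      + (a (i + 1) * (1 - q (nbhd x (i + 1))) + b (i + 1) * q (nbhd x (i + 1)) - ?F x))"
    using h by (intro mult_left_mono) auto
  moreover have "real (card ?K) = 5" by simp
  ultimately have "?F x + h * (1 / 2 - 2 * ?F x) - 50 * h^2 \<le> avg q h ?F x"
    by (simp only: abs_le_iff power_mult_distrib) simp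
  then show ?thesis by (simp add: algebra_simps)
qed

private lemma avg_const_bound_lower:
  assumes F: "F \<in> borel_measurable config_space" "\<And>y. \<bar>F y\<bar> \<le> B" and le: "\<And>y. e \<le> F y"
  shows "e \<le> avg q t F x"
proof -
  have "(\<integral>\<omega>. e \<partial>noise_law) \<le> avg q t F x"
    unfolding avg_def by (rule integral_mono[OF _ integrable_noise_bounded[OF measurable_FX[OF F(1)] F(2)] le])
      (rule integrable_noise_bounded[where B="\<bar>e\<bar>"]; simp)
  then show ?thesis by simp
qed

private lemma measurable_differ: "(\<lambda>y. of_bool (y i \<noteq> y j) :: real) \<in> borel_measurable config_space"
proof -
  note [measurable] = measurable_config_component[OF measurable_ident_sets[OF refl]]
  have "Measurable.pred config_space (\<lambda>y. y i \<noteq> y j)" by measurable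
  then show ?thesis by simp
qed

private lemma avg_linear:
  assumes F: "F \<in> borel_measurable config_space" "\<And>y. \<bar>F y\<bar> \<le> B"
    and G: "G \<in> borel_measurable config_space" "\<And>y. \<bar>G y\<bar> \<le> C"
  shows "avg q t (\<lambda>y. a * F y + b * G y + c) x = a * avg q t F x + b * avg q t G x + c"
  unfolding avg_def
  using integrable_noise_bounded[OF measurable_FX[OF F(1)] F(2), of q x t]
    integrable_noise_bounded[OF measurable_FX[OF G(1)] G(2), of q x t] by simp

lemma game_C_profit:
  shows "\<exists>\<mu>>0. \<forall>x i. AE \<omega> in noise_law. ((\<lambda>t. site_profit q x \<omega> i t / t) \<longlongrightarrow> \<mu>) at_top"
proof -
  define S where "S i y = (of_bool (y i) :: real)" for i and y :: config
  define Q where "Q i y = q (nbhd y i)" for i y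
  define D where "D i y = (of_bool (y (i - 1) \<noteq> y (i + 1)) :: real)" for i and y :: config
  have Sm: "S i \<in> borel_measurable config_space" "\<bar>S i y\<bar> \<le> 1" for i y
    using measurable_status[of i] by (simp_all add: S_def[abs_def])
  have Qm: "Q i \<in> borel_measurable config_space" "\<bar>Q i y\<bar> \<le> 1" for i y
    using measurable_qf[of i] q_bounds01[of y i] by (simp_all add: Q_def[abs_def])
  have Dm: "D i \<in> borel_measurable config_space" "\<bar>D i y\<bar> \<le> 1" for i y
    using measurable_differ[of "i - 1" "i + 1"] by (simp_all add: D_def[abs_def])
  let ?x = "\<lambda>_ :: int. False"
  have expn: "(\<lambda>n. exp (- rate * real n)) \<longlonglongrightarrow> 0" using exp_rate_lim[of 1] by simp
  have "\<exists>\<rho>. \<forall>t\<ge>0. \<forall>x. \<bar>avg q t (S i) x - \<rho>\<bar> \<le> exp (- rate * t)" for i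
  proof -
    have "\<bar>avg q t (S i) x - avg q t (S i) y\<bar> \<le> exp (- rate * t)" if "t \<ge> 0" for t x y
    proof -
      have "\<bar>avg q t (S i) x - avg q t (S i) y\<bar> \<le> (1 + 0) * exp (- rate * t)"
      proof (rule avg_osc[OF Sm that])
        show "\<bar>S i y - S i z\<bar> \<le> 1 * of_bool (y i \<noteq> z i) + 0 * of_bool (y i \<noteq> z i)" for y z
          by (simp add: S_def)
      qed simp_all
      then show ?thesis by simp
    qed
    from oscillation_limit[OF Sm this expn] show ?thesis by metis
  qed
  then obtain \<rho> where \<rho>: "\<And>i t x. t \<ge> 0 \<Longrightarrow> \<bar>avg q t (S i) x - \<rho> i\<bar> \<le> exp (- rate * t)" by metis
  have "\<exists>\<mu>. \<forall>t\<ge>0. \<forall>x. \<bar>avg q t (Q i) x - \<mu>\<bar> \<le> \<kappa> * exp (- rate * t)" for i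
  proof -
    have osc: "\<bar>avg q t (Q i) x - avg q t (Q i) y\<bar> \<le> \<kappa> * exp (- rate * t)" if "t \<ge> 0" for t x y
    proof -
      have "\<bar>avg q t (Q i) x - avg q t (Q i) y\<bar> \<le> (\<kappa> / 2 + \<kappa> / 2) * exp (- rate * t)"
      proof (rule avg_osc[OF Qm that])
        show "\<bar>Q i y - Q i z\<bar> \<le> \<kappa> / 2 * of_bool (y (i - 1) \<noteq> z (i - 1)) + \<kappa> / 2 * of_bool (y (i + 1) \<noteq> z (i + 1))" for y z
          using q_Lipschitz[of y i z] by (simp add: Q_def distrib_left)
      qed (use \<kappa> in auto)
      then show ?thesis by simp
    qed
    have "(\<lambda>n. \<kappa> * exp (- rate * real n)) \<longlonglongrightarrow> 0"
      using tendsto_mult_right_zero[OF expn, of \<kappa>] by simp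
    from oscillation_limit[OF Qm osc this] show ?thesis by metis
  qed
  then obtain \<mu> where \<mu>: "\<And>i t x. t \<ge> 0 \<Longrightarrow> \<bar>avg q t (Q i) x - \<mu> i\<bar> \<le> \<kappa> * exp (- rate * t)" by metis
  have Slim: "(\<lambda>k. avg q (real k * h) (S i) ?x) \<longlonglongrightarrow> \<rho> i" if "h > 0" for h i
  proof (rule LIM_zero_cancel, rule Lim_null_comparison)
    show "\<forall>\<^sub>F k in sequentially. norm (avg q (real k * h) (S i) ?x - \<rho> i) \<le> exp (- rate * (real k * h))"
      using that by (intro always_eventually allI) (simp only: real_norm_def, rule \<rho>, simp)
  qed (rule exp_rate_lim[OF that])
  have Qlim: "(\<lambda>k. avg q (real k * h) (Q i) ?x) \<longlonglongrightarrow> \<mu> i" if "h > 0" for h i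
  proof (rule LIM_zero_cancel, rule Lim_null_comparison)
    show "\<forall>\<^sub>F k in sequentially. norm (avg q (real k * h) (Q i) ?x - \<mu> i) \<le> \<kappa> * exp (- rate * (real k * h))"
      using that by (intro always_eventually allI) (simp only: real_norm_def, rule \<mu>, simp)
    show "(\<lambda>k. \<kappa> * exp (- rate * (real k * h))) \<longlonglongrightarrow> 0"
      using tendsto_mult_right_zero[OF exp_rate_lim[OF that], of \<kappa>] by simp
  qed
  have \<rho>_shift: "\<rho> (i + 1) = \<rho> i" for i
  proof -
    have "avg q t (S i) ?x = avg q t (S (i + 1)) ?x" for t
      using avg_status_shift[of q t i ?x] by (simp add: S_def[abs_def])
    then show ?thesis using Slim[of 1 i] Slim[of 1 "i + 1"] LIMSEQ_unique by simp
  qed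
  have \<rho>_const: "\<rho> i = \<rho> 0" for i
  proof (induction i rule: int_induct[where k=0])
    case (step2 i)
    then show ?case using \<rho>_shift[of "i - 1"] by simp
  qed (simp_all add: \<rho>_shift)
  \<comment> \<open>In one block the expected status becomes, up to \<open>18 * h^2\<close>, the
    mixture of itself and the expected winning probability with weights \<open>1 - h\<close> and
    \<open>h\<close>. In the limit over time the terms of first order in \<open>h\<close> must
    balance.\<close>
  have \<rho>\<mu>: "\<rho> i = \<mu> i" for i
  proof -
    have "\<bar>\<rho> i - \<mu> i\<bar> \<le> 18 * h" if h: "h > 0" for h
    proof -
      have "\<bar>avg q (real (Suc k) * h) (S i) ?x - ((1 - h) * avg q (real k * h) (S i) ?x + h * avg q (real k * h) (Q i) ?x)\<bar> \<le> 18 * h^2" for k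
      proof -
        let ?G = "\<lambda>y. 1 * avg q h (S i) y + (- 1) * ((1 - h) * S i y + h * Q i y + 0) + 0"
        have G1: "(\<lambda>y. (1 - h) * S i y + h * Q i y + 0) \<in> borel_measurable config_space"
          by (intro borel_measurable_add borel_measurable_times borel_measurable_const Sm Qm)
        have G2: "\<bar>(1 - h) * S i y + h * Q i y + 0\<bar> \<le> \<bar>1 - h\<bar> + \<bar>h\<bar>" for y
          using mult_left_mono[OF Sm(2)[of i y], of "\<bar>1 - h\<bar>"] mult_left_mono[OF Qm(2)[of i y], of "\<bar>h\<bar>"]
            abs_triangle_ineq[of "(1 - h) * S i y" "h * Q i y"] by (simp add: abs_mult)
        have "avg q (real (Suc k) * h) (S i) ?x = avg q (real k * h) (avg q h (S i)) ?x"
          using avg_add[OF Sm, of "real k * h" h] h by (simp add: distrib_right add.commute)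
        then have "avg q (real (Suc k) * h) (S i) ?x - ((1 - h) * avg q (real k * h) (S i) ?x + h * avg q (real k * h) (Q i) ?x)
            = avg q (real k * h) ?G ?x"
          unfolding avg_linear[OF measurable_avg[OF Sm(1)] avg_abs_le[OF Sm] G1 G2] avg_linear[OF Sm Qm] by simp
        also have "\<bar>\<dots>\<bar> \<le> 18 * h^2"
        proof -
          have "\<bar>avg q (real k * h) ?G ?x - 0\<bar> \<le> 18 * h^2"
          proof (rule avg_diff_le)
            show "?G \<in> borel_measurable config_space"
              by (intro borel_measurable_add borel_measurable_times borel_measurable_const Sm Qm measurable_avg)
            have *: "\<bar>?G y\<bar> \<le> 18 * h^2" for y
              using status_block[of h i y] h by (simp add: S_def[abs_def] Q_def)
            show "\<bar>?G y\<bar> \<le> 18 * h^2" "\<bar>?G y - 0\<bar> \<le> 18 * h^2" for y using *[of y] by simp_all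
          qed
          then show ?thesis by simp
        qed
        finally show ?thesis .
      qed
      moreover have "(\<lambda>k. \<bar>avg q (real (Suc k) * h) (S i) ?x - ((1 - h) * avg q (real k * h) (S i) ?x + h * avg q (real k * h) (Q i) ?x)\<bar>)
          \<longlonglongrightarrow> \<bar>\<rho> i - ((1 - h) * \<rho> i + h * \<mu> i)\<bar>"
        by (intro tendsto_intros Slim Qlim h LIMSEQ_Suc[OF Slim[OF h]])
      ultimately have "\<bar>\<rho> i - ((1 - h) * \<rho> i + h * \<mu> i)\<bar> \<le> 18 * h^2"
        by (intro tendsto_upperbound[where F=sequentially]) auto
      moreover have "\<rho> i - ((1 - h) * \<rho> i + h * \<mu> i) = h * (\<rho> i - \<mu> i)" by (simp add: algebra_simps)
      ultimately have "h * \<bar>\<rho> i - \<mu> i\<bar> \<le> h * (18 * h)" using h by (simp add: abs_mult power2_eq_square ac_simps)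
      then show ?thesis using h by simp
    qed
    \<comment> \<open>For this \<open>h\<close> the bound is half of the difference itself.\<close>
    from this[of "\<bar>\<rho> i - \<mu> i\<bar> / 36"] show ?thesis by (cases "\<rho> i = \<mu> i") auto
  qed
  \<comment> \<open>At mesh \<open>h = 1 / 200\<close> the error \<open>50 * h^2 = 1 / 800\<close>
    is half of the gain \<open>h / 2\<close>, the factor \<open>1 - 2 * h\<close> is
    \<open>99 / 100\<close>, and the fixed point is \<open>(1 / 800) / (1 / 100) = 1 / 8\<close>. A
    positive lower bound is enough in place of the limit of \<open>D\<close>.\<close>
  have D_low: "avg q (real k * (1 / 200)) (D 0) ?x \<ge> 1 / 8 * (1 - (99 / 100) ^ k)" for k
  proof (induction k)
    case 0
    have "0 \<le> avg q 0 (D 0) ?x" by (rule avg_const_bound_lower[OF Dm]) (simp add: D_def)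
    then show ?case by simp
  next
    case (Suc k)
    let ?h = "1 / 200 :: real"
    have e: "real (Suc k) * ?h = real k * ?h + ?h" by (simp add: field_simps)
    have "avg q (real (Suc k) * ?h) (D 0) ?x = avg q (real k * ?h) (avg q ?h (D 0)) ?x"
      unfolding e by (rule avg_add[OF Dm]) simp_all
    moreover have "0 \<le> avg q (real k * ?h) (\<lambda>y. 1 * avg q ?h (D 0) y + (- 99 / 100) * D 0 y + (- 1 / 800)) ?x"
    proof (rule avg_const_bound_lower)
      show "(\<lambda>y. 1 * avg q ?h (D 0) y + (- 99 / 100) * D 0 y + (- 1 / 800)) \<in> borel_measurable config_space"
        by (intro borel_measurable_add borel_measurable_times borel_measurable_const Dm measurable_avg)
      show "\<bar>1 * avg q ?h (D 0) y + (- 99 / 100) * D 0 y + (- 1 / 800)\<bar> \<le> 3" for y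
      proof -
        have "\<bar>avg q ?h (D 0) y\<bar> \<le> 1" by (rule avg_abs_le[OF Dm])
        with Dm(2)[of 0 y] show ?thesis by (simp add: abs_le_iff)
      qed
      show "0 \<le> 1 * avg q ?h (D 0) y + (- 99 / 100) * D 0 y + (- 1 / 800)" for y
        using differ_block[of ?h y 0] by (simp add: D_def[abs_def] power2_eq_square)
    qed
    ultimately have "avg q (real (Suc k) * ?h) (D 0) ?x \<ge> 99 / 100 * avg q (real k * ?h) (D 0) ?x + 1 / 800"
      unfolding avg_linear[OF measurable_avg[OF Dm(1)] avg_abs_le[OF Dm] Dm] by simp
    with Suc show ?case by (simp add: algebra_simps)
  qed
  \<comment> \<open>A symmetric function of two bits is affine up to one interaction term: the
    affine part has slope -1/4 in each neighbour and fits equal neighbours, and \<open>D\<close>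
    corrects \<open>1 / 2\<close> to \<open>r\<close> for different ones.\<close>
  have Q_eq: "Q 0 y = 1 * ((- 1 / 4) * S (- 1) y + (- 1 / 4) * S 1 y + 3 / 4) + (r - 1 / 2) * D 0 y + 0" for y
    by (simp add: Q_def S_def D_def q_nbhd)
  have "\<mu> 0 \<ge> 3 / 4 - \<rho> 0 / 2 + (r - 1 / 2) * (1 / 8)"
  proof -
    let ?h = "1 / 200 :: real"
    have Sm2: "(\<lambda>y. (- 1 / 4) * S (- 1) y + (- 1 / 4) * S 1 y + 3 / 4) \<in> borel_measurable config_space"
      by (intro borel_measurable_add borel_measurable_times borel_measurable_const Sm)
    have Sm2b: "\<bar>(- 1 / 4) * S (- 1) y + (- 1 / 4) * S 1 y + 3 / 4\<bar> \<le> 1" for y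
      by (simp add: S_def)
    have eq: "avg q t (Q 0) ?x = 3 / 4 - avg q t (S (- 1)) ?x / 4 - avg q t (S 1) ?x / 4 + (r - 1 / 2) * avg q t (D 0) ?x" for t
      unfolding Q_eq[abs_def] avg_linear[OF Sm2 Sm2b Dm] avg_linear[OF Sm Sm] by simp
    have "avg q (real k * ?h) (Q 0) ?x \<ge> 3 / 4 - avg q (real k * ?h) (S (- 1)) ?x / 4 - avg q (real k * ?h) (S 1) ?x / 4
        + (r - 1 / 2) * (1 / 8 * (1 - (99 / 100) ^ k))" for k
      unfolding eq using r by (intro add_left_mono mult_left_mono D_low) auto
    moreover have "(\<lambda>k. 3 / 4 - avg q (real k * ?h) (S (- 1)) ?x / 4 - avg q (real k * ?h) (S 1) ?x / 4
        + (r - 1 / 2) * (1 / 8 * (1 - (99 / 100) ^ k))) \<longlonglongrightarrow> 3 / 4 - \<rho> (- 1) / 4 - \<rho> 1 / 4 + (r - 1 / 2) * (1 / 8 * (1 - 0))"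
      by (intro tendsto_intros Slim LIMSEQ_realpow_zero) simp_all
    ultimately have "3 / 4 - \<rho> (- 1) / 4 - \<rho> 1 / 4 + (r - 1 / 2) * (1 / 8 * (1 - 0)) \<le> \<mu> 0"
      using Qlim[of ?h 0] by (intro LIMSEQ_le[of _ _ "\<lambda>k. avg q (real k * ?h) (Q 0) ?x"]) auto
    then show ?thesis using \<rho>_const[of 1] \<rho>_const[of "- 1"] by simp
  qed
  \<comment> \<open>With \<open>\<mu> 0 = \<rho> 0\<close> the inequality reads
    \<open>3 / 2 * \<rho> 0 \<ge> 3 / 4 + (r - 1 / 2) / 8\<close>.\<close>
  then have pos: "2 * \<rho> 0 - 1 > 0" using \<rho>\<mu>[of 0] r by (simp add: field_simps)
  have "AE \<omega> in noise_law. ((\<lambda>t. site_profit q x \<omega> i t / t) \<longlongrightarrow> 2 * \<rho> 0 - 1) at_top" for x i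
  proof -
    have "AE \<omega> in noise_law. ((\<lambda>t. (\<Sum>i\<in>{i}. site_profit q x \<omega> i t) / t) \<longlongrightarrow> 2 * \<rho> 0 - 1) at_top"
    proof (rule profit_limitI[where \<delta>="\<lambda>_. 0" and hs="\<lambda>m. 1 / real (Suc m)"])
      show "(\<lambda>m. 1 / real (Suc m)) \<longlonglongrightarrow> 0" by (rule LIMSEQ_Suc[OF lim_1_over_n])
      fix m
      let ?h = "1 / real (Suc m)"
      have "(\<lambda>m. \<kappa> * exp (- rate * (real m * ?h))) \<longlonglongrightarrow> 0"
        using tendsto_mult_right_zero[OF exp_rate_lim[of ?h], of \<kappa>] by simp
      then have "AE \<omega> in noise_law. skel_avg ?h q x \<omega> (Q i) \<longlonglongrightarrow> \<mu> i"
        by (intro skel_avg_limit[OF Qm _ \<mu>]) simp_all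
      then show "AE \<omega> in noise_law. \<forall>\<epsilon>>0. \<forall>\<^sub>F n in sequentially.
          \<bar>(\<Sum>i\<in>{i}. skel_avg ?h q x \<omega> (\<lambda>y. 2 * q (nbhd y i) - 1) n) - (2 * \<rho> 0 - 1)\<bar> \<le> 0 + \<epsilon>"
      proof eventually_elim
        case (elim \<omega>)
        show ?case
        proof (intro allI impI)
          fix \<epsilon> :: real assume "\<epsilon> > 0"
          then have "\<forall>\<^sub>F n in sequentially. \<bar>skel_avg ?h q x \<omega> (Q i) n - \<mu> i\<bar> < \<epsilon> / 2"
            using tendstoD[OF elim, of "\<epsilon> / 2"] by (simp add: dist_real_def)
          then show "\<forall>\<^sub>F n in sequentially. \<bar>(\<Sum>i\<in>{i}. skel_avg ?h q x \<omega> (\<lambda>y. 2 * q (nbhd y i) - 1) n) - (2 * \<rho> 0 - 1)\<bar> \<le> 0 + \<epsilon>"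
            using eventually_gt_at_top[of 0]
          proof eventually_elim
            case (elim n)
            have "skel_avg ?h q x \<omega> (\<lambda>y. 2 * q (nbhd y i) - 1) n = 2 * skel_avg ?h q x \<omega> (Q i) n - 1"
              using skel_avg_affine[OF elim(2), of ?h q x \<omega> "Q i"] by (simp only: Q_def)
            moreover have "\<mu> i = \<rho> 0" using \<rho>\<mu>[of i] \<rho>_const[of i] by simp
            moreover have "(\<Sum>i\<in>{i}. skel_avg ?h q x \<omega> (\<lambda>y. 2 * q (nbhd y i) - 1) n)
                = skel_avg ?h q x \<omega> (\<lambda>y. 2 * q (nbhd y i) - 1) n" by simp
            ultimately show ?case using elim(1) unfolding abs_less_iff abs_le_iff by linarith
          qed
        qed
      qed
    qed (simp_all add: q_bounds01)
    then show ?thesis by simp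
  qed
  with pos show ?thesis by blast
qed

end

subsection \<open>Game B: the moving defect\<close>

text \<open>Not the position of the single defect but a label for each site: whether it deviates
  from the alternating pattern of phase \<open>b\<close>. In these labels a state of S is a step,
  false up to \<open>w\<close> and true from there on.\<close>

definition defect :: "bool \<Rightarrow> config \<Rightarrow> int \<Rightarrow> bool" where
  "defect b x j \<longleftrightarrow> (x j \<noteq> (even j = b))"

lemma defect_conf[simp]: "defect b (conf b w) j \<longleftrightarrow> w < j"
  by (auto simp: defect_def conf_def)

lemma conf_eq_iff: "x = conf b w \<longleftrightarrow> (\<forall>j. defect b x j \<longleftrightarrow> w < j)"
proof -
  have "x j = conf b w j \<longleftrightarrow> (defect b x j \<longleftrightarrow> w < j)" for j
    by (cases "even j"; cases b; cases "x j") (simp_all add: defect_def conf_def not_le)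
  then show ?thesis unfolding fun_eq_iff by (rule all_cong1)
qed

lemma conf_inj: "conf b w = conf b w' \<longleftrightarrow> w = w'"
proof
  assume "conf b w = conf b w'"
  then have "w < j \<longleftrightarrow> w' < j" for j by (metis defect_conf)
  from this[of w] this[of w'] show "w = w'" by auto
qed simp

definition wall :: "bool \<Rightarrow> config \<Rightarrow> int" where
  "wall b x = (THE w. x = conf b w)"

lemma wall_conf[simp]: "wall b (conf b w) = w"
  unfolding wall_def by (rule the_equality) (simp_all add: conf_inj)

text \<open>Functions of the wall position have to become functions of all configurations before
  \<open>avg\<close> can act on them. From a start \<open>conf b w\<close> with good noise, game B
  never meets the default value 0, by \<open>X_conf\<close>.\<close>

definition lift :: "bool \<Rightarrow> (int \<Rightarrow> real) \<Rightarrow> config \<Rightarrow> real" where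
  "lift b f x = (if x \<in> range (conf b) then f (wall b x) else 0)"

lemma lift_conf[simp]: "lift b f (conf b w) = f w"
  by (simp add: lift_def)

lemma lift_abs_le: "(\<And>w. \<bar>f w\<bar> \<le> B) \<Longrightarrow> \<bar>lift b f x\<bar> \<le> B"
  using order_trans[OF abs_ge_zero, of "f 0" B] by (auto simp: lift_def)

lemma config_singleton: "{c} \<in> sets config_space"
proof -
  note [measurable] = measurable_config_component[OF measurable_ident_sets[OF refl]]
  have "Measurable.pred config_space (\<lambda>x. \<forall>j. x j = c j)" by measurable
  then have "{x \<in> space config_space. \<forall>j. x j = c j} \<in> sets config_space" by (rule predE)
  also have "{x \<in> space config_space. \<forall>j. x j = c j} = {c}" by (auto simp: fun_eq_iff)
  finally show ?thesis .
qed

lemma conf_range_sets: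
  assumes "A \<subseteq> range (conf b)" shows "A \<in> sets config_space"
proof (rule sets.countable)
  show "countable A" using assms by (rule countable_subset) (intro countable_image countableI_type)
qed (rule config_singleton)

text \<open>Any \<open>f\<close> is admissible because the range of \<open>conf b\<close> is
  countable and its points are measurable.\<close>

lemma measurable_lift: "lift b f \<in> borel_measurable config_space"
proof (rule measurableI)
  fix A :: "real set"
  define C where "C = {x \<in> range (conf b). f (wall b x) \<in> A}"
  have "lift b f -` A \<inter> space config_space = (if 0 \<in> A then C \<union> (space config_space - range (conf b)) else C)"
    by (auto simp: C_def lift_def split: if_splits)
  moreover have "C \<in> sets config_space" by (rule conf_range_sets) (auto simp: C_def)
  moreover have "range (conf b) \<in> sets config_space" by (rule conf_range_sets[OF order_refl])
  ultimately show "lift b f -` A \<inter> space config_space \<in> sets config_space"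
    using sets.compl_sets[of "range (conf b)" config_space] by (cases "0 \<in> A") (simp_all add: sets.Un)
qed simp

lemma measurable_of_bool_pred: "Measurable.pred M Q \<Longrightarrow> (\<lambda>z. of_bool (Q z) :: real) \<in> borel_measurable M"
  by (rule measurable_compose[where N="count_space UNIV"]) simp_all

lemma avg_0: "F \<in> borel_measurable config_space \<Longrightarrow> avg p 0 F x = F x"
proof -
  assume F: "F \<in> borel_measurable config_space"
  have "avg p 0 F x = (\<integral>\<omega>. F x \<partial>noise_law)"
    unfolding avg_def
    by (rule integral_cong_AE[OF measurable_FX[OF F]]) (use AE_good in \<open>auto elim!: eventually_mono simp: X_0\<close>)
  then show ?thesis by simp
qed

lemma avg_mult: "avg p t (\<lambda>y. a * F y) x = a * avg p t F x"
  unfolding avg_def by simp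

lemma avg_minus_const:
  "F \<in> borel_measurable config_space \<Longrightarrow> (\<And>y. \<bar>F y\<bar> \<le> B) \<Longrightarrow> avg p t (\<lambda>y. F y - c) x = avg p t F x - c"
  unfolding avg_def using integrable_noise_bounded[OF measurable_FX, of F p x t B] by simp

subsection \<open>Test functions\<close>

text \<open>Away from the origin the second difference of \<open>tent L\<close> is at most 2, at the origin it is about
  \<open>- 4 L\<close>. As the long-run drift of a bounded function vanishes, the proportion of time at the
  origin is \<open>O(1 / L)\<close>.\<close>

definition tent :: "real \<Rightarrow> real \<Rightarrow> real" where
  "tent L x = (max 0 (L - \<bar>x\<bar>))^2"

lemma tent_second_difference:
  assumes L: "L \<ge> 1"
  shows "tent L (real_of_int k - 1) + tent L (real_of_int k + 1) - 2 * tent L (real_of_int k) \<le> 2 - (if k = 0 then 4 * L else 0)"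
proof -
  \<comment> \<open>On either side of the origin \<open>tent L\<close> agrees, at the three points
    involved, with the square of a positive part, so one inequality serves both sides.\<close>
  have key: "(max 0 (u - 1))^2 + (max 0 (u + 1))^2 - 2 * (max 0 u)^2 \<le> 2" for u :: real
  proof -
    consider "u \<ge> 1" | "0 \<le> u" "u < 1" | "-1 \<le> u" "u < 0" | "u < -1" by linarith
    then show ?thesis
    proof cases
      case 1 then show ?thesis by (simp add: power2_eq_square algebra_simps)
    next
      case 2
      have "(u + 1)^2 - 2 * u^2 = 2 - (1 - u)^2" by (simp add: power2_eq_square algebra_simps)
      with 2 show ?thesis by simp
    next
      case 3
      then have "(u + 1)^2 \<le> 1^2" by (intro power_mono) auto
      with 3 show ?thesis by simp
    next
      case 4 then show ?thesis by simp
    qed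
  qed
  consider "k = 0" | "k \<ge> 1" | "k \<le> -1" by linarith
  then show ?thesis
  proof cases
    case 1
    with L show ?thesis by (simp add: tent_def power2_eq_square algebra_simps)
  next
    case 2
    then have "real_of_int k \<ge> 1" by simp
    then have "tent L (real_of_int k - 1) = (max 0 ((L - k) + 1))^2" "tent L (real_of_int k + 1) = (max 0 ((L - k) - 1))^2"
      "tent L (real_of_int k) = (max 0 (L - k))^2"
      by (simp_all add: tent_def algebra_simps)
    with key[of "L - k"] 2 show ?thesis by simp
  next
    case 3
    then have "real_of_int k \<le> -1" by linarith
    then have "tent L (real_of_int k - 1) = (max 0 ((L + k) - 1))^2" "tent L (real_of_int k + 1) = (max 0 ((L + k) + 1))^2"
      "tent L (real_of_int k) = (max 0 (L + k))^2"
      by (simp_all add: tent_def algebra_simps)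
    with key[of "L + k"] 3 show ?thesis by simp
  qed
qed

text \<open>A continuous function with support \<open>[- M, M]\<close> that decreases at most by a factor
  \<open>exp (- c t / M^2)\<close> under the random walk, because at its boundary it is convex. Moving its centre
  at speed \<open>O(1 / M)\<close> does no harm.\<close>

definition bump :: "real \<Rightarrow> real \<Rightarrow> real" where
  "bump M z = (max 0 (M^2 - z^2))^2"

lemma bump_nonneg: "bump M z \<ge> 0" by (simp add: bump_def)

lemma bump_le: "bump M z \<le> M^4"
proof -
  have "max 0 (M^2 - z^2) \<le> M^2" by simp
  then have "(max 0 (M^2 - z^2))^2 \<le> (M^2)^2" by (intro power_mono) auto
  then show ?thesis by (simp add: bump_def flip: power_mult)
qed

lemma bump_minus: "bump M (- z) = bump M z" by (simp add: bump_def)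

lemma bump_outside: "M \<ge> 0 \<Longrightarrow> M \<le> \<bar>z\<bar> \<Longrightarrow> bump M z = 0"
  using abs_le_square_iff[of M z] by (simp add: bump_def)

text \<open>Without truncation the quartic has second difference
  \<open>12 * z^2 - 4 * M^2 + 2\<close>. Only the outer of the two neighbouring points can lie
  beyond the support, where the truncation lowers the value by at most \<open>(2 * M + 1)^2\<close>.
  The margin that remains is \<open>(3 * M - 1) * (M - 1)\<close>.\<close>

lemma bump_second_difference:
  assumes M: "M \<ge> 1" and z: "\<bar>z\<bar> < M"
  shows "bump M (z - 1) + bump M (z + 1) - 2 * bump M z \<ge> M^2 - 12 * (M^2 - z^2)"
proof -
  have pos: "bump M (z - 1) + bump M (z + 1) - 2 * bump M z \<ge> M^2 - 12 * (M^2 - z^2)" if z: "0 \<le> z" "z < M" for z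
  proof -
    have "\<bar>z - 1\<bar> \<le> \<bar>M\<bar>" using z M by auto
    then have "(z - 1)^2 \<le> M^2" by (simp only: abs_le_square_iff)
    then have 1: "bump M (z - 1) = (M^2 - (z - 1)^2)^2" by (simp add: bump_def)
    have "\<bar>z\<bar> \<le> \<bar>M\<bar>" using z by auto
    then have "z^2 \<le> M^2" by (simp only: abs_le_square_iff)
    then have 2: "bump M z = (M^2 - z^2)^2" by (simp add: bump_def)
    have 3: "bump M (z + 1) \<ge> (M^2 - (z + 1)^2)^2 - (2 * M + 1)^2"
    proof (cases "(z + 1)^2 \<le> M^2")
      case True
      then show ?thesis by (simp add: bump_def)
    next
      case False
      have "(z + 1)^2 \<le> (M + 1)^2" using z by (intro power_mono) auto
      then have "(z + 1)^2 - M^2 \<le> 2 * M + 1" by (simp add: power2_eq_square algebra_simps)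
      then have "((z + 1)^2 - M^2)^2 \<le> (2 * M + 1)^2" using False by (intro power_mono) auto
      then show ?thesis using bump_nonneg[of M "z + 1"] by (simp add: power2_commute[of "M^2"])
    qed
    have "(M^2 - (z - 1)^2)^2 + (M^2 - (z + 1)^2)^2 - 2 * (M^2 - z^2)^2 = 12 * z^2 - 4 * M^2 + 2"
      by (simp add: power2_eq_square algebra_simps)
    with 1 2 3 have "bump M (z - 1) + bump M (z + 1) - 2 * bump M z \<ge> 12 * z^2 - 4 * M^2 + 2 - (2 * M + 1)^2"
      by linarith
    moreover have "12 * z^2 - 4 * M^2 + 2 - (2 * M + 1)^2 - (M^2 - 12 * (M^2 - z^2)) = (3 * M - 1) * (M - 1)"
      by (simp add: power2_eq_square algebra_simps)
    moreover have "(3 * M - 1) * (M - 1) \<ge> 0" using M by (intro mult_nonneg_nonneg) auto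
    ultimately show ?thesis by linarith
  qed
  show ?thesis
  proof (cases "0 \<le> z")
    case True
    then show ?thesis using pos[of z] z by simp
  next
    case False
    have "bump M (z - 1) = bump M (- z + 1)" "bump M (z + 1) = bump M (- z - 1)"
      using bump_minus[of M "z - 1"] bump_minus[of M "z + 1"] by simp_all
    then show ?thesis using pos[of "- z"] z False by (simp add: bump_minus)
  qed
qed

text \<open>Let \<open>q\<close> be the positive part of \<open>M^2 - z^2\<close>. Inside the
  support the second difference contributes at least \<open>m * M^2 - 12 * q\<close>, the motion of
  the centre costs at most \<open>12 * q\<close>, and the exponential returns
  \<open>K * q^2 / M^2\<close>. The sum is a perfect square for \<open>K = 144 / m\<close>. The rate
  \<open>l\<close> ranges over \<open>[m, 1]\<close> because that of the wall varies with its
  position.\<close>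

lemma bump_step:
  assumes M: "M \<ge> 1" and \<delta>: "\<bar>\<delta>\<bar> \<le> 3 / M" and h: "0 \<le> h" "h \<le> 1 / 2"
    and m: "0 < m" "m \<le> l" "l \<le> 1"
  defines "K \<equiv> 144 / m"
  shows "bump M (z + \<delta> * h) - (144 + 2 * K * M^2) * h^2
    \<le> exp (K / M^2 * h) * (bump M z + h * l * (bump M (z - 1) + bump M (z + 1) - 2 * bump M z))"
proof -
  define g where "g = bump M z"
  define D where "D = bump M (z - 1) + bump M (z + 1) - 2 * bump M z"
  define q where "q = max 0 (M^2 - z^2)"
  define \<kappa> where "\<kappa> = K / M^2"
  have l0: "l > 0" using m by linarith
  have K: "K > 0" using m by (simp add: K_def)
  have \<kappa>: "\<kappa> > 0" using K M by (simp add: \<kappa>_def)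
  have q0: "q \<ge> 0" by (simp add: q_def)
  have gq: "g = q^2" by (simp add: g_def q_def bump_def)
  have g0: "g \<ge> 0" by (simp add: gq)
  have gM: "g \<le> M^4" unfolding g_def by (rule bump_le)
  have D2: "D \<ge> - 2 * g" unfolding D_def g_def using bump_nonneg[of M "z - 1"] bump_nonneg[of M "z + 1"] by linarith
  have hl: "0 \<le> h * l" "h * l \<le> 1 / 2" using h l0 m mult_mono[of h "1/2" l 1] by auto
  have lD: "h * l * D \<ge> - (2 * (h * l) * g)"
    using mult_left_mono[OF D2 hl(1)] by simp
  have "2 * (h * l) * g \<le> 1 * g" using hl g0 by (intro mult_right_mono) auto
  with lD have gD0: "g + h * l * D \<ge> 0" by linarith
  have low: "exp (\<kappa> * h) * (g + h * l * D) \<ge> (1 + \<kappa> * h) * (g + h * l * D)"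
    using gD0 exp_ge_add_one_self[of "\<kappa> * h"] by (intro mult_right_mono) auto
  have exp0: "0 \<le> exp (\<kappa> * h) * (g + h * l * D)" using gD0 by simp
  show ?thesis
  proof (cases "\<bar>z + \<delta> * h\<bar> < M")
    case False
    then have "bump M (z + \<delta> * h) = 0" using M by (intro bump_outside) auto
    moreover have "(144 + 2 * K * M^2) * h^2 \<ge> 0" using K by (intro mult_nonneg_nonneg) auto
    ultimately show ?thesis using exp0 unfolding g_def D_def \<kappa>_def by linarith
  next
    case True
    define a where "a = M^2 - (z + \<delta> * h)^2"
    \<comment> \<open>\<open>u\<close> is the change of \<open>M^2 - z^2\<close> caused by the
      motion of the centre; its square gives the error term \<open>144 * h^2\<close>.\<close>
    define u where "u = - (\<delta> * h) * (2 * z + \<delta> * h)"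
    have aq: "a = (M^2 - z^2) + u" by (simp add: a_def u_def power2_eq_square algebra_simps)
    have \<delta>M: "\<bar>\<delta>\<bar> * M \<le> 3" using \<delta> M by (simp add: field_simps)
    have \<delta>3: "\<bar>\<delta>\<bar> \<le> 3"
    proof -
      have "3 / M \<le> 3" using M by (simp add: divide_le_eq)
      with \<delta> show ?thesis by linarith
    qed
    have \<delta>h: "\<bar>\<delta> * h\<bar> \<le> 3 / 2"
      using mult_mono[OF \<delta>3 h(2)] h by (simp add: abs_mult)
    have "2 * z + \<delta> * h = 2 * (z + \<delta> * h) - \<delta> * h" by simp
    then have "\<bar>2 * z + \<delta> * h\<bar> \<le> 2 * \<bar>z + \<delta> * h\<bar> + \<bar>\<delta> * h\<bar>"
      using abs_triangle_ineq4[of "2 * (z + \<delta> * h)" "\<delta> * h"] by (simp only: abs_mult abs_numeral)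
    then have "\<bar>2 * z + \<delta> * h\<bar> \<le> 4 * M" using True \<delta>h M by linarith
    then have "\<bar>u\<bar> \<le> (\<bar>\<delta>\<bar> * h) * (4 * M)"
      unfolding u_def abs_mult abs_minus_cancel using h by (intro mult_mono) auto
    also have "\<dots> = (\<bar>\<delta>\<bar> * M) * (4 * h)" by simp
    also have "\<dots> \<le> 3 * (4 * h)" using \<delta>M h by (intro mult_right_mono) auto
    finally have "\<bar>u\<bar>^2 \<le> (12 * h)^2" by (intro power_mono) auto
    then have u2: "u^2 \<le> 144 * h^2" by (simp add: power_mult_distrib)
    \<comment> \<open>The square of the positive part has derivative \<open>2 * max 0 x\<close>,
      also where the truncation sets in; this is its quadratic upper bound.\<close>
    have sq: "(max 0 (x + u))^2 \<le> (max 0 x)^2 + 2 * max 0 x * u + u^2" for x :: real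
    proof (cases "x \<ge> 0")
      case True
      have "(max 0 (x + u))^2 \<le> (x + u)^2" by (cases "x + u \<ge> 0") auto
      with True show ?thesis by (simp add: power2_sum)
    next
      case False
      have "(max 0 (x + u))^2 \<le> u^2"
      proof (cases "x + u \<ge> 0")
        case True
        then show ?thesis using False by (auto intro!: power_mono)
      qed simp
      with False show ?thesis by simp
    qed
    have "bump M (z + \<delta> * h) \<le> g + 2 * q * u + u^2"
      using sq[of "M^2 - z^2"] unfolding bump_def a_def[symmetric] aq gq q_def .
    moreover have "2 * q * u \<le> 12 * h * q"
    proof (cases "\<bar>z\<bar> < M")
      case zM: True
      have "u \<le> 2 * (\<bar>\<delta>\<bar> * h) * \<bar>z\<bar>"
      proof -
        have "u = - (2 * (\<delta> * h) * z) - (\<delta> * h)^2" by (simp add: u_def power2_eq_square algebra_simps)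
        moreover have "- (2 * (\<delta> * h) * z) \<le> \<bar>2 * (\<delta> * h) * z\<bar>" by (rule abs_ge_minus_self)
        moreover have "\<bar>2 * (\<delta> * h) * z\<bar> = 2 * (\<bar>\<delta>\<bar> * h) * \<bar>z\<bar>" using h by (simp add: abs_mult)
        ultimately show ?thesis using zero_le_power2[of "\<delta> * h"] by linarith
      qed
      also have "\<dots> \<le> 2 * (\<bar>\<delta>\<bar> * h) * M" using zM h by (intro mult_left_mono) auto
      also have "\<dots> = 2 * h * (\<bar>\<delta>\<bar> * M)" by simp
      also have "\<dots> \<le> 2 * h * 3" using \<delta>M h by (intro mult_left_mono) auto
      finally have "u \<le> 6 * h" by simp
      then have "(2 * q) * u \<le> (2 * q) * (6 * h)" using q0 by (intro mult_left_mono) auto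
      then show ?thesis by (simp add: ac_simps)
    next
      case False
      then have "\<bar>M\<bar> \<le> \<bar>z\<bar>" using M by simp
      then have "M^2 \<le> z^2" by (simp only: abs_le_square_iff)
      then have "q = 0" by (simp add: q_def)
      then show ?thesis by simp
    qed
    ultimately have up: "bump M (z + \<delta> * h) \<le> g + 12 * h * q + 144 * h^2" using u2 by linarith
    have main: "l * D + \<kappa> * g - 12 * q \<ge> 0"
    proof (cases "\<bar>z\<bar> < M")
      case zM: True
      then have "\<bar>z\<bar> \<le> \<bar>M\<bar>" by simp
      then have "z^2 \<le> M^2" by (simp only: abs_le_square_iff)
      then have q: "q = M^2 - z^2" by (simp add: q_def)
      have "l * (M^2 - 12 * q) \<le> l * D"
        using bump_second_difference[OF M zM] l0 unfolding q D_def by (intro mult_left_mono) auto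
      moreover have "m * M^2 \<le> l * M^2" using m by (intro mult_right_mono) auto
      moreover have "l * (12 * q) \<le> 1 * (12 * q)" using m q0 by (intro mult_right_mono) auto
      ultimately have "m * M^2 - 12 * q \<le> l * D" by (simp add: right_diff_distrib)
      moreover have "m * M^2 + \<kappa> * g - 24 * q = (m * M^2 - 12 * q)^2 / (m * M^2)"
        using m M by (simp add: \<kappa>_def K_def gq power2_eq_square field_simps)
      moreover have "(m * M^2 - 12 * q)^2 / (m * M^2) \<ge> 0" using m by simp
      ultimately show ?thesis by linarith
    next
      case False
      then have "\<bar>M\<bar> \<le> \<bar>z\<bar>" using M by simp
      then have "M^2 \<le> z^2" by (simp only: abs_le_square_iff)
      then have "q = 0" by (simp add: q_def)
      then have "g = 0" by (simp add: gq)
      with D2 l0 \<open>q = 0\<close> show ?thesis by simp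
    qed
    have "h * (l * D + \<kappa> * g - 12 * q) \<ge> 0" using main h by simp
    moreover have "(1 + \<kappa> * h) * (g + h * l * D) = g + h * (l * D + \<kappa> * g) + \<kappa> * h * (h * l * D)"
      by (simp add: algebra_simps)
    \<comment> \<open>The cross term of second order, controlled by \<open>g \<le> M^4\<close> and
      \<open>\<kappa> * M^4 = K * M^2\<close>.\<close>
    moreover have "\<kappa> * h * (h * l * D) \<ge> - (2 * K * M^2 * h^2)"
    proof -
      have "2 * (h * l) * g \<le> 2 * (h * 1) * M^4"
        using h m l0 gM g0 by (intro mult_mono) auto
      with lD have "h * l * D \<ge> - (2 * h * M^4)" by linarith
      then have "\<kappa> * h * (h * l * D) \<ge> \<kappa> * h * (- (2 * h * M^4))"
        using \<kappa> h by (intro mult_left_mono) auto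
      moreover have "\<kappa> * h * (- (2 * h * M^4)) = - (2 * K * M^2 * h^2)"
        using M by (simp add: \<kappa>_def power2_eq_square power4_eq_xxxx)
      ultimately show ?thesis by linarith
    qed
    ultimately have "g + 12 * h * q - 2 * K * M^2 * h^2 \<le> (1 + \<kappa> * h) * (g + h * l * D)"
      by (simp add: algebra_simps)
    with up low have "bump M (z + \<delta> * h) - (144 * h^2 + 2 * K * M^2 * h^2) \<le> exp (\<kappa> * h) * (g + h * l * D)"
      by linarith
    then show ?thesis by (simp only: g_def D_def \<kappa>_def distrib_right)
  qed
qed

subsection \<open>The wall process\<close>

locale game_B =
  fixes P :: game and p :: real
  assumes P: "P 0 = 1" "P 1 = p" "P 2 = p" "P 3 = 0" and p: "0 < p" "p < 1"

context game_B
begin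

section \<open>Invariance of S under game B\<close>

lemma P_nbhd: "P (nbhd y i) = (if y (i - 1) then (if y (i + 1) then 0 else p) else (if y (i + 1) then p else 1))"
  using P by (simp add: nbhd_eq)

lemma P_bounds: "0 \<le> P (nbhd y i)" "P (nbhd y i) \<le> 1"
  using p by (simp_all add: P_nbhd)

text \<open>\<open>i - 1\<close> and \<open>i + 1\<close> have the same parity, so equal labels mean
  equal symbols, and then game B leaves nothing to chance: a mark in \<open>[0, 1)\<close> is
  compared with 0 or 1. The player takes over the label of his neighbours.\<close>

lemma outcome_agree:
  assumes "0 \<le> u" "u < 1" "defect b y (i - 1) = defect b y (i + 1)"
  shows "((u < P (nbhd y i)) \<noteq> (even i = b)) = defect b y (i + 1)"
  using assms by (cases "even i"; cases b; cases "y (i - 1)"; cases "y (i + 1)") (simp_all add: defect_def P_nbhd)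

lemma outcome_differ:
  assumes "defect b y (i - 1) \<noteq> defect b y (i + 1)"
  shows "P (nbhd y i) = p"
  using assms by (cases "even i"; cases b; cases "y (i - 1)"; cases "y (i + 1)") (simp_all add: defect_def P_nbhd)

text \<open>A descent of the labels. Labels without descents that are false far to the left and true
  far to the right come from some \<open>conf b w\<close>.\<close>

definition viol :: "bool \<Rightarrow> config \<Rightarrow> noise \<Rightarrow> real \<Rightarrow> int \<Rightarrow> bool" where
  "viol b x \<omega> t j \<longleftrightarrow> defect b (X P x \<omega> t) j \<and> \<not> defect b (X P x \<omega> t) (j + 1)"

lemma defect_play:
  assumes g: "good \<omega>" and c: "cnt (\<omega> i) t = Suc m"
    and agree: "defect b (X P x \<omega> (ptime (\<omega> i) m)) (i - 1) = v" "defect b (X P x \<omega> (ptime (\<omega> i) m)) (i + 1) = v"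
  shows "defect b (X P x \<omega> t) i = v"
proof -
  let ?y = "X P x \<omega> (ptime (\<omega> i) m)"
  have u: "0 \<le> snd (\<omega> i m)" "snd (\<omega> i m) < 1" using g by (simp_all add: good_def)
  have "X P x \<omega> t i \<longleftrightarrow> snd (\<omega> i m) < P (nbhd ?y i)" using c out_unfold[OF g] by (simp add: X_eq)
  then have "defect b (X P x \<omega> t) i = defect b ?y (i + 1)"
    using outcome_agree[OF u, of b ?y i] agree by (simp add: defect_def)
  with agree show ?thesis by simp
qed

lemma defect_between:
  assumes g: "good \<omega>" and st: "s \<le> t" and last: "\<And>m. ptime (\<omega> j) m < t \<Longrightarrow> ptime (\<omega> j) m < s"
  shows "defect b (X P x \<omega> s) j = defect b (X P x \<omega> t) j"
proof -
  have "cnt (\<omega> j) s = cnt (\<omega> j) t"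
  proof (rule cnt_eqI)
    fix n show "ptime (\<omega> j) n < s \<longleftrightarrow> n < cnt (\<omega> j) t"
      using less_cnt_iff[OF good_proper[OF g], of n j t] last[of n] st by auto
  qed
  then show ?thesis by (simp add: defect_def X_eq)
qed

text \<open>Go back to the last play of \<open>j\<close> or \<open>j + 1\<close> before
  \<open>t\<close>; there is one since the initial labels have no descent, and ties are excluded.
  Had the neighbours of that player agreed, he would have taken over their label and there would be
  no descent. So just before the play his left neighbour is labelled and his right one is not, which
  makes a descent on one of his two sides whatever his own label.\<close>

lemma viol_earlier:
  assumes g: "good \<omega>" and v: "viol b (conf b w) \<omega> t j"
  obtains i n where "i = j \<or> i = j + 1" "ptime (\<omega> i) n < t"
    "viol b (conf b w) \<omega> (ptime (\<omega> i) n) (i - 1) \<or> viol b (conf b w) \<omega> (ptime (\<omega> i) n) i"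
proof -
  let ?y = "\<lambda>t. defect b (X P (conf b w) \<omega> t)"
  have pr: "proper (\<omega> i)" for i by (rule good_proper[OF g])
  have y: "?y t j" "\<not> ?y t (j + 1)" using v by (simp_all add: viol_def)
  define L where "L i m \<longleftrightarrow> cnt (\<omega> i) t = Suc m" for i m
  have lastI: "ptime (\<omega> i) n \<le> ptime (\<omega> i) m" if "L i m" "ptime (\<omega> i) n < t" for i m n
  proof -
    have "n \<le> m" using that less_cnt_iff[OF pr, of n i t] by (simp add: L_def)
    then show ?thesis by (rule monoD[OF strict_mono_mono[OF proper_strict_mono[OF pr]]])
  qed
  have before: "ptime (\<omega> i) m < t" if "L i m" for i m
    using that cnt_SucD[OF pr] by (simp add: L_def)
  have tie: "ptime (\<omega> j) n \<noteq> ptime (\<omega> (j + 1)) m" for n m using g by (simp add: good_def)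
  consider (left) m where "L j m" "\<And>n. ptime (\<omega> (j + 1)) n < t \<Longrightarrow> ptime (\<omega> (j + 1)) n < ptime (\<omega> j) m"
    | (right) m where "L (j + 1) m" "\<And>n. ptime (\<omega> j) n < t \<Longrightarrow> ptime (\<omega> j) n < ptime (\<omega> (j + 1)) m"
  proof (cases "cnt (\<omega> j) t")
    case 0
    then have no: "\<not> ptime (\<omega> j) n < t" for n using less_cnt_iff[OF pr, of n j t] by simp
    show thesis
    proof (cases "cnt (\<omega> (j + 1)) t")
      case 0
      have init: "?y t k = (w < k)" if "cnt (\<omega> k) t = 0" for k
        using X_unchanged[of \<omega> k t P "conf b w", OF that] defect_conf[of b w k] by (simp add: defect_def)
      show thesis using y init[OF \<open>cnt (\<omega> j) t = 0\<close>] init[OF 0] by simp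
    next
      case (Suc m)
      then show thesis using right[of m] no by (simp add: L_def)
    qed
  next
    case (Suc m)
    then have m: "L j m" by (simp add: L_def)
    show thesis
    proof (cases "cnt (\<omega> (j + 1)) t")
      case 0
      then have "\<not> ptime (\<omega> (j + 1)) n < t" for n using less_cnt_iff[OF pr, of n "j + 1" t] by simp
      then show thesis using left[OF m] by blast
    next
      case (Suc m')
      then have m': "L (j + 1) m'" by (simp add: L_def)
      show thesis
      proof (cases "ptime (\<omega> (j + 1)) m' < ptime (\<omega> j) m")
        case True
        then show thesis using left[OF m] lastI[OF m'] by (meson le_less_trans)
      next
        case False
        then have "ptime (\<omega> j) m < ptime (\<omega> (j + 1)) m'" using tie[of m m'] by linarith
        then show thesis using right[OF m'] lastI[OF m] by (meson le_less_trans)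
      qed
    qed
  qed
  then show thesis
  proof cases
    case left
    let ?s = "ptime (\<omega> j) m"
    have s: "?s < t" by (rule before[OF left(1)])
    have 1: "\<not> ?y ?s (j + 1)"
      using defect_between[OF g less_imp_le[OF s] left(2), of b "conf b w"] y by simp
    have "?y ?s (j - 1)"
      using defect_play[OF g left(1)[unfolded L_def], of b "conf b w" False] 1 y by auto
    with 1 show thesis by (intro that[of j m] s) (auto simp: viol_def)
  next
    case right
    let ?s = "ptime (\<omega> (j + 1)) m"
    have s: "?s < t" by (rule before[OF right(1)])
    have 1: "?y ?s j"
      using defect_between[OF g less_imp_le[OF s] right(2), of b "conf b w"] y by simp
    have "\<not> ?y ?s (j + 1 + 1)"
      using defect_play[OF g right(1)[unfolded L_def], of b "conf b w" True] 1 y by auto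
    with 1 show thesis by (intro that[of "j + 1" m] s) (auto simp: viol_def)
  qed
qed

text \<open>Every descent goes back to one just before an earlier neighbouring play. As the infinite
  system has no first play, \<open>good_induct\<close> replaces the choice of an earliest
  descent.\<close>

lemma no_viol:
  assumes g: "good \<omega>" shows "\<not> viol b (conf b w) \<omega> t j"
proof
  assume v: "viol b (conf b w) \<omega> t j"
  have ok: "\<not> viol b (conf b w) \<omega> (ptime (\<omega> i) n) (i - 1) \<and> \<not> viol b (conf b w) \<omega> (ptime (\<omega> i) n) i" for i n
    using g
  proof (induction i n rule: good_induct)
    case (step i n)
    show ?case
    proof (rule ccontr)
      assume "\<not> ?thesis"
      then obtain j where j: "j = i - 1 \<or> j = i" "viol b (conf b w) \<omega> (ptime (\<omega> i) n) j" by blast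
      from viol_earlier[OF g j(2)] obtain i' n' where i': "i' = j \<or> i' = j + 1" "ptime (\<omega> i') n' < ptime (\<omega> i) n"
        "viol b (conf b w) \<omega> (ptime (\<omega> i') n') (i' - 1) \<or> viol b (conf b w) \<omega> (ptime (\<omega> i') n') i'" .
      have "\<bar>i - i'\<bar> \<le> 1" using j(1) i'(1) by auto
      from step[OF this i'(2)] i'(3) show False by blast
    qed
  qed
  from viol_earlier[OF g v] ok show False by metis
qed

text \<open>Players far to the left and to the right who have not yet played keep their initial
  labels, and without descents the labels switch exactly once in between.\<close>

lemma X_conf:
  assumes g: "good \<omega>" obtains w' where "X P (conf b w) \<omega> t = conf b w'"
proof -
  let ?y = "defect b (X P (conf b w) \<omega> t)"
  have step: "?y j \<Longrightarrow> ?y (j + 1)" for j using no_viol[OF g, of b w t j] by (simp add: viol_def)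
  have mono: "?y j \<Longrightarrow> ?y (j + int k)" for j k
  proof (induction k)
    case (Suc k)
    from step[OF Suc.IH[OF Suc.prems]] show ?case by (simp add: ac_simps)
  qed simp
  have still: "?y j = (w < j)" if "t \<le> fst (\<omega> j 0)" for j
  proof -
    have "cnt (\<omega> j) t = 0" using that cnt_eq_0_iff[OF good_proper[OF g]] by blast
    then show ?thesis using X_unchanged[of \<omega> j t P "conf b w"] defect_conf[of b w j] by (simp add: defect_def)
  qed
  obtain a where a: "a < w" "t \<le> fst (\<omega> a 0)" using good_left[OF g] by blast
  obtain c where c: "c > w" "t \<le> fst (\<omega> c 0)" using good_right[OF g] by blast
  have ya: "\<not> ?y a" using still[OF a(2)] a by simp
  have yc: "?y (a + int (nat (c - a)))" using still[OF c(2)] a c by simp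
  define n where "n = (LEAST n. ?y (a + int n))"
  have n: "?y (a + int n)" unfolding n_def by (rule LeastI[of _ "nat (c - a)"]) (rule yc)
  have below: "\<not> ?y (a + int k)" if "k < n" for k using that not_less_Least unfolding n_def by blast
  define w' where "w' = a + int n - 1"
  have "?y j \<longleftrightarrow> w' < j" for j
  proof
    assume "w' < j"
    then have "j = a + int n + int (nat (j - a - int n))" by (simp add: w'_def)
    then show "?y j" using mono[OF n, of "nat (j - a - int n)"] by simp
  next
    assume yj: "?y j"
    show "w' < j"
    proof (rule ccontr)
      assume nj: "\<not> w' < j"
      show False
      proof (cases "a \<le> j")
        case True
        with nj have "j = a + int (nat (j - a))" "nat (j - a) < n" by (auto simp: w'_def)
        with below[of "nat (j - a)"] yj show False by simp
      next
        case False
        then have "a = j + int (nat (a - j))" by simp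
        with mono[OF yj, of "nat (a - j)"] ya show False by simp
      qed
    qed
  qed
  then have "X P (conf b w) \<omega> t = conf b w'" unfolding conf_eq_iff by blast
  then show thesis by (rule that)
qed

lemma avg_conf_mono:
  assumes F: "F \<in> borel_measurable config_space" "\<And>y. \<bar>F y\<bar> \<le> B"
    and G: "G \<in> borel_measurable config_space" "\<And>y. \<bar>G y\<bar> \<le> C"
    and le: "\<And>w'. F (conf b w') \<le> G (conf b w')"
  shows "avg P t F (conf b w) \<le> avg P t G (conf b w)"
  unfolding avg_def
proof (rule noise_integral_le[OF measurable_FX[OF F(1)] F(2) measurable_FX[OF G(1)] G(2)])
  fix \<omega> assume "good \<omega>"
  then obtain w' where "X P (conf b w) \<omega> t = conf b w'" by (rule X_conf)
  then show "F (X P (conf b w) \<omega> t) \<le> G (X P (conf b w) \<omega> t)" using le[of w'] by simp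
qed

lemma wall_at:
  assumes g: "good \<omega>" and y: "\<not> defect b (X P (conf b w) \<omega> t) v" "defect b (X P (conf b w) \<omega> t) (v + 1)"
  shows "lift b f (X P (conf b w) \<omega> t) = f v"
proof -
  obtain w' where w': "X P (conf b w) \<omega> t = conf b w'" by (rule X_conf[OF g])
  with y have "w' = v" by simp
  with w' show ?thesis by simp
qed

text \<open>A play of \<open>w\<close> can move the wall to the left and a play of
  \<open>w + 1\<close> to the right. Both players see different neighbours and win with probability
  \<open>p\<close>, and the parity of \<open>w\<close> decides whether winning or losing moves the
  wall, in the same way for both. So the two directions have equal rates, which alternate in
  \<open>w\<close> between \<open>p\<close> and \<open>1 - p\<close>.\<close>

definition jump :: "bool \<Rightarrow> int \<Rightarrow> real" where
  "jump b w = (if even w = b then 1 - p else p)"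

lemma wall_block:
  assumes h: "h \<ge> 0" and f: "\<And>w. \<bar>f w\<bar> \<le> B"
  shows "\<bar>avg P h (lift b f) (conf b w) - (f w + h * jump b w * (f (w - 1) + f (w + 1) - 2 * f w))\<bar> \<le> 32 * B * h^2"
proof -
  let ?K = "{w - 1, w, w + 1, w + 2}" and ?x = "conf b w"
  \<comment> \<open>The value of \<open>f\<close> after a play of \<open>j\<close> that moves the
    wall if it can; \<open>\<beta>\<close> is the value after a win and \<open>\<alpha>\<close>
    after a loss. The four players of the window give the constant
    \<open>32 = 2 * 4^2\<close>.\<close>
  define to where "to j = (if j = w then f (w - 1) else if j = w + 1 then f (w + 1) else f w)" for j
  define \<beta> where "\<beta> j = (if even w = b then f w else to j)" for j
  define \<alpha> where "\<alpha> j = (if even w = b then to j else f w)" for j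
  have cons: "P (nbhd ?x w) = p" "P (nbhd ?x (w + 1)) = p"
    by (rule outcome_differ[of b]; simp)+
  have pu: "measure mark_law {..<p} = p" using p by (intro prob_mark_less) auto
  have "\<bar>avg P h (lift b f) ?x - (f w + h * (\<Sum>j\<in>?K. (\<alpha> j * (1 - measure mark_law {..<p}) + \<beta> j * measure mark_law {..<p}) - f w))\<bar>
      \<le> 2 * B * (real (card ?K) * h)^2"
    unfolding avg_def
  proof (rule block_expansion[OF h _ measurable_FX[OF measurable_lift] lift_abs_le[OF f]])
    fix \<omega> assume g: "good \<omega>"
    { assume q: "quiet ?K h \<omega>"
      have "defect b (X P ?x \<omega> h) k = (w < k)" if "k \<in> ?K" for k
        using X_quiet[OF q that, of P ?x] defect_conf[of b w k] by (simp add: defect_def)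
      from this[of w] this[of "w + 1"] show "lift b f (X P ?x \<omega> h) = f w"
        by (intro wall_at[OF g]) simp_all }
    fix j assume j: "j \<in> ?K" and s: "single ?K j h \<omega>"
    have keep: "defect b (X P ?x \<omega> h) k = (w < k)" if "k \<in> ?K" "k \<noteq> j" for k
      using X_single_other[OF s that, of P ?x] defect_conf[of b w k] by (simp add: defect_def)
    consider "j = w" | "j = w + 1" | "j \<noteq> w" "j \<noteq> w + 1" by blast
    then show "lift b f (X P ?x \<omega> h) = (if snd (\<omega> j 0) \<in> {..<p} then \<beta> j else \<alpha> j)"
    proof cases
      case 1
      have "X P ?x \<omega> h w \<longleftrightarrow> snd (\<omega> w 0) < p"
        using X_single[OF g s, of P ?x] cons 1 by simp
      then have d: "defect b (X P ?x \<omega> h) w \<longleftrightarrow> ((snd (\<omega> w 0) < p) \<noteq> (even w = b))" by (simp add: defect_def)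
      have "lift b f (X P ?x \<omega> h) = (if defect b (X P ?x \<omega> h) w then f (w - 1) else f w)"
        using wall_at[OF g, of b w h w f] wall_at[OF g, of b w h "w - 1" f] keep[of "w + 1"] keep[of "w - 1"] 1 by auto
      then show ?thesis unfolding d using 1 by (auto simp: \<alpha>_def \<beta>_def to_def)
    next
      case 2
      have "X P ?x \<omega> h (w + 1) \<longleftrightarrow> snd (\<omega> (w + 1) 0) < p"
        using X_single[OF g s, of P ?x] cons 2 by simp
      then have d: "defect b (X P ?x \<omega> h) (w + 1) \<longleftrightarrow> ((snd (\<omega> (w + 1) 0) < p) = (even w = b))" by (auto simp: defect_def)
      have "lift b f (X P ?x \<omega> h) = (if defect b (X P ?x \<omega> h) (w + 1) then f w else f (w + 1))"
        using wall_at[OF g, of b w h w f] wall_at[OF g, of b w h "w + 1" f] keep[of "w + 2"] keep[of w] 2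
        by (auto simp: add.commute[of 2 w])
      then show ?thesis unfolding d using 2 by (auto simp: \<alpha>_def \<beta>_def to_def)
    next
      case 3
      have "lift b f (X P ?x \<omega> h) = f w"
        using keep[of w] keep[of "w + 1"] 3 by (intro wall_at[OF g]) auto
      then show ?thesis using 3 by (simp add: \<alpha>_def \<beta>_def to_def)
    qed
  qed (use f in \<open>auto simp: \<alpha>_def \<beta>_def to_def\<close>)
  moreover have "(\<Sum>j\<in>?K. (\<alpha> j * (1 - measure mark_law {..<p}) + \<beta> j * measure mark_law {..<p}) - f w)
      = jump b w * (f (w - 1) + f (w + 1) - 2 * f w)"
    unfolding pu by (simp add: \<alpha>_def \<beta>_def to_def jump_def algebra_simps)
  moreover have "real (card ?K) = 4" by simp
  ultimately show ?thesis by (simp only: power_mult_distrib) (simp add: mult.assoc)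
qed

section \<open>Comparison principle and survival of the wall in intervals\<close>

definition "m0 = min p (1 - p)"

lemma m0: "0 < m0" "m0 \<le> jump b w" "jump b w \<le> 1" "0 < jump b w"
  using p by (auto simp: m0_def jump_def)

text \<open>A comparison principle: \<open>v\<close> is a subsolution of the backward equation of
  the wall process, up to \<open>C * h^2\<close> in each step. Chaining \<open>n\<close> steps of
  length \<open>t / n\<close> adds an error of \<open>t^2 * D / n\<close>, which vanishes as
  \<open>n\<close> grows.\<close>

lemma wall_sub:
  fixes v :: "real \<Rightarrow> int \<Rightarrow> real"
  assumes t: "t \<ge> 0" and C: "C \<ge> 0" and vB: "\<And>s w. 0 \<le> s \<Longrightarrow> s \<le> t \<Longrightarrow> \<bar>v s w\<bar> \<le> B"
    and step: "\<And>s h w. 0 < h \<Longrightarrow> h \<le> 1 / 2 \<Longrightarrow> 0 \<le> s \<Longrightarrow> s + h \<le> t \<Longrightarrow>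
      v s w - C * h^2 \<le> v (s + h) w + h * jump b w * (v (s + h) (w - 1) + v (s + h) (w + 1) - 2 * v (s + h) w)"
  shows "v 0 w \<le> avg P t (lift b (v t)) (conf b w)"
proof (cases "t = 0")
  case True
  then show ?thesis by (simp add: avg_0 measurable_lift)
next
  case False
  with t have t: "t > 0" by simp
  define D where "D = C + 32 * B"
  have B: "B \<ge> 0" using vB[of 0 0] t by (intro order_trans[OF abs_ge_zero]) auto
  have bound: "v 0 w - t^2 * D / real n \<le> avg P t (lift b (v t)) (conf b w)" if n: "real n \<ge> max 1 (2 * t)" for n
  proof -
    define h where "h = t / real n"
    have n0: "real n > 0" "2 * t \<le> real n" using n by auto
    have h: "0 < h" "h \<le> 1 / 2" using t n0 by (simp_all add: h_def divide_le_eq)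
    have nh: "real n * h = t" using n0 by (simp add: h_def)
    have "k \<le> n \<Longrightarrow> v 0 w - real k * (D * h^2) \<le> avg P (real k * h) (lift b (v (real k * h))) (conf b w)" for k
    proof (induction k)
      case 0
      then show ?case by (simp add: avg_0 measurable_lift)
    next
      case (Suc k)
      define s where "s = real k * h"
      have s: "0 \<le> s" "real (Suc k) * h = s + h" using h by (simp_all add: s_def distrib_right)
      have "real (Suc k) * h \<le> real n * h" using Suc.prems h by (intro mult_right_mono) auto
      then have sh: "s + h \<le> t" using nh s by simp
      have Bs: "\<bar>v s w\<bar> \<le> B" "\<bar>v (s + h) w\<bar> \<le> B" for w using vB sh s h by auto
      have "avg P s (lift b (v s)) (conf b w) - D * h^2 = avg P s (\<lambda>y. lift b (v s) y - D * h^2) (conf b w)"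
        by (rule avg_minus_const[symmetric, OF measurable_lift lift_abs_le[OF Bs(1)]])
      also have "\<dots> \<le> avg P s (avg P h (lift b (v (s + h)))) (conf b w)"
      proof (rule avg_conf_mono[OF _ _ measurable_avg[OF measurable_lift] avg_abs_le[OF measurable_lift lift_abs_le[OF Bs(2)]]])
        show "(\<lambda>y. lift b (v s) y - D * h^2) \<in> borel_measurable config_space"
          by (intro borel_measurable_diff measurable_lift borel_measurable_const)
        show "\<bar>lift b (v s) y - D * h^2\<bar> \<le> B + \<bar>D * h^2\<bar>" for y
        proof -
          have "\<bar>lift b (v s) y\<bar> \<le> B" by (rule lift_abs_le) (rule Bs)
          then show ?thesis using abs_triangle_ineq4[of "lift b (v s) y" "D * h^2"] by linarith
        qed
        fix u
        have "v s u - C * h^2 \<le> v (s + h) u + h * jump b u * (v (s + h) (u - 1) + v (s + h) (u + 1) - 2 * v (s + h) u)"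
          by (rule step[OF h s(1) sh])
        moreover have "\<bar>avg P h (lift b (v (s + h))) (conf b u) -
            (v (s + h) u + h * jump b u * (v (s + h) (u - 1) + v (s + h) (u + 1) - 2 * v (s + h) u))\<bar> \<le> 32 * B * h^2"
          by (rule wall_block[OF less_imp_le[OF h(1)] Bs(2)])
        ultimately show "lift b (v s) (conf b u) - D * h^2 \<le> avg P h (lift b (v (s + h))) (conf b u)"
          unfolding lift_conf D_def distrib_right by linarith
      qed
      also have "\<dots> = avg P (s + h) (lift b (v (s + h))) (conf b w)"
        by (rule avg_add[symmetric, OF measurable_lift lift_abs_le[OF Bs(2)]]) (use s h in auto)
      finally have "avg P s (lift b (v s)) (conf b w) - D * h^2 \<le> avg P (s + h) (lift b (v (s + h))) (conf b w)" .
      moreover have "v 0 w - real k * (D * h^2) \<le> avg P s (lift b (v s)) (conf b w)"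
        unfolding s_def by (rule Suc.IH) (use Suc.prems in simp)
      ultimately show ?case unfolding s(2) by (simp add: distrib_right)
    qed
    from this[of n] have "v 0 w - real n * (D * h^2) \<le> avg P t (lift b (v t)) (conf b w)" unfolding nh by simp
    moreover have "real n * (D * h^2) = t^2 * D / real n"
      using n0 by (simp add: h_def power2_eq_square)
    ultimately show ?thesis by simp
  qed
  have "(\<lambda>n. v 0 w - t^2 * D / real n) \<longlonglongrightarrow> v 0 w - 0"
    by (intro tendsto_diff tendsto_const lim_const_over_n)
  moreover have "\<forall>\<^sub>F n in sequentially. v 0 w - t^2 * D / real n \<le> avg P t (lift b (v t)) (conf b w)"
  proof -
    have "\<forall>\<^sub>F n in sequentially. max 1 (2 * t) \<le> real n"
      using filterlim_real_sequentially unfolding filterlim_at_top by blast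
    then show ?thesis by eventually_elim (rule bound)
  qed
  ultimately show ?thesis
    using tendsto_upperbound[of "\<lambda>n. v 0 w - t^2 * D / real n" "v 0 w" sequentially] by simp
qed

definition "K0 = 144 / m0"

lemma K0: "K0 > 0" using m0 by (simp add: K0_def)

text \<open>By \<open>bump_step\<close> a bump with moving centre is a subsolution after
  multiplication with an increasing exponential. Thus an interval of radius \<open>M\<close> can be
  transported during time \<open>M^2\<close> over a distance of order \<open>M\<close> at a cost
  independent of \<open>M\<close>.\<close>

lemma bump_avg:
  assumes M: "M \<ge> 1" and \<delta>: "\<bar>\<delta>\<bar> \<le> 3 / M" and t: "t \<ge> 0"
  shows "bump M (real_of_int w - c) \<le> exp (K0 / M^2 * t) * avg P t (lift b (\<lambda>w. bump M (real_of_int w - c - \<delta> * t))) (conf b w)"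
proof -
  define \<kappa> where "\<kappa> = K0 / M^2"
  have \<kappa>: "\<kappa> \<ge> 0" using K0 by (simp add: \<kappa>_def)
  define v where "v s w = exp (\<kappa> * s) * bump M (real_of_int w - c - \<delta> * s)" for s and w :: int
  define C where "C = exp (\<kappa> * t) * (144 + 2 * K0 * M^2)"
  have "v 0 w \<le> avg P t (lift b (v t)) (conf b w)"
  proof (rule wall_sub[OF t, where C=C and B="exp (\<kappa> * t) * M^4"])
    show "C \<ge> 0" using K0 by (simp add: C_def)
    show "\<bar>v s w\<bar> \<le> exp (\<kappa> * t) * M^4" if "0 \<le> s" "s \<le> t" for s w
      unfolding v_def abs_mult using that \<kappa> bump_le[of M] bump_nonneg[of M]
      by (intro mult_mono) (auto intro: mult_left_mono)
    fix s h w assume h: "0 < h" "h \<le> 1 / 2" and s: "0 \<le> s" "s + h \<le> t"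
    \<comment> \<open>The position relative to the new centre; \<open>z + \<delta> * h\<close> is
      the one relative to the old centre.\<close>
    define z where "z = real_of_int w - c - \<delta> * (s + h)"
    define A where "A = bump M z + h * jump b w * (bump M (z - 1) + bump M (z + 1) - 2 * bump M z)"
    have "bump M (z + \<delta> * h) - (144 + 2 * (144 / m0) * M^2) * h^2 \<le> exp (144 / m0 / M^2 * h) * A"
      unfolding A_def by (rule bump_step[OF M \<delta> _ h(2) m0(1,2,3)]) (use h in simp)
    then have *: "bump M (z + \<delta> * h) - (144 + 2 * K0 * M^2) * h^2 \<le> exp (\<kappa> * h) * A"
      by (simp only: K0_def \<kappa>_def)
    have zh: "z + \<delta> * h = real_of_int w - c - \<delta> * s" by (simp add: z_def algebra_simps)
    have "v s w - C * h^2 \<le> exp (\<kappa> * s) * (bump M (z + \<delta> * h) - (144 + 2 * K0 * M^2) * h^2)"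
    proof -
      have "exp (\<kappa> * s) * ((144 + 2 * K0 * M^2) * h^2) \<le> exp (\<kappa> * t) * ((144 + 2 * K0 * M^2) * h^2)"
        using s h \<kappa> K0 by (intro mult_right_mono) (auto intro!: mult_left_mono mult_nonneg_nonneg)
      then show ?thesis unfolding v_def zh C_def right_diff_distrib mult.assoc by linarith
    qed
    also have "\<dots> \<le> exp (\<kappa> * s) * (exp (\<kappa> * h) * A)" by (intro mult_left_mono *) simp
    also have "\<dots> = exp (\<kappa> * (s + h)) * A" by (simp add: distrib_left exp_add)
    also have "\<dots> = v (s + h) w + h * jump b w * (v (s + h) (w - 1) + v (s + h) (w + 1) - 2 * v (s + h) w)"
    proof -
      have "real_of_int (w - 1) - c - \<delta> * (s + h) = z - 1" "real_of_int (w + 1) - c - \<delta> * (s + h) = z + 1"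
        by (simp_all add: z_def)
      then show ?thesis unfolding v_def A_def by (simp add: z_def[symmetric] algebra_simps)
    qed
    finally show "v s w - C * h^2 \<le> v (s + h) w + h * jump b w * (v (s + h) (w - 1) + v (s + h) (w + 1) - 2 * v (s + h) w)" .
  qed
  moreover have "lift b (v t) = (\<lambda>y. exp (\<kappa> * t) * lift b (\<lambda>w. bump M (real_of_int w - c - \<delta> * t)) y)"
    by (simp add: fun_eq_iff lift_def v_def)
  ultimately show ?thesis by (simp add: v_def \<kappa>_def avg_mult)
qed

definition stay :: "config set \<Rightarrow> real \<Rightarrow> nat \<Rightarrow> config \<Rightarrow> real" where
  "stay R h l x = (\<integral>\<omega>. of_bool (\<forall>k\<le>l. X P x \<omega> (real k * h) \<in> R) \<partial>noise_law)"

lemma pred_X_in: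
  assumes R: "R \<in> sets config_space" and x: "x \<in> measurable M config_space" and \<omega>: "\<omega> \<in> measurable M noise_law"
  shows "Measurable.pred M (\<lambda>z. \<forall>k\<le>(l::nat). X P (x z) (\<omega> z) (f k) \<in> R)"
proof -
  have [measurable]: "Measurable.pred M (\<lambda>z. X P (x z) (\<omega> z) (f k) \<in> R)" for k
    by (rule pred_sets2[OF R measurable_X[OF x \<omega>]])
  show ?thesis by measurable
qed

lemma measurable_stay:
  assumes R: "R \<in> sets config_space" shows "stay R h l \<in> borel_measurable config_space" "\<bar>stay R h l x\<bar> \<le> 1"
proof -
  have 1: "(\<lambda>z. of_bool (\<forall>k\<le>l. X P (fst z) (snd z) (real k * h) \<in> R) :: real) \<in> borel_measurable (config_space \<Otimes>\<^sub>M noise_law)"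
    by (rule measurable_of_bool_pred[OF pred_X_in[OF R measurable_fst measurable_snd]])
  show "stay R h l \<in> borel_measurable config_space"
    unfolding stay_def[abs_def]
    by (rule noise.borel_measurable_lebesgue_integral) (unfold split_beta', rule 1)
  have "(\<lambda>\<omega>. of_bool (\<forall>k\<le>l. X P x \<omega> (real k * h) \<in> R) :: real) \<in> borel_measurable noise_law"
    by (rule measurable_of_bool_pred[OF pred_X_in[OF R measurable_const measurable_ident_sets[OF refl]]]) simp
  then show "\<bar>stay R h l x\<bar> \<le> 1"
    unfolding stay_def by (rule noise_integral_abs_le) (simp add: of_bool_def)
qed

lemma stay_later:
  assumes R: "R \<in> sets config_space" and h: "h \<ge> 0"
  shows "(\<integral>\<omega>. of_bool (\<forall>k\<le>l. X P x \<omega> (real (n + k) * h) \<in> R) \<partial>noise_law) = avg P (real n * h) (stay R h l) x"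
  unfolding avg_def stay_def
proof (rule integral_glue[where B=1])
  have "Measurable.pred noise_law (\<lambda>\<omega>. \<forall>k\<le>l. X P x \<omega> (real (n + k) * h) \<in> R)"
    by (rule pred_X_in[OF R measurable_const measurable_ident_sets[OF refl]]) simp
  then show "(\<lambda>\<omega>. of_bool (\<forall>k\<le>l. X P x \<omega> (real (n + k) * h) \<in> R) :: real) \<in> borel_measurable noise_law" by (rule measurable_of_bool_pred)
  have "Measurable.pred (noise_law \<Otimes>\<^sub>M noise_law) (\<lambda>z. \<forall>k\<le>l. X P (X P x (fst z) (real n * h)) (snd z) (real k * h) \<in> R)"
    by (rule pred_X_in[OF R measurable_compose[OF measurable_fst measurable_X1] measurable_snd])
  then show "(\<lambda>z. of_bool (\<forall>k\<le>l. X P (X P x (fst z) (real n * h)) (snd z) (real k * h) \<in> R) :: real)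
      \<in> borel_measurable (noise_law \<Otimes>\<^sub>M noise_law)" by (rule measurable_of_bool_pred)
  fix \<omega> \<omega>' assume g3: "good3 (real n * h) \<omega> \<omega>'"
  have "X P x (glue (real n * h) \<omega> \<omega>') (real (n + k) * h) = X P (X P x \<omega> (real n * h)) \<omega>' (real k * h)" for k
    using X_glue_ge3[OF g3, of "real k * h" P x] h by (simp add: distrib_right)
  then show "of_bool (\<forall>k\<le>l. X P x (glue (real n * h) \<omega> \<omega>') (real (n + k) * h) \<in> R)
      = (of_bool (\<forall>k\<le>l. X P (X P x \<omega> (real n * h)) \<omega>' (real k * h) \<in> R) :: real)" by simp
qed (use h in auto)

lemma stay_Suc:
  assumes R: "R \<in> sets config_space" and h: "h \<ge> 0" and x: "x \<in> R"
  shows "stay R h (Suc l) x = avg P h (stay R h l) x"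
proof -
  have "stay R h (Suc l) x = (\<integral>\<omega>. of_bool (\<forall>k\<le>l. X P x \<omega> (real (1 + k) * h) \<in> R) \<partial>noise_law)"
    unfolding stay_def
  proof (rule integral_cong_AE)
    have "Measurable.pred noise_law (\<lambda>\<omega>. \<forall>k\<le>Suc l. X P x \<omega> (real k * h) \<in> R)"
      by (rule pred_X_in[OF R measurable_const measurable_ident_sets[OF refl]]) simp
    then show "(\<lambda>\<omega>. of_bool (\<forall>k\<le>Suc l. X P x \<omega> (real k * h) \<in> R) :: real) \<in> borel_measurable noise_law"
      by (rule measurable_of_bool_pred)
    have "Measurable.pred noise_law (\<lambda>\<omega>. \<forall>k\<le>l. X P x \<omega> (real (1 + k) * h) \<in> R)"
      by (rule pred_X_in[OF R measurable_const measurable_ident_sets[OF refl]]) simp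
    then show "(\<lambda>\<omega>. of_bool (\<forall>k\<le>l. X P x \<omega> (real (1 + k) * h) \<in> R) :: real) \<in> borel_measurable noise_law"
      by (rule measurable_of_bool_pred)
    show "AE \<omega> in noise_law. of_bool (\<forall>k\<le>Suc l. X P x \<omega> (real k * h) \<in> R)
        = (of_bool (\<forall>k\<le>l. X P x \<omega> (real (1 + k) * h) \<in> R) :: real)"
      using AE_good
    proof eventually_elim
      case (elim \<omega>)
      have "(\<forall>k\<le>Suc l. X P x \<omega> (real k * h) \<in> R) \<longleftrightarrow> X P x \<omega> (real 0 * h) \<in> R \<and> (\<forall>k\<le>l. X P x \<omega> (real (Suc k) * h) \<in> R)"
        by (metis Suc_le_mono le0 not0_implies_Suc)
      then show ?case using X_0[OF elim] x by simp
    qed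
  qed
  also have "\<dots> = avg P (real 1 * h) (stay R h l) x" by (rule stay_later[OF R h])
  finally show ?thesis by simp
qed

text \<open>The bump vanishes outside \<open>V\<close> and is at most \<open>M^4\<close>, so divided
  by \<open>M^4\<close> it is a lower bound for \<open>l = 0\<close>. By \<open>bump_avg\<close>
  with a resting centre, every further step costs a factor
  \<open>exp (- (K0 / M^2 * h))\<close>.\<close>

lemma stay_lower:
  assumes M: "M \<ge> 1" and h: "h \<ge> 0" and V: "\<And>w. \<bar>real_of_int w - c\<bar> < M \<Longrightarrow> w \<in> V"
  shows "stay (conf b ` V) h l (conf b w) \<ge> exp (- (K0 / M^2) * (real l * h)) / M^4 * bump M (real_of_int w - c)"
proof (induction l arbitrary: w)
  case 0
  have R: "conf b ` V \<in> sets config_space" by (rule conf_range_sets) auto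
  show ?case
  proof (cases "w \<in> V")
    case True
    have "stay (conf b ` V) h 0 (conf b w) = (\<integral>\<omega>. 1 \<partial>noise_law)"
      unfolding stay_def
    proof (rule integral_cong_AE)
      have "Measurable.pred noise_law (\<lambda>\<omega>. \<forall>k\<le>0. X P (conf b w) \<omega> (real k * h) \<in> conf b ` V)"
        by (rule pred_X_in[OF R measurable_const measurable_ident_sets[OF refl]]) simp
      then show "(\<lambda>\<omega>. of_bool (\<forall>k\<le>0. X P (conf b w) \<omega> (real k * h) \<in> conf b ` V) :: real) \<in> borel_measurable noise_law"
        by (rule measurable_of_bool_pred)
      show "AE \<omega> in noise_law. of_bool (\<forall>k\<le>0. X P (conf b w) \<omega> (real k * h) \<in> conf b ` V) = (1 :: real)"
        using AE_good by eventually_elim (use True in \<open>simp add: X_0\<close>)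
    qed simp
    then show ?thesis using bump_le[of M "real_of_int w - c"] M by (simp add: divide_le_eq)
  next
    case False
    then have "M \<le> \<bar>real_of_int w - c\<bar>" using V[of w] not_le by blast
    then have "bump M (real_of_int w - c) = 0" using M by (intro bump_outside) auto
    moreover have "0 \<le> stay (conf b ` V) h 0 (conf b w)" unfolding stay_def by (rule integral_nonneg_AE) simp
    ultimately show ?thesis by simp
  qed
next
  case (Suc l)
  have R: "conf b ` V \<in> sets config_space" by (rule conf_range_sets) auto
  let ?g = "\<lambda>w. bump M (real_of_int w - c)"
  define a where "a = exp (- (K0 / M^2) * (real l * h)) / M^4"
  have a: "a \<ge> 0" by (simp add: a_def)
  show ?case
  proof (cases "w \<in> V")
    case True
    have gB: "\<bar>?g w\<bar> \<le> M^4" for w using bump_le[of M] bump_nonneg[of M] by simp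
    have "?g w \<le> exp (K0 / M^2 * h) * avg P h (lift b ?g) (conf b w)"
      using bump_avg[OF M _ h, of 0 w c b] M by simp
    then have "exp (- (K0 / M^2 * h)) * ?g w \<le> exp (- (K0 / M^2 * h)) * (exp (K0 / M^2 * h) * avg P h (lift b ?g) (conf b w))"
      by (rule mult_left_mono) simp
    also have "\<dots> = avg P h (lift b ?g) (conf b w)" by (simp add: mult.assoc[symmetric] exp_minus)
    finally have "a * (exp (- (K0 / M^2 * h)) * ?g w) \<le> a * avg P h (lift b ?g) (conf b w)"
      using a by (rule mult_left_mono)
    also have "\<dots> = avg P h (\<lambda>y. a * lift b ?g y) (conf b w)" by (simp only: avg_mult)
    also have "\<dots> \<le> avg P h (stay (conf b ` V) h l) (conf b w)"
    proof (rule avg_conf_mono[OF _ _ measurable_stay[OF R]])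
      show "(\<lambda>y. a * lift b ?g y) \<in> borel_measurable config_space"
        by (intro borel_measurable_times borel_measurable_const measurable_lift)
      show "\<bar>a * lift b ?g y\<bar> \<le> a * M^4" for y
      proof -
        have "\<bar>lift b ?g y\<bar> \<le> M^4" by (rule lift_abs_le) (rule gB)
        then show ?thesis using a by (simp add: abs_mult mult_left_mono)
      qed
      show "a * lift b ?g (conf b w') \<le> stay (conf b ` V) h l (conf b w')" for w'
        using Suc.IH[of w'] by (simp add: a_def)
    qed
    also have "\<dots> = stay (conf b ` V) h (Suc l) (conf b w)"
      by (rule stay_Suc[symmetric, OF R h]) (use True in simp)
    finally have "a * (exp (- (K0 / M^2 * h)) * ?g w) \<le> stay (conf b ` V) h (Suc l) (conf b w)" .
    moreover have "exp (- (K0 / M^2) * (real (Suc l) * h)) / M^4 = a * exp (- (K0 / M^2 * h))"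
      by (simp add: a_def exp_add[symmetric] distrib_right distrib_left)
    ultimately show ?thesis by (simp only: mult.assoc)
  next
    case False
    then have "M \<le> \<bar>real_of_int w - c\<bar>" using V[of w] not_le by blast
    then have "?g w = 0" using M by (intro bump_outside) auto
    moreover have "0 \<le> stay (conf b ` V) h (Suc l) (conf b w)" unfolding stay_def by (rule integral_nonneg_AE) simp
    ultimately show ?thesis by simp
  qed
qed

text \<open>Diffusive scaling with \<open>M = sqrt (real n * h)\<close>: during time
  \<open>M^2\<close> the centre moves by \<open>3 * M\<close> in direction \<open>\<sigma>\<close>,
  at cost \<open>exp (- K0)\<close>, and then the interval of radius \<open>M\<close> around it is
  kept for time \<open>2 * M^2\<close>, at cost \<open>exp (- 2 * K0)\<close>. Its points are more
  than \<open>2 * M\<close> away from the start, and the bound does not depend on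
  \<open>n\<close>.\<close>

lemma escape_probability:
  assumes h: "h > 0" and n: "real n * h \<ge> 1" and \<sigma>: "\<bar>\<sigma>\<bar> = (1 :: real)"
    and V: "\<And>w'. \<sigma> * (real_of_int w' - real_of_int w) > 2 * sqrt (real n * h) \<Longrightarrow> w' \<in> V"
  shows "(\<integral>\<omega>. of_bool (\<forall>k\<le>2 * n. X P (conf b w) \<omega> (real (n + k) * h) \<in> conf b ` V) \<partial>noise_law) \<ge> exp (- 3 * K0)"
proof -
  define M where "M = sqrt (real n * h)"
  have M2: "M^2 = real n * h" using n by (simp add: M_def)
  have M: "M \<ge> 1" using n by (simp add: M_def)
  define \<delta> where "\<delta> = \<sigma> * 3 / M"
  have \<delta>: "\<bar>\<delta>\<bar> \<le> 3 / M" using \<sigma> M by (simp add: \<delta>_def abs_mult)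
  define c where "c = real_of_int w + \<delta> * (real n * h)"
  have \<sigma>2: "\<sigma> * \<sigma> = 1" using \<sigma> by (metis abs_mult_self_eq mult_1)
  have \<delta>n: "\<delta> * (real n * h) = \<sigma> * (3 * M)"
    using M unfolding M2[symmetric] by (simp add: \<delta>_def power2_eq_square)
  have VM: "w' \<in> V" if "\<bar>real_of_int w' - c\<bar> < M" for w'
  proof (rule V)
    have "\<bar>\<sigma> * (real_of_int w' - c)\<bar> < M" using that \<sigma> by (simp add: abs_mult)
    moreover have "\<sigma> * (real_of_int w' - c) = \<sigma> * (real_of_int w' - real_of_int w) - (\<sigma> * \<sigma>) * (3 * M)"
      unfolding c_def \<delta>n by (simp add: algebra_simps)
    ultimately show "\<sigma> * (real_of_int w' - real_of_int w) > 2 * sqrt (real n * h)"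
      unfolding \<sigma>2 M_def[symmetric] by linarith
  qed
  have R: "conf b ` V \<in> sets config_space" by (rule conf_range_sets) auto
  let ?g = "\<lambda>w. bump M (real_of_int w - c)"
  define a where "a = exp (- (K0 / M^2) * (real (2 * n) * h)) / M^4"
  have a: "a \<ge> 0" by (simp add: a_def)
  have a_eq: "a = exp (- 2 * K0) / M^4"
  proof -
    have "K0 / N * (2 * N) = 2 * K0" if "N \<noteq> 0" for N using that by simp
    from this[of "M^2"] have "K0 / M^2 * (2 * M^2) = 2 * K0" using M by simp
    moreover have "real (2 * n) * h = 2 * M^2" unfolding M2 by simp
    ultimately have "K0 / M^2 * (real (2 * n) * h) = 2 * K0" by (simp only:)
    then show ?thesis by (simp add: a_def)
  qed
  have gB: "\<bar>?g w\<bar> \<le> M^4" for w using bump_le[of M] bump_nonneg[of M] by simp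
  have "bump M (real_of_int w - real_of_int w) \<le> exp (K0 / M^2 * (real n * h)) *
      avg P (real n * h) (lift b (\<lambda>u. bump M (real_of_int u - real_of_int w - \<delta> * (real n * h)))) (conf b w)"
    by (rule bump_avg[OF M \<delta>]) (use h in simp)
  moreover have "bump M (real_of_int w - real_of_int w) = M^4" by (simp add: bump_def flip: power_mult)
  moreover have "K0 / M^2 * (real n * h) = K0"
  proof -
    have "K0 / N * N = K0" if "N \<noteq> 0" for N using that by simp
    from this[of "M^2"] show ?thesis using M unfolding M2[symmetric] by simp
  qed
  moreover have "(\<lambda>u. bump M (real_of_int u - real_of_int w - \<delta> * (real n * h))) = ?g"
    by (simp add: c_def algebra_simps)
  ultimately have "M^4 \<le> exp K0 * avg P (real n * h) (lift b ?g) (conf b w)" by simp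
  then have "exp (- 3 * K0) / M^4 * M^4 \<le> exp (- 3 * K0) / M^4 * (exp K0 * avg P (real n * h) (lift b ?g) (conf b w))"
    by (rule mult_left_mono) simp
  also have "\<dots> = a * avg P (real n * h) (lift b ?g) (conf b w)"
    unfolding a_eq by (simp add: exp_add[symmetric] mult.assoc[symmetric])
  also have "\<dots> = avg P (real n * h) (\<lambda>y. a * lift b ?g y) (conf b w)" by (simp only: avg_mult)
  also have "\<dots> \<le> avg P (real n * h) (stay (conf b ` V) h (2 * n)) (conf b w)"
  proof (rule avg_conf_mono[OF _ _ measurable_stay[OF R]])
    show "(\<lambda>y. a * lift b ?g y) \<in> borel_measurable config_space"
      by (intro borel_measurable_times borel_measurable_const measurable_lift)
    show "\<bar>a * lift b ?g y\<bar> \<le> a * M^4" for y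
    proof -
      have "\<bar>lift b ?g y\<bar> \<le> M^4" by (rule lift_abs_le) (rule gB)
      then show ?thesis using a by (simp add: abs_mult mult_left_mono)
    qed
    show "a * lift b ?g (conf b w') \<le> stay (conf b ` V) h (2 * n) (conf b w')" for w'
      using stay_lower[OF M less_imp_le[OF h] VM, where b=b and l="2 * n" and w=w'] by (simp add: a_def)
  qed
  also have "\<dots> = (\<integral>\<omega>. of_bool (\<forall>k\<le>2 * n. X P (conf b w) \<omega> (real (n + k) * h) \<in> conf b ` V) \<partial>noise_law)"
    by (rule stay_later[symmetric, OF R less_imp_le[OF h]])
  finally show ?thesis using M by simp
qed

end

subsection \<open>Occupation times and the profit of game B\<close>

lemma tent_abs_le: "L \<ge> 0 \<Longrightarrow> \<bar>tent L x\<bar> \<le> L^2"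
  unfolding tent_def by (auto intro!: power_mono)

lemma skel_avg_cmult: "skel_avg h q x \<omega> (\<lambda>y. c * F y) n = c * skel_avg h q x \<omega> F n"
  by (simp add: skel_avg_def sum_distrib_left)

lemma skel_avg_diff: "skel_avg h q x \<omega> (\<lambda>y. F y - G y) n = skel_avg h q x \<omega> F n - skel_avg h q x \<omega> G n"
  by (simp add: skel_avg_def sum_subtractf diff_divide_distrib)

lemma skel_avg_sum: "skel_avg h q x \<omega> (\<lambda>y. \<Sum>i\<in>A. F i y) n = (\<Sum>i\<in>A. skel_avg h q x \<omega> (F i) n)"
  unfolding skel_avg_def by (subst sum.swap) (simp add: sum_divide_distrib)

lemma skel_avg_abs_le:
  assumes "\<And>k. \<bar>F (X q x \<omega> (real k * h))\<bar> \<le> G (X q x \<omega> (real k * h))"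
  shows "\<bar>skel_avg h q x \<omega> F n\<bar> \<le> skel_avg h q x \<omega> G n"
proof -
  have "\<bar>\<Sum>k<n. F (X q x \<omega> (real k * h))\<bar> \<le> (\<Sum>k<n. G (X q x \<omega> (real k * h)))"
    by (rule order_trans[OF sum_abs sum_mono]) (rule assms)
  then show ?thesis by (simp add: skel_avg_def divide_right_mono)
qed

definition sgn_parity :: "bool \<Rightarrow> int \<Rightarrow> real" where
  "sgn_parity b i = (if even i = b then 1 else - 1)"

lemma sum_sgn_parity: "(\<Sum>i\<in>{a..<a + int N}. sgn_parity b i) = (if even N then 0 else sgn_parity b a)"
proof (induction N)
  case (Suc N)
  have "{a..<a + int (Suc N)} = insert (a + int N) {a..<a + int N}" by auto
  with Suc show ?case by (auto simp: sgn_parity_def)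
qed simp

text \<open>Player \<open>i\<close> sees an undisturbed pattern if both neighbours are on the same
  side of the wall, that is, for \<open>v \<ge> i + 1\<close> or \<open>v \<le> i - 2\<close>. For
  the whole ensemble this leaves out the \<open>N + 1\<close> positions from \<open>a - 1\<close> to
  \<open>a + N - 1\<close>.\<close>

definition side :: "int \<Rightarrow> nat \<Rightarrow> int \<Rightarrow> real" where
  "side a N v = (if v \<ge> a + int N then 1 else if v \<le> a - 2 then - 1 else 0)"

context game_B
begin

text \<open>Pointwise \<open>F - avg P h F\<close> is at least \<open>c\<close> times the indicator
  of a visit to \<open>j\<close>, minus \<open>34 * h\<close>, while its long-run average is 0 by
  \<open>skeleton_LLN\<close>.\<close>

lemma occupation:
  assumes L: "L \<ge> 1"
  shows "AE \<omega> in noise_law. \<forall>\<epsilon>>0. \<forall>\<^sub>F n in sequentially.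
    skel_avg (1 / L^2) P (conf b w) \<omega> (lift b (\<lambda>v. of_bool (v = j))) n \<le> 9 / (m0 * L) + \<epsilon>"
proof -
  \<comment> \<open>For this mesh the block error \<open>32 * L^2 * h^2\<close> equals
    \<open>32 * h\<close>, of the same order as the drift \<open>2 * h\<close> away from
    \<open>j\<close>. Together they give \<open>34 * h / c = (17 / 2) / (m0 * L)\<close>, rounded up
    to 9.\<close>
  define h where "h = 1 / L^2"
  have h: "h > 0" "h * L^2 = 1" using L by (simp_all add: h_def)
  define f where "f v = tent L (real_of_int (v - j))" for v
  define F where "F = lift b f"
  have fB: "\<bar>f v\<bar> \<le> L^2" for v unfolding f_def using L by (intro tent_abs_le) simp
  have F: "F \<in> borel_measurable config_space" "\<bar>F y\<bar> \<le> L^2" for y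
    unfolding F_def by (rule measurable_lift) (rule lift_abs_le[OF fB])
  define c where "c = 4 * L * h * m0"
  have c: "c > 0" using L h m0 by (simp add: c_def)
  have pw: "of_bool (v = j) \<le> (F (conf b v) - avg P h F (conf b v)) / c + 9 / (m0 * L)" for v
  proof -
    define D where "D = f (v - 1) + f (v + 1) - 2 * f v"
    have "avg P h F (conf b v) \<le> f v + h * jump b v * D + 32 * L^2 * h^2"
      using wall_block[of h f "L^2" b v, OF less_imp_le[OF h(1)] fB] unfolding F_def D_def by linarith
    also have "32 * L^2 * h^2 = 32 * h"
    proof -
      have "32 * L^2 * h^2 = 32 * h * (h * L^2)" by (simp add: power2_eq_square)
      then show ?thesis by (simp only: h(2))
    qed
    finally have avg: "avg P h F (conf b v) \<le> F (conf b v) + h * jump b v * D + 32 * h" by (simp add: F_def)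
    have D: "D \<le> 2 - (if v = j then 4 * L else 0)"
      using tent_second_difference[OF L, of "v - j"] by (simp add: D_def f_def algebra_simps)
    have hj: "h * jump b v \<ge> 0" "h * jump b v \<le> h" using h m0(3,4)[of b v] by (simp_all add: mult_le_cancel_left1)
    have "h * jump b v * D \<le> 2 * h - c * of_bool (v = j)"
    proof (cases "v = j")
      case True
      have "h * jump b v * D \<le> h * jump b v * (2 - 4 * L)" using D True hj by (intro mult_left_mono) auto
      also have "\<dots> = 2 * (h * jump b v) - (4 * L * h) * jump b v" by (simp add: algebra_simps)
      also have "\<dots> \<le> 2 * h - (4 * L * h) * m0"
        using hj h L m0(2)[of b v] by (intro diff_mono mult_left_mono) auto
      finally show ?thesis using True by (simp add: c_def)
    next
      case False
      have "h * jump b v * D \<le> h * jump b v * 2" using D False hj by (intro mult_left_mono) auto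
      then show ?thesis using hj False by simp
    qed
    with avg have "c * of_bool (v = j) \<le> (F (conf b v) - avg P h F (conf b v)) + 34 * h" by linarith
    then have "of_bool (v = j) \<le> ((F (conf b v) - avg P h F (conf b v)) + 34 * h) / c"
      using c by (simp add: pos_le_divide_eq mult.commute)
    also have "\<dots> = (F (conf b v) - avg P h F (conf b v)) / c + 34 * h / c" by (simp add: add_divide_distrib)
    also have "34 * h / c = (17 / 2) / (m0 * L)" using h L m0 by (simp add: c_def field_simps)
    also have "\<dots> \<le> 9 / (m0 * L)" using L m0(1) by (intro divide_right_mono) auto
    finally show ?thesis by simp
  qed
  from AE_good skeleton_LLN[OF less_imp_le[OF h(1)] F, of P "conf b w"] show ?thesis
  proof eventually_elim
    case (elim \<omega>)
    define y where "y k = X P (conf b w) \<omega> (real k * h)" for k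
    define T where "T n = (\<Sum>k<n. F (y k) - avg P h F (y k)) / real n" for n
    have T: "T \<longlonglongrightarrow> 0" using elim(2) by (simp add: T_def[abs_def] y_def)
    have le: "lift b (\<lambda>v. of_bool (v = j)) (y k) \<le> (F (y k) - avg P h F (y k)) / c + 9 / (m0 * L)" for k
    proof -
      obtain v where v: "y k = conf b v" unfolding y_def by (rule X_conf[OF elim(1)])
      show ?thesis using pw[of v] by (simp add: v)
    qed
    show ?case
    proof (intro allI impI)
      fix \<epsilon> :: real assume "\<epsilon> > 0"
      then have "\<forall>\<^sub>F n in sequentially. T n < \<epsilon> * c"
        using order_tendstoD(2)[OF T, of "\<epsilon> * c"] c by simp
      then show "\<forall>\<^sub>F n in sequentially.
          skel_avg (1 / L^2) P (conf b w) \<omega> (lift b (\<lambda>v. of_bool (v = j))) n \<le> 9 / (m0 * L) + \<epsilon>"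
        using eventually_gt_at_top[of 0]
      proof eventually_elim
        case (elim n)
        have "skel_avg h P (conf b w) \<omega> (lift b (\<lambda>v. of_bool (v = j))) n
            \<le> (\<Sum>k<n. (F (y k) - avg P h F (y k)) / c + 9 / (m0 * L)) / real n"
          unfolding skel_avg_def y_def[symmetric] by (intro divide_right_mono sum_mono le) simp
        also have "\<dots> = T n / c + 9 / (m0 * L)"
          using elim(2) by (simp add: T_def sum.distrib add_divide_distrib sum_divide_distrib[symmetric])
        also have "T n / c \<le> \<epsilon>" using elim(1) c by (simp add: pos_divide_le_eq)
        finally show ?case unfolding h_def by simp
      qed
    qed
  qed
qed

lemma drift_conf:
  "i + 1 \<le> v \<Longrightarrow> 2 * P (nbhd (conf b v) i) - 1 = sgn_parity b i"
  "v \<le> i - 2 \<Longrightarrow> 2 * P (nbhd (conf b v) i) - 1 = - sgn_parity b i"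
  using P by (auto simp: nbhd_eq conf_def sgn_parity_def)

text \<open>Off the \<open>N + 1\<close> positions at the ensemble the two sides agree exactly; on
  them \<open>side\<close> is 0 and each player has drift at most 1 in absolute value.\<close>

lemma drift_sum_conf:
  "\<bar>(\<Sum>i\<in>{a..<a + int N}. 2 * P (nbhd (conf b v) i) - 1) - (\<Sum>i\<in>{a..<a + int N}. sgn_parity b i) * side a N v\<bar>
    \<le> real N * (\<Sum>j\<in>{a - 1..<a + int N}. of_bool (v = j))"
proof -
  consider "v \<ge> a + int N" | "v \<le> a - 2" "\<not> v \<ge> a + int N" | "a - 1 \<le> v" "v < a + int N" by linarith
  then show ?thesis
  proof cases
    case 1
    then have "(\<Sum>i\<in>{a..<a + int N}. 2 * P (nbhd (conf b v) i) - 1) = (\<Sum>i\<in>{a..<a + int N}. sgn_parity b i)"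
      by (intro sum.cong refl drift_conf(1)) auto
    then show ?thesis using 1 by (simp add: side_def sum_nonneg)
  next
    case 2
    then have "(\<Sum>i\<in>{a..<a + int N}. 2 * P (nbhd (conf b v) i) - 1) = (\<Sum>i\<in>{a..<a + int N}. - sgn_parity b i)"
      by (intro sum.cong refl drift_conf(2)) auto
    then show ?thesis using 2 by (simp add: side_def sum_nonneg sum_negf)
  next
    case 3
    have "(\<Sum>j\<in>{a - 1..<a + int N}. of_bool (v = j)) = (1 :: real)"
      using 3 by (simp add: of_bool_def)
    moreover have "\<bar>\<Sum>i\<in>{a..<a + int N}. 2 * P (nbhd (conf b v) i) - 1\<bar> \<le> (\<Sum>i\<in>{a..<a + int N}. 1)"
    proof (rule order_trans[OF sum_abs sum_mono])
      fix i show "\<bar>2 * P (nbhd (conf b v) i) - 1\<bar> \<le> 1" using P_bounds[of "conf b v" i] by linarith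
    qed
    ultimately show ?thesis using 3 by (simp add: side_def)
  qed
qed

lemma skeleton_profit:
  assumes L: "L \<ge> 1"
  shows "AE \<omega> in noise_law. \<forall>\<epsilon>>0. \<forall>\<^sub>F n in sequentially.
    \<bar>(\<Sum>i\<in>{a..<a + int N}. skel_avg (1 / L^2) P (conf b w) \<omega> (\<lambda>y. 2 * P (nbhd y i) - 1) n)
      - (\<Sum>i\<in>{a..<a + int N}. sgn_parity b i) * skel_avg (1 / L^2) P (conf b w) \<omega> (lift b (side a N)) n\<bar>
    \<le> real N * real (N + 1) * 9 / m0 / L + \<epsilon>"
proof -
  define J where "J = {a - 1..<a + int N}"
  have J: "card J = N + 1" "finite J" by (simp_all add: J_def nat_add_distrib)
  define h where "h = 1 / L^2"
  have "AE \<omega> in noise_law. \<forall>j. \<forall>\<epsilon>>0. \<forall>\<^sub>F n in sequentially.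
    skel_avg h P (conf b w) \<omega> (lift b (\<lambda>v. of_bool (v = j))) n \<le> 9 / (m0 * L) + \<epsilon>"
    unfolding AE_all_countable h_def by (intro allI occupation L)
  with AE_good show ?thesis unfolding h_def[symmetric]
  proof eventually_elim
    case (elim \<omega>)
    let ?A = "{a..<a + int N}" and ?sk = "skel_avg h P (conf b w) \<omega>"
    let ?S = "\<Sum>i\<in>?A. sgn_parity b i"
    have main: "\<bar>(\<Sum>i\<in>?A. ?sk (\<lambda>y. 2 * P (nbhd y i) - 1) n) - ?S * ?sk (lift b (side a N)) n\<bar>
        \<le> real N * (\<Sum>j\<in>J. ?sk (lift b (\<lambda>v. of_bool (v = j))) n)" for n
    proof -
      let ?F = "\<lambda>y. (\<Sum>i\<in>?A. 2 * P (nbhd y i) - 1) - ?S * lift b (side a N) y"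
      let ?G = "\<lambda>y. real N * (\<Sum>j\<in>J. lift b (\<lambda>v. of_bool (v = j)) y)"
      have "\<bar>?sk ?F n\<bar> \<le> ?sk ?G n"
      proof (rule skel_avg_abs_le)
        fix k
        obtain v where v: "X P (conf b w) \<omega> (real k * h) = conf b v" by (rule X_conf[OF elim(1)])
        show "\<bar>?F (X P (conf b w) \<omega> (real k * h))\<bar> \<le> ?G (X P (conf b w) \<omega> (real k * h))"
          using drift_sum_conf[where b=b and v=v and a=a and N=N] unfolding v J_def lift_conf .
      qed
      then show ?thesis unfolding skel_avg_diff skel_avg_cmult skel_avg_sum .
    qed
    show ?case
    proof (intro allI impI)
      fix \<epsilon> :: real assume e: "\<epsilon> > 0"
      \<comment> \<open>\<open>N * (N + 1)\<close> shares of \<open>\<eta>\<close> are spent; the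
        additional 1 keeps \<open>K\<close> positive.\<close>
      define K where "K = real N * real (N + 1) + 1"
      have K: "K > 0" unfolding K_def by (rule add_nonneg_pos) auto
      define \<eta> where "\<eta> = \<epsilon> / K"
      have \<eta>: "\<eta> > 0" "K * \<eta> = \<epsilon>" using e K by (simp_all add: \<eta>_def)
      have "\<forall>\<^sub>F n in sequentially. \<forall>j\<in>J. ?sk (lift b (\<lambda>v. of_bool (v = j))) n \<le> 9 / (m0 * L) + \<eta>"
        using elim(2) \<eta>(1) J(2) by (simp add: eventually_ball_finite)
      then show "\<forall>\<^sub>F n in sequentially. \<bar>(\<Sum>i\<in>?A. ?sk (\<lambda>y. 2 * P (nbhd y i) - 1) n) - ?S * ?sk (lift b (side a N)) n\<bar>
          \<le> real N * real (N + 1) * 9 / m0 / L + \<epsilon>"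
      proof eventually_elim
        case (elim n)
        have "(\<Sum>j\<in>J. ?sk (lift b (\<lambda>v. of_bool (v = j))) n) \<le> (\<Sum>j\<in>J. 9 / (m0 * L) + \<eta>)"
          using elim by (intro sum_mono) auto
        then have "real N * (\<Sum>j\<in>J. ?sk (lift b (\<lambda>v. of_bool (v = j))) n) \<le> real N * (real (N + 1) * (9 / (m0 * L) + \<eta>))"
          using J(1) by (intro mult_left_mono) auto
        also have "\<dots> = real N * real (N + 1) * 9 / m0 / L + (K * \<eta> - \<eta>)"
          by (simp add: K_def algebra_simps)
        also have "\<dots> \<le> real N * real (N + 1) * 9 / m0 / L + \<epsilon>" using \<eta> by simp
        finally show ?case using main[of n] by linarith
      qed
    qed
  qed
qed

lemma even_profit:
  assumes "even N"
  shows "AE \<omega> in noise_law. ((\<lambda>t. (\<Sum>i\<in>{a..<a + int N}. site_profit P (conf b w) \<omega> i t) / t) \<longlongrightarrow> 0) at_top"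
proof (rule profit_limitI[where hs="\<lambda>m. 1 / (real (Suc m))^2" and \<delta>="\<lambda>m. real N * real (N + 1) * 9 / m0 / real (Suc m)"])
  have l: "(\<lambda>m. 1 / real (Suc m)) \<longlonglongrightarrow> 0" by (rule LIMSEQ_Suc[OF lim_1_over_n])
  show "(\<lambda>m. 1 / (real (Suc m))^2) \<longlonglongrightarrow> 0"
    using tendsto_power[OF l, of 2] by (simp only: power_divide power_one) simp
  show "(\<lambda>m. real N * real (N + 1) * 9 / m0 / real (Suc m)) \<longlonglongrightarrow> 0"
    using tendsto_mult_right_zero[OF l, of "real N * real (N + 1) * 9 / m0"] by simp
  fix m
  show "AE \<omega> in noise_law. \<forall>\<epsilon>>0. \<forall>\<^sub>F n in sequentially.
      \<bar>(\<Sum>i\<in>{a..<a + int N}. skel_avg (1 / (real (Suc m))^2) P (conf b w) \<omega> (\<lambda>y. 2 * P (nbhd y i) - 1) n) - 0\<bar>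
      \<le> real N * real (N + 1) * 9 / m0 / real (Suc m) + \<epsilon>"
    using skeleton_profit[of "real (Suc m)", where a=a and N=N and b=b and w=w] assms unfolding sum_sgn_parity by simp
qed (simp_all add: P_bounds)

text \<open>With probability bounded below the defect moves, on the diffusive scale, to either side of the
  ensemble and stays there during the last two thirds of a long time interval, so neither sign of
  the average profit can be excluded.\<close>

lemma odd_profit:
  assumes odd: "odd N"
  shows "\<not> (AE \<omega> in noise_law. ((\<lambda>t. (\<Sum>i\<in>{a..<a + int N}. site_profit P (conf b w) \<omega> i t) / t) \<longlongrightarrow> \<nu>) at_top)"
proof
  let ?A = "{a..<a + int N}"
  assume conv: "AE \<omega> in noise_law. ((\<lambda>t. (\<Sum>i\<in>?A. site_profit P (conf b w) \<omega> i t) / t) \<longlongrightarrow> \<nu>) at_top"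
  define C where "C = real N * real (N + 1) * 9 / m0"
  have C: "C \<ge> 0" using m0(1) by (simp add: C_def)
  \<comment> \<open>\<open>L\<close> makes the mesh error \<open>6 * N * h\<close> and the
    occupation error \<open>C / L\<close> together at most 1/12. Another 1/12 goes to
    \<open>\<epsilon>\<close> below, and the total 1/6 is less than the 1/3 that a persistent wall
    forces.\<close>
  define L where "L = 12 * (6 * real N + C) + 1"
  have L: "L \<ge> 1" using C by (simp add: L_def)
  define h where "h = 1 / L^2"
  have h: "h > 0" using L by (simp add: h_def)
  have small: "6 * real N * h + C / L \<le> 1 / 12"
  proof -
    have "h \<le> 1 / L" using L by (simp add: h_def power2_eq_square divide_simps)
    then have "6 * real N * h \<le> 6 * real N * (1 / L)" by (rule mult_left_mono) simp
    moreover have "(6 * real N + C) / L \<le> 1 / 12" using L by (simp add: pos_divide_le_eq L_def)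
    ultimately show ?thesis by (simp add: add_divide_distrib)
  qed
  define S where "S = sgn_parity b a"
  have S2: "S * S = 1" by (simp add: S_def sgn_parity_def)
  define R where "R \<omega> n = skel_avg h P (conf b w) \<omega> (lift b (side a N)) n" for \<omega> n
  have near: "AE \<omega> in noise_law. \<forall>\<^sub>F n in sequentially. \<bar>S * R \<omega> n - \<nu>\<bar> \<le> 1 / 6"
  proof -
    have "AE \<omega> in noise_law. \<forall>i. \<forall>\<epsilon>>0. \<forall>\<^sub>F t in at_top.
        \<bar>site_profit P (conf b w) \<omega> i t / t - skel_avg h P (conf b w) \<omega> (\<lambda>y. 2 * P (nbhd y i) - 1) (nat \<lfloor>t / h\<rfloor>)\<bar> \<le> 6 * h + \<epsilon>"
      unfolding AE_all_countable by (intro allI site_profit_avg P_bounds h)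
    with conv skeleton_profit[OF L, where a=a and N=N and b=b and w=w] show ?thesis
    proof eventually_elim
      case (elim \<omega>)
      let ?sk = "\<lambda>i. skel_avg h P (conf b w) \<omega> (\<lambda>y. 2 * P (nbhd y i) - 1)"
      \<comment> \<open>One share for each of the \<open>N\<close> players, one for the assumed
        convergence and one for the skeleton estimate.\<close>
      define \<epsilon> where "\<epsilon> = 1 / (12 * (real N + 2))"
      have \<epsilon>: "\<epsilon> > 0" "real N * \<epsilon> + 2 * \<epsilon> = 1 / 12"
        by (simp_all add: \<epsilon>_def add_pos_nonneg flip: distrib_right) (simp add: divide_simps)
      have lim: "filterlim (\<lambda>n. real n * h) at_top sequentially"
        by (rule filterlim_at_top_mult_tendsto_pos[OF tendsto_const h filterlim_real_sequentially])
      have fl: "nat \<lfloor>real n * h / h\<rfloor> = n" for n using h by simp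
      have "\<forall>\<^sub>F t in at_top. \<bar>(\<Sum>i\<in>?A. site_profit P (conf b w) \<omega> i t) / t - \<nu>\<bar> < \<epsilon>"
        using tendstoD[OF elim(1) \<epsilon>(1)] by (simp add: dist_real_def)
      from eventually_compose_filterlim[OF this lim]
      have 1: "\<forall>\<^sub>F n in sequentially. \<bar>(\<Sum>i\<in>?A. site_profit P (conf b w) \<omega> i (real n * h)) / (real n * h) - \<nu>\<bar> < \<epsilon>" .
      have 2: "\<forall>\<^sub>F n in sequentially. \<bar>(\<Sum>i\<in>?A. ?sk i n) - S * R \<omega> n\<bar> \<le> C / L + \<epsilon>"
        using elim(2) \<epsilon>(1) odd unfolding sum_sgn_parity R_def S_def C_def h_def by simp
      have "\<forall>\<^sub>F n in sequentially. \<bar>site_profit P (conf b w) \<omega> i (real n * h) / (real n * h) - ?sk i n\<bar> \<le> 6 * h + \<epsilon>" for i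
        using eventually_compose_filterlim[OF elim(3)[rule_format, OF \<epsilon>(1), of i] lim] unfolding fl .
      then have 3: "\<forall>\<^sub>F n in sequentially. \<forall>i\<in>?A.
          \<bar>site_profit P (conf b w) \<omega> i (real n * h) / (real n * h) - ?sk i n\<bar> \<le> 6 * h + \<epsilon>"
        by (intro eventually_ball_finite) auto
      from 1 2 3 show ?case
      proof eventually_elim
        case (elim n)
        have "\<bar>\<Sum>i\<in>?A. site_profit P (conf b w) \<omega> i (real n * h) / (real n * h) - ?sk i n\<bar> \<le> (\<Sum>i\<in>?A. 6 * h + \<epsilon>)"
          by (rule order_trans[OF sum_abs sum_mono]) (use elim(3) in auto)
        also have "\<dots> = 6 * real N * h + real N * \<epsilon>" by (simp add: algebra_simps)
        finally have 4: "\<bar>(\<Sum>i\<in>?A. site_profit P (conf b w) \<omega> i (real n * h)) / (real n * h) - (\<Sum>i\<in>?A. ?sk i n)\<bar>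
            \<le> 6 * real N * h + real N * \<epsilon>"
          by (simp only: sum_subtractf sum_divide_distrib)
        have tri: "\<bar>z - \<nu>\<bar> \<le> 1 / 6"
          if "\<bar>u - v\<bar> \<le> 6 * real N * h + real N * \<epsilon>" "\<bar>u - \<nu>\<bar> < \<epsilon>" "\<bar>v - z\<bar> \<le> C / L + \<epsilon>" for u v z :: real
          using that small \<epsilon>(2) unfolding abs_le_iff abs_less_iff by linarith
        show ?case by (rule tri[OF 4 elim(1,2)])
      qed
    qed
  qed
  \<comment> \<open>The side is chosen against the sign of the supposed limit, so that no value of
    \<open>\<nu>\<close>, not even 0, escapes.\<close>
  define \<sigma> where "\<sigma> = (if S * \<nu> \<ge> 0 then - 1 else 1 :: real)"
  have \<sigma>: "\<bar>\<sigma>\<bar> = 1" "\<sigma> * (S * \<nu>) \<le> 0" by (simp_all add: \<sigma>_def)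
  define V where "V = {v. \<sigma> * side a N v = 1}"
  define E where "E n \<omega> \<longleftrightarrow> (\<forall>k\<le>2 * n. X P (conf b w) \<omega> (real (n + k) * h) \<in> conf b ` V)" for n \<omega>
  \<comment> \<open>On \<open>E n\<close> the wall is on the chosen side at \<open>2 * n\<close> of
    the first \<open>3 * n\<close> times and at worst on the wrong one at the other
    \<open>n\<close>. So the average in direction \<open>\<sigma>\<close> is at least 1/3, whereas
    the supposed limit in that direction is at most 0.\<close>
  have off: "\<not> E n \<omega>" if "n > 0" "\<bar>S * R \<omega> (3 * n) - \<nu>\<bar> \<le> 1 / 6" for n \<omega>
  proof
    assume En: "E n \<omega>"
    let ?g = "\<lambda>k. \<sigma> * lift b (side a N) (X P (conf b w) \<omega> (real k * h))"
    have s1: "\<bar>lift b (side a N) y\<bar> \<le> 1" for y by (rule lift_abs_le) (simp add: side_def)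
    have lo: "?g k \<ge> - 1" for k
    proof -
      have "\<bar>?g k\<bar> \<le> 1" using s1 by (simp only: abs_mult \<sigma>(1) mult_1)
      then show ?thesis by linarith
    qed
    have hi: "?g k = 1" if "k \<in> {n..<3 * n}" for k
    proof -
      have k: "k - n \<le> 2 * n" "n + (k - n) = k" using that by auto
      have "X P (conf b w) \<omega> (real k * h) \<in> conf b ` V"
        using En[unfolded E_def, rule_format, OF k(1)] unfolding k(2) .
      then obtain v where "v \<in> V" "X P (conf b w) \<omega> (real k * h) = conf b v" by (rule imageE)
      then show ?thesis by (simp add: V_def)
    qed
    have "(\<Sum>k<3 * n. ?g k) = (\<Sum>k<n. ?g k) + (\<Sum>k\<in>{n..<3 * n}. ?g k)"
      unfolding lessThan_atLeast0 by (rule sum.atLeastLessThan_concat[symmetric]) auto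
    moreover have "(\<Sum>k\<in>{n..<3 * n}. ?g k) = (\<Sum>k\<in>{n..<3 * n}. 1)" by (rule sum.cong[OF refl hi])
    moreover have "(\<Sum>k<n. ?g k) \<ge> (\<Sum>k<n. - 1)" by (rule sum_mono[OF lo])
    ultimately have "(\<Sum>k<3 * n. ?g k) \<ge> real n" by simp
    then have "\<sigma> * R \<omega> (3 * n) \<ge> real n / real (3 * n)"
      unfolding R_def skel_avg_def times_divide_eq_right sum_distrib_left by (rule divide_right_mono) simp
    then have 1: "\<sigma> * R \<omega> (3 * n) \<ge> 1 / 3" using that(1) by simp
    have "\<sigma> * (S * (S * R \<omega> (3 * n) - \<nu>)) = \<sigma> * ((S * S) * R \<omega> (3 * n)) - \<sigma> * (S * \<nu>)" by (simp add: algebra_simps)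
    also have "\<dots> \<ge> 1 / 3" using 1 \<sigma>(2) unfolding S2 by simp
    finally have "1 / 3 \<le> \<bar>\<sigma> * (S * (S * R \<omega> (3 * n) - \<nu>))\<bar>" by linarith
    also have "\<dots> = \<bar>S * R \<omega> (3 * n) - \<nu>\<bar>"
    proof -
      have "\<bar>S\<bar> = 1" by (simp add: S_def sgn_parity_def)
      then show ?thesis by (simp only: abs_mult \<sigma>(1) mult_1)
    qed
    finally show False using that(2) by simp
  qed
  have E_meas: "(\<lambda>\<omega>. of_bool (E n \<omega>) :: real) \<in> borel_measurable noise_law" for n
  proof -
    have "conf b ` V \<in> sets config_space" by (rule conf_range_sets) auto
    then have "Measurable.pred noise_law (E n)"
      unfolding E_def[abs_def] by (rule pred_X_in[OF _ measurable_const measurable_ident_sets[OF refl]]) simp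
    then show ?thesis by (rule measurable_of_bool_pred)
  qed
  \<comment> \<open>Almost surely \<open>E n\<close> fails for all large \<open>n\<close>, so its
    probability tends to 0, against the lower bound of \<open>escape_probability\<close>.\<close>
  have "(\<lambda>n. \<integral>\<omega>. of_bool (E n \<omega>) \<partial>noise_law) \<longlonglongrightarrow> (\<integral>\<omega>. (0 :: real) \<partial>noise_law)"
  proof (rule integral_dominated_convergence[where w="\<lambda>_. 1"])
    show "AE \<omega> in noise_law. (\<lambda>n. of_bool (E n \<omega>) :: real) \<longlonglongrightarrow> 0"
      using near
    proof eventually_elim
      case (elim \<omega>)
      have "filterlim (\<lambda>n :: nat. 3 * n) sequentially sequentially"
        by (rule filterlim_subseq) (simp add: strict_mono_def)
      from eventually_compose_filterlim[OF elim this]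
      have "\<forall>\<^sub>F n in sequentially. \<bar>S * R \<omega> (3 * n) - \<nu>\<bar> \<le> 1 / 6" .
      then have "\<forall>\<^sub>F n in sequentially. of_bool (E n \<omega>) = (0 :: real)"
        using eventually_gt_at_top[of 0]
      proof eventually_elim
        case (elim n)
        show ?case using off[OF elim(2,1)] by simp
      qed
      then show ?case by (rule tendsto_eventually)
    qed
  qed (use E_meas in auto)
  then have "(\<lambda>n. \<integral>\<omega>. of_bool (E n \<omega>) \<partial>noise_law) \<longlonglongrightarrow> (0 :: real)" by simp
  moreover have "\<forall>\<^sub>F n in sequentially. exp (- 3 * K0) \<le> (\<integral>\<omega>. of_bool (E n \<omega>) \<partial>noise_law)"
  proof -
    \<comment> \<open>A displacement from \<open>w\<close> by more than \<open>r\<close> clears the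
      ensemble and its neighbouring sites, and \<open>r \<le> sqrt (real n * h)\<close> for large
      \<open>n\<close>.\<close>
    define r where "r = real_of_int (\<bar>a\<bar> + int N + 2 + \<bar>w\<bar>)"
    have "filterlim (\<lambda>n. real n * h) at_top sequentially"
      by (rule filterlim_at_top_mult_tendsto_pos[OF tendsto_const h filterlim_real_sequentially])
    then have "\<forall>\<^sub>F n in sequentially. max 1 (r^2) \<le> real n * h"
      by (simp only: filterlim_at_top)
    then show ?thesis
    proof eventually_elim
      case (elim n)
      then have n: "1 \<le> real n * h" "r^2 \<le> real n * h" by auto
      have r: "r \<le> sqrt (real n * h)" using n(2) by (rule real_le_rsqrt)
      show ?case
        unfolding E_def
      proof (rule escape_probability[OF h n(1) \<sigma>(1)])
        fix w' assume "\<sigma> * (real_of_int w' - real_of_int w) > 2 * sqrt (real n * h)"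
        moreover have "sqrt (real n * h) \<ge> 0" using n(1) by simp
        ultimately have "\<sigma> * (real_of_int w' - real_of_int w) > r" using r by linarith
        moreover have "w' \<ge> a + int N" if "real_of_int w' - real_of_int w > r" using that unfolding r_def by linarith
        moreover have "w' \<le> a - 2" if "- (real_of_int w' - real_of_int w) > r" using that unfolding r_def by linarith
        ultimately show "w' \<in> V" unfolding V_def \<sigma>_def side_def by (cases "S * \<nu> \<ge> 0") auto
      qed
    qed
  qed
  ultimately have "exp (- 3 * K0) \<le> 0" by (intro tendsto_lowerbound[OF _ _ sequentially_bot]) auto
  then show False by (simp add: not_le[symmetric])
qed

end

subsection \<open>The ensemble in the spin system\<close>

lemma profit_per_player_smp:
  "good \<omega> \<Longrightarrow> profit_per_player q A (smp x \<omega>) t / t = (\<Sum>i\<in>A. site_profit q x \<omega> i t) / t / real (card A)"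
  by (simp add: profit_per_player_def wins_smp site_profit_def mult.commute)

lemma has_mean_profitI:
  assumes \<nu>: "concentrated_on_S \<nu>" and A: "A \<noteq> {}" "finite A"
    and lim: "\<And>b w. AE \<omega> in noise_law. ((\<lambda>t. (\<Sum>i\<in>A. site_profit q (conf b w) \<omega> i t) / t) \<longlongrightarrow> real (card A) * \<mu>) at_top"
  shows "has_mean_profit q \<nu> A \<mu>"
  unfolding has_mean_profit_def
proof (rule AE_sample_spaceI[OF \<nu>])
  fix b w
  have c: "real (card A) \<noteq> 0" using A by simp
  from AE_good lim[of b w]
  show "AE \<omega> in noise_law. ((\<lambda>t. profit_per_player q A (smp (conf b w) \<omega>) t / t) \<longlongrightarrow> \<mu>) at_top"
  proof eventually_elim
    case (elim \<omega>)
    from tendsto_divide[OF elim(2) tendsto_const c] c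
    show ?case by (simp add: profit_per_player_smp[OF elim(1)])
  qed
qed

lemma has_mean_profitD:
  assumes \<nu>: "concentrated_on_S \<nu>" and A: "A \<noteq> {}" "finite A" and mean: "has_mean_profit q \<nu> A \<mu>"
  obtains b w where
    "AE \<omega> in noise_law. ((\<lambda>t. (\<Sum>i\<in>A. site_profit q (conf b w) \<omega> i t) / t) \<longlongrightarrow> real (card A) * \<mu>) at_top"
proof -
  have c: "real (card A) \<noteq> 0" using A by simp
  obtain b w where bw: "AE \<omega> in noise_law. ((\<lambda>t. profit_per_player q A (smp (conf b w) \<omega>) t / t) \<longlongrightarrow> \<mu>) at_top"
    using mean unfolding has_mean_profit_def by (rule AE_sample_spaceD[OF \<nu>])
  show thesis
  proof (rule that)
    from AE_good bw
    show "AE \<omega> in noise_law. ((\<lambda>t. (\<Sum>i\<in>A. site_profit q (conf b w) \<omega> i t) / t) \<longlongrightarrow> real (card A) * \<mu>) at_top"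
    proof eventually_elim
      case (elim \<omega>)
      from tendsto_mult[OF tendsto_const elim(2), of "real (card A)"] c
      show ?case by (simp add: profit_per_player_smp[OF elim(1)])
    qed
  qed
qed

lemma finite_consecutive: "finite (consecutive a N)" "N \<ge> 1 \<Longrightarrow> consecutive a N \<noteq> {}"
  by (auto simp: consecutive_def)

theorem theorem15:
  fixes p :: game and N :: nat
  assumes "p 0 = 1" and "p 1 = p 2" and "1 / 2 < p 1" and "p 1 < 1" and "p 3 = 0"
    and "N \<ge> 1"
  shows "(even N \<longrightarrow>
            (\<forall>\<nu> a. concentrated_on_S \<nu> \<longrightarrow> has_mean_profit p \<nu> (consecutive a N) 0))
       \<and> (odd N \<longrightarrow>
            (\<forall>\<nu> a. concentrated_on_S \<nu> \<longrightarrow> \<not> (\<exists>\<mu>. has_mean_profit p \<nu> (consecutive a N) \<mu>)))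
       \<and> (\<exists>\<mu>>0. \<forall>\<nu> a. concentrated_on_S \<nu> \<longrightarrow>
            has_mean_profit (game_C p) \<nu> (consecutive a N) \<mu>)
       \<and> (\<forall>\<nu> a. concentrated_on_S \<nu> \<longrightarrow>
            (parrondo_effect p \<nu> (consecutive a N) \<longleftrightarrow> even N))"
proof -
  interpret game_B p "p 1" by unfold_locales (use assms in auto)
  note fin = finite_consecutive(1) finite_consecutive(2)[OF \<open>N \<ge> 1\<close>]
  have B_even: "has_mean_profit p \<nu> (consecutive a N) 0" if "even N" "concentrated_on_S \<nu>" for \<nu> a
    using even_profit[OF that(1)] by (intro has_mean_profitI[OF that(2) fin(2,1)]) (simp add: consecutive_def)
  have B_odd: "\<not> has_mean_profit p \<nu> (consecutive a N) \<mu>" if N: "odd N" and \<nu>: "concentrated_on_S \<nu>" for \<nu> a \<mu>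
  proof
    assume "has_mean_profit p \<nu> (consecutive a N) \<mu>"
    then obtain b w where "AE \<omega> in noise_law. ((\<lambda>t. (\<Sum>i\<in>consecutive a N. site_profit p (conf b w) \<omega> i t) / t)
        \<longlongrightarrow> real (card (consecutive a N)) * \<mu>) at_top"
      by (rule has_mean_profitD[OF \<nu> fin(2,1)])
    then show False using odd_profit[OF N] unfolding consecutive_def by blast
  qed
  \<comment> \<open>Since \<open>p 1\<close> lies between 1/2 and 1, the value \<open>r\<close> lies
    between 1/2 and 3/4; the lower bound drives the profit and the upper one the loss of
    memory.\<close>
  have "\<exists>\<mu>>0. \<forall>x i. AE \<omega> in noise_law. ((\<lambda>t. site_profit (game_C p) x \<omega> i t / t) \<longlongrightarrow> \<mu>) at_top"
    by (rule game_C_profit[where r="(1 / 2 + p 1) / 2"]) (use assms in \<open>auto simp: game_C_def\<close>)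
  then obtain \<mu> where \<mu>: "\<mu> > 0"
    and site: "\<And>x i. AE \<omega> in noise_law. ((\<lambda>t. site_profit (game_C p) x \<omega> i t / t) \<longlongrightarrow> \<mu>) at_top"
    by blast
  have C: "has_mean_profit (game_C p) \<nu> (consecutive a N) \<mu>" if "concentrated_on_S \<nu>" for \<nu> a
  proof (rule has_mean_profitI[OF that fin(2,1)])
    fix b w
    have "AE \<omega> in noise_law. \<forall>i. ((\<lambda>t. site_profit (game_C p) (conf b w) \<omega> i t / t) \<longlongrightarrow> \<mu>) at_top"
      unfolding AE_all_countable by (intro allI site)
    then show "AE \<omega> in noise_law. ((\<lambda>t. (\<Sum>i\<in>consecutive a N. site_profit (game_C p) (conf b w) \<omega> i t) / t)
        \<longlongrightarrow> real (card (consecutive a N)) * \<mu>) at_top"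
    proof eventually_elim
      case (elim \<omega>)
      have "((\<lambda>t. \<Sum>i\<in>consecutive a N. site_profit (game_C p) (conf b w) \<omega> i t / t)
          \<longlongrightarrow> (\<Sum>i\<in>consecutive a N. \<mu>)) at_top"
        by (rule tendsto_sum) (use elim in blast)
      then show ?case by (simp add: sum_divide_distrib)
    qed
  qed
  have "parrondo_effect p \<nu> (consecutive a N) \<longleftrightarrow> even N" if "concentrated_on_S \<nu>" for \<nu> a
  proof
    assume "parrondo_effect p \<nu> (consecutive a N)"
    \<comment> \<open>For odd \<open>N\<close> the mean profit of game B does not exist, which
      excludes the effect regardless of signs.\<close>
    then show "even N" unfolding parrondo_effect_def using B_odd[OF _ that] by blast
  next
    assume "even N"
    from B_even[OF this that] C[OF that] \<mu> show "parrondo_effect p \<nu> (consecutive a N)"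
      unfolding parrondo_effect_def by (intro exI[of _ 0] exI[of _ \<mu>]) simp
  qed
  with B_even B_odd C \<mu> show ?thesis by blast
qed

end
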